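(* Let $T$ and $T'$ be two zonotopal tilings of the same convex polygon $P$, such that both tilings are dual to simplicial pseudoline arrangements that include the line at infinity, and such that overlaying the vertices and edges of $T$ and $T'$ produces a third zonotopal tiling $T''$ of $P$. Form a planar graph $G$ from the disjoint union of the graph of $T$ and the graph of the central reflection of $T'$ by connecting, by an edge, each vertex (corner) of the outer polygon $P$ of $T$ with the corresponding vertex (corner) of the outer polygon of the central reflection of $T'$. Then $G$ is a cubic partial cube.
   Context: A partial cube is an undirected graph whose vertices can be labeled by binary vectors (of a common length) in such a way that the graph distance between any two vertices equals the Hamming distance between their labels. A graph is cubic if every vertex has degree exactly three. A pseudoline arrangement is a finite collection of curves in the real projective plane, each topologically equivalent to a line (closed, non-self-crossing, non-contractible), any two of which have a single point in common, at which they cross. It is simplicial if every connected component of the complement of the curves (cell) is a triangle, i.e. is bounded by three sides belonging to three of the curves. Pseudolines meeting on the line at infinity are called parallel. A zonotopal tiling of a centrally symmetric convex polygon $P$ is an edge-to-edge partition of $P$ into finitely many smaller centrally symmetric convex polygons. It is regarded as a straight-line planar drawing of a graph (the graph of the tiling), in which all edges have unit length and every bounded face is a centrally symmetric strictly convex polygon having the vertices of the drawing on its boundary as its corners. A side of $P$ may be subdivided by vertices of the tiling into several unit edges. A zonotopal tiling $T$ is dual to an arrangement $A$ that includes the line at infinity when it is a drawing of the dual graph of the affine part of $A$ (i.e. of $A$ without the line at infinity, in the affine plane), drawn as the planar dual: its vertices correspond to the cells of the affine arrangement, its edges to pairs of cells adjacent along one of the finite pseudolines, and its tiles to the finite crossing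 points of the arrangement; all edges dual to a given pseudoline are parallel unit segments, and parallel pseudolines have parallel dual edges. When $A$ is simplicial, every vertex of such a tiling has degree three, except the corners of $P$, which have degree two. Overlaying $T$ and $T'$ means taking the drawing on $P$ whose vertex set is the union of the vertex sets, and whose edge set is the union of the edge sets, of the two drawings. The central reflection of $T'$ is its image under the point reflection through the center of $P$; it is again a tiling of $P$. The corner of $P$ in $T$ and the corner of $P$ in the reflected copy of $T'$ that are located at the same point of $P$ correspond to each other; thus each corner $p$ of $P$ in $T$ is joined to the vertex of the reflected tiling located at $p$, that is, the image of the vertex of $T'$ at the corner of $P$ opposite to $p$. *)

theory Defs
  imports "HOL-Analysis.Analysis"
begin

section \<open>Undirected graphs\<close>

record 'v ugraph =
  verts :: "'v set"
  edges :: "'v set set"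

definition simple_graph :: "'v ugraph \<Rightarrow> bool" where
  "simple_graph G \<longleftrightarrow>
    (\<forall>e\<in>edges G. \<exists>u\<in>verts G. \<exists>v\<in>verts G. u \<noteq> v \<and> e = {u, v})"

definition vertex_degree :: "'v ugraph \<Rightarrow> 'v \<Rightarrow> nat" where
  "vertex_degree G v = card {e \<in> edges G. v \<in> e}"

definition cubic :: "'v ugraph \<Rightarrow> bool" where
  "cubic G \<longleftrightarrow> simple_graph G \<and> (\<forall>v\<in>verts G. vertex_degree G v = 3)"

definition walk_betw :: "'v ugraph \<Rightarrow> 'v \<Rightarrow> 'v list \<Rightarrow> 'v \<Rightarrow> bool" where
  "walk_betw G u xs v \<longleftrightarrow>
    xs \<noteq> [] \<and> set xs \<subseteq> verts G \<and> hd xs = u \<and> last xs = v \<and>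
    successively (\<lambda>x y. {x, y} \<in> edges G) xs"

text \<open>The distance is \<open>\<infinity>\<close> between vertices not joined by a walk, so partial
  cubes, as defined below, are connected.\<close>

definition graph_dist :: "'v ugraph \<Rightarrow> 'v \<Rightarrow> 'v \<Rightarrow> enat" where
  "graph_dist G u v = (INF xs \<in> {xs. walk_betw G u xs v}. enat (length xs - 1))"

definition hamming_dist :: "bool list \<Rightarrow> bool list \<Rightarrow> nat" where
  "hamming_dist xs ys = card {i. i < length xs \<and> xs ! i \<noteq> ys ! i}"

definition partial_cube :: "'v ugraph \<Rightarrow> bool" where
  "partial_cube G \<longleftrightarrow> simple_graph G \<and>
    (\<exists>(n::nat) label.
      (\<forall>v\<in>verts G. length (label v) = n) \<and>
      (\<forall>u\<in>verts G. \<forall>v\<in>verts G.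
        graph_dist G u v = enat (hamming_dist (label u) (label v))))"

definition planar :: "'v ugraph \<Rightarrow> bool" where
  "planar G \<longleftrightarrow> simple_graph G \<and>
    (\<exists>(pos :: 'v \<Rightarrow> complex) (\<gamma> :: 'v set \<Rightarrow> real \<Rightarrow> complex).
      inj_on pos (verts G) \<and>
      (\<forall>e\<in>edges G. arc (\<gamma> e) \<and> {pathstart (\<gamma> e), pathfinish (\<gamma> e)} = pos ` e \<and>
        path_image (\<gamma> e) \<inter> pos ` verts G = pos ` e) \<and>
      (\<forall>e\<in>edges G. \<forall>e'\<in>edges G. e \<noteq> e' \<longrightarrow>
        path_image (\<gamma> e) \<inter> path_image (\<gamma> e') = pos ` (e \<inter> e')))"

section \<open>The real projective plane\<close>

text \<open>The projective plane is modelled as the unit sphere of \<open>\<real>\<^sup>3\<close> modulo antipodes,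
  realized as a subspace of a Euclidean space by sending the line spanned by a unit
  vector \<open>x\<close> to the orthogonal projection \<open>x x\<^sup>T\<close> onto it. The sphere being compact,
  the subspace topology is the quotient topology.\<close>

definition proj_point :: "real^3 \<Rightarrow> real^3^3" where
  "proj_point x = (\<chi> i j. x $ i * x $ j)"

definition proj_plane :: "(real^3^3) set" where
  "proj_plane = proj_point ` sphere 0 1"

lemma proj_point_eq_iff:
  assumes "x \<in> sphere 0 1" "y \<in> sphere 0 1"
  shows "proj_point x = proj_point y \<longleftrightarrow> x = y \<or> x = - y"
proof
  assume eq: "proj_point x = proj_point y"
  have "x $ i * x $ j = y $ i * y $ j" for i j
    using arg_cong[OF eq, of "\<lambda>m. m $ i $ j"] by (simp add: proj_point_def)
  then have "(x \<bullet> y) *\<^sub>R x = y"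
  proof -
    assume *: "\<And>i j. x $ i * x $ j = y $ i * y $ j"
    have "((x \<bullet> y) *\<^sub>R x) $ j = y $ j" for j
    proof -
      have "((x \<bullet> y) *\<^sub>R x) $ j = (\<Sum>i\<in>UNIV. (x $ i * x $ j) * y $ i)"
        by (simp add: inner_vec_def sum_distrib_left mult_ac)
      also have "\<dots> = (y \<bullet> y) * y $ j"
        by (simp add: * inner_vec_def sum_distrib_left mult_ac)
      also have "\<dots> = y $ j"
        using assms by (simp add: dot_square_norm)
      finally show ?thesis .
    qed
    then show ?thesis by (simp add: vec_eq_iff)
  qed
  moreover from this have "\<bar>x \<bullet> y\<bar> = 1"
    using assms by (metis mem_sphere_0 mult.right_neutral norm_scaleR)
  ultimately show "x = y \<or> x = - y"
    by (metis abs_eq_iff' abs_1 scaleR_minus1_left scaleR_one minus_minus)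
next
  assume "x = y \<or> x = - y"
  then show "proj_point x = proj_point y" by (auto simp: proj_point_def)
qed

definition proj_line :: "real^3 \<Rightarrow> (real^3^3) set" where
  "proj_line a = proj_point ` {x \<in> sphere 0 1. a \<bullet> x = 0}"

definition line_at_infinity :: "(real^3^3) set" where
  "line_at_infinity = proj_line (axis 3 1)"

section \<open>Pseudoline arrangements\<close>

text \<open>Topological equivalence with a line is meant inside the projective plane: a
  homeomorphism of the plane carries a line to the curve. Such a curve is in particular
  closed, non-self-crossing and non-contractible.\<close>

definition pseudoline :: "(real^3^3) set \<Rightarrow> bool" where
  "pseudoline L \<longleftrightarrow>
    (\<exists>h k a. a \<noteq> 0 \<and> homeomorphism proj_plane proj_plane h k \<and> L = h ` proj_line a)"

text \<open>Two curves cross at \<open>p\<close> if near \<open>p\<close> they look like the two coordinate axes.\<close>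

definition crosses_at :: "(real^3^3) set \<Rightarrow> (real^3^3) set \<Rightarrow> real^3^3 \<Rightarrow> bool" where
  "crosses_at L M p \<longleftrightarrow>
    (\<exists>U h k. openin (top_of_set proj_plane) U \<and> p \<in> U \<and>
      homeomorphism U (UNIV :: complex set) h k \<and> h p = 0 \<and>
      h ` (L \<inter> U) = {z. Im z = 0} \<and> h ` (M \<inter> U) = {z. Re z = 0})"

definition pseudoline_arrangement :: "(real^3^3) set set \<Rightarrow> bool" where
  "pseudoline_arrangement A \<longleftrightarrow> finite A \<and> (\<forall>L\<in>A. pseudoline L) \<and>
    (\<forall>L\<in>A. \<forall>M\<in>A. L \<noteq> M \<longrightarrow> (\<exists>p. L \<inter> M = {p} \<and> crosses_at L M p))"

definition cells :: "(real^3^3) set set \<Rightarrow> (real^3^3) set set" where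
  "cells A = components (proj_plane - \<Union>A)"

definition triangular_cell :: "(real^3^3) set set \<Rightarrow> (real^3^3) set \<Rightarrow> bool" where
  "triangular_cell A C \<longleftrightarrow>
    (\<exists>(a::complex) b c h k. \<exists>L\<in>A. \<exists>M\<in>A. \<exists>N\<in>A.
      \<not> collinear {a, b, c} \<and> L \<noteq> M \<and> M \<noteq> N \<and> L \<noteq> N \<and>
      homeomorphism (convex hull {a, b, c}) (closure C) h k \<and>
      h ` interior (convex hull {a, b, c}) = C \<and>
      h ` closed_segment a b \<subseteq> L \<and> h ` closed_segment b c \<subseteq> M \<and>
      h ` closed_segment c a \<subseteq> N)"

definition simplicial :: "(real^3^3) set set \<Rightarrow> bool" where
  "simplicial A \<longleftrightarrow> (\<forall>C\<in>cells A. triangular_cell A C)"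

section \<open>Zonotopal tilings\<close>

definition point_reflection :: "complex \<Rightarrow> complex \<Rightarrow> complex" where
  "point_reflection c x = 2 * c - x"

definition corners :: "complex set \<Rightarrow> complex set" where
  "corners Q = {p. p extreme_point_of Q}"

definition symmetric_polygon :: "complex set \<Rightarrow> bool" where
  "symmetric_polygon Q \<longleftrightarrow>
    polytope Q \<and> interior Q \<noteq> {} \<and> (\<exists>c. point_reflection c ` Q = Q)"

text \<open>A straight-line drawing is a graph whose vertices are points of the plane; an edge
  \<open>e = {u, v}\<close> is drawn as the segment \<open>convex hull e\<close>.\<close>

definition drawn :: "complex ugraph \<Rightarrow> complex set" where
  "drawn T = verts T \<union> (\<Union>e\<in>edges T. convex hull e)"

definition planar_drawing :: "complex ugraph \<Rightarrow> bool" where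
  "planar_drawing T \<longleftrightarrow> finite (verts T) \<and> simple_graph T \<and>
    (\<forall>e\<in>edges T. convex hull e \<inter> verts T = e) \<and>
    (\<forall>e\<in>edges T. \<forall>e'\<in>edges T. e \<noteq> e' \<longrightarrow> convex hull e \<inter> convex hull e' = e \<inter> e')"

definition bounded_faces :: "complex ugraph \<Rightarrow> complex set set" where
  "bounded_faces T = {F \<in> components (- drawn T). bounded F}"

definition zonotopal_tiling :: "complex set \<Rightarrow> complex ugraph \<Rightarrow> bool" where
  "zonotopal_tiling P T \<longleftrightarrow> symmetric_polygon P \<and> planar_drawing T \<and>
    (\<forall>u v. {u, v} \<in> edges T \<longrightarrow> dist u v = 1) \<and>
    (\<forall>F\<in>bounded_faces T. \<exists>Q. F = interior Q \<and> symmetric_polygon Q \<and>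
      verts T \<inter> frontier Q = corners Q) \<and>
    P = drawn T \<union> \<Union>(bounded_faces T)"

definition overlay :: "complex ugraph \<Rightarrow> complex ugraph \<Rightarrow> complex ugraph" where
  "overlay T T' = \<lparr>verts = verts T \<union> verts T', edges = edges T \<union> edges T'\<rparr>"

section \<open>Duality of tilings and arrangements\<close>

text \<open>Two cells are adjacent along \<open>L\<close> if they share a boundary point lying on \<open>L\<close> and on
  no other curve of the arrangement.\<close>

definition adjacent_along ::
  "(real^3^3) set set \<Rightarrow> (real^3^3) set \<Rightarrow> (real^3^3) set \<Rightarrow> (real^3^3) set \<Rightarrow> bool" where
  "adjacent_along A L C D \<longleftrightarrow> C \<in> cells A \<and> D \<in> cells A \<and> C \<noteq> D \<and>
    (\<exists>p \<in> closure C \<inter> closure D \<inter> L. \<forall>M\<in>A. p \<in> M \<longrightarrow> M = L)"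

definition finite_pseudolines :: "(real^3^3) set set \<Rightarrow> (real^3^3) set set" where
  "finite_pseudolines A = A - {line_at_infinity}"

definition finite_crossings :: "(real^3^3) set set \<Rightarrow> (real^3^3) set" where
  "finite_crossings A =
    {p. p \<notin> line_at_infinity \<and> (\<exists>L\<in>A. \<exists>M\<in>A. L \<noteq> M \<and> p \<in> L \<inter> M)}"

text \<open>For an arrangement containing the line at infinity, \<open>cells\<close> are the cells of its
  affine part. In the parallelism condition the case \<open>L = L'\<close> is included: every
  pseudoline meets the line at infinity, so all edges dual to one pseudoline are parallel.\<close>

definition dual_tiling :: "complex ugraph \<Rightarrow> (real^3^3) set set \<Rightarrow> bool" where
  "dual_tiling T A \<longleftrightarrow> line_at_infinity \<in> A \<and>
    (\<exists>f g. bij_betw f (cells A) (verts T) \<and>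
      edges T = {{f C, f D} | C D. \<exists>L\<in>finite_pseudolines A. adjacent_along A L C D} \<and>
      (\<forall>L\<in>finite_pseudolines A. \<forall>L'\<in>finite_pseudolines A. \<forall>C D C' D'.
        L \<inter> L' \<inter> line_at_infinity \<noteq> {} \<longrightarrow>
        adjacent_along A L C D \<longrightarrow> adjacent_along A L' C' D' \<longrightarrow>
        collinear {0, f D - f C, f D' - f C'}) \<and>
      bij_betw g (finite_crossings A) (bounded_faces T) \<and>
      (\<forall>p\<in>finite_crossings A.
        verts T \<inter> frontier (g p) = f ` {C \<in> cells A. p \<in> closure C}))"

section \<open>Gluing a tiling to a reflected tiling\<close>

definition center :: "complex set \<Rightarrow> complex" where
  "center P = (THE c. point_reflection c ` P = P)"

definition central_reflection :: "complex set \<Rightarrow> complex ugraph \<Rightarrow> complex ugraph" where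
  "central_reflection P T =
    \<lparr>verts = point_reflection (center P) ` verts T,
     edges = (\<lambda>e. point_reflection (center P) ` e) ` edges T\<rparr>"

definition join_at_corners ::
  "complex set \<Rightarrow> complex ugraph \<Rightarrow> complex ugraph \<Rightarrow> (complex + complex) ugraph" where
  "join_at_corners P S R =
    \<lparr>verts = verts S <+> verts R,
     edges = (\<lambda>e. Inl ` e) ` edges S \<union> (\<lambda>e. Inr ` e) ` edges R \<union>
       {{Inl p, Inr p} | p. p \<in> corners P}\<rparr>"

end

theory Submission
  imports Defs
begin

text \<open>
  The graph \<open>G\<close> consists of two discs, the tiling \<open>T\<close> and the reflected tiling \<open>T'\<close>, whose outer
  corners are joined. Each of the three claims has its own reason.

  \<^emph>\<open>Partial cube.\<close> Every edge direction \<open>d\<close> of the overlay carries a height function \<open>N d\<close> on the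
  vertices: it grows by one along each edge with direction \<open>d\<close> and is constant along all edges that
  are not parallel to \<open>d\<close> (\<open>potential_exists\<close>). It counts the \<open>d\<close>-steps on ascending paths for a
  generic linear functional. The count does not depend on the path because two neighbouring ascending
  edges span a tile, and the two ways around a centrally symmetric tile are reflections of each other
  (\<open>tile_diamond\<close>). The heights of the overlay restrict to both \<open>T\<close> and \<open>T'\<close>.

  The edges parallel to \<open>d\<close> at one height form a zone: crossing a tile from an edge to the opposite
  edge is an injective step, all zones run into one side of the polygon, and on that side every height
  occurs once. Hence all these edges lie on a single chain (\<open>zone_comparable\<close>). So a path that crosses
  a zone forth and back can be shortened along the border of the zone, and graph distance in a tiling
  is the sum of the height differences (\<open>geodesic\<close>). The thresholds \<open>t \<le> N d v\<close> are therefore Hamming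
  labels for a single tiling. For \<open>G\<close>, the reflected tiling gets the complementary bits, and one more
  bit tells the two tilings apart.

  Let \<open>v\<close> be a vertex of \<open>T\<close> and \<open>w\<close> one of \<open>T'\<close>. A path in \<open>G\<close> from \<open>v\<close> to the reflection of \<open>w\<close>
  passes through a corner, and it is short enough if this corner lies on the side of \<open>v\<close> of every zone that
  separates \<open>v\<close> from \<open>w\<close> in the overlay, where both are vertices. No three of these zones have directions that positively
  span the plane (\<open>no_positively_spanning_triple\<close>), because such zones cannot have both a common
  region below them and a common region above them. By Caratheodory the separating directions lie in an
  open half-plane (\<open>separating_halfplane\<close>), and the corner that is highest in the direction of this
  half-plane is the required one (\<open>corner_between\<close>).

  \<^emph>\<open>Cubic.\<close> The tiles at the vertex dual to a cell correspond to the finite crossings on the boundary of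
  the cell, that is, to the corners of a triangle that are not at infinity
  (\<open>crossing_corner\<close>), and its edges to the sides that are not at infinity
  (\<open>adjacent_unique\<close>). If one side is at infinity, there is one tile and the
  vertex is a corner of degree two. Otherwise there are two or three tiles, which forces three edges; the
  vertex is not a corner because two of its edges are opposite, or because its three tiles would overlap.

  \<^emph>\<open>Planar.\<close> The polygon is mapped to the unit disc. One tiling is drawn inside, the other one outside after
  an inversion, and the corners are joined by radial segments (\<open>planar_join\<close>).
\<close>

section \<open>Plane geometry of convex polygons\<close>

text \<open>The planar determinant: positive when the second vector points to the left of the first.\<close>

definition wedge :: "complex \<Rightarrow> complex \<Rightarrow> real" where
  "wedge a b = Re a * Im b - Im a * Re b"

lemma inner_i_times: "(\<i> * a) \<bullet> b = wedge a b"
  by (simp add: wedge_def inner_complex_def)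

lemma wedge_lin:
  "wedge (a + b) c = wedge a c + wedge b c" "wedge a (b + c) = wedge a b + wedge a c"
  "wedge (a - b) c = wedge a c - wedge b c" "wedge a (b - c) = wedge a b - wedge a c"
  "wedge (- a) b = - wedge a b" "wedge a (- b) = - wedge a b"
  "wedge (r *\<^sub>R a) b = r * wedge a b" "wedge a (r *\<^sub>R b) = r * wedge a b"
  by (simp_all add: wedge_def algebra_simps)

lemma wedge_0 [simp]: "wedge a a = 0" "wedge a 0 = 0" "wedge 0 a = 0"
  by (simp_all add: wedge_def)

lemma wedge_commute: "wedge a b = - wedge b a"
  by (simp add: wedge_def)

text \<open>Cramer's rule. It turns sign conditions on determinants into membership in the cone spanned by
  two vectors, which is how angular positions are handled throughout.\<close>

lemma wedge_cramer: "wedge a b *\<^sub>R x = wedge x b *\<^sub>R a + wedge a x *\<^sub>R b"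
  by (simp add: wedge_def complex_eq_iff algebra_simps)

lemma wedge_cramer_inner: "wedge a b * (c \<bullet> x) = wedge x b * (c \<bullet> a) + wedge a x * (c \<bullet> b)"
  by (simp add: wedge_def inner_complex_def algebra_simps)

text \<open>The three-term Pluecker relation. It transports the relation of lying between two directions.\<close>

lemma wedge_exchange: "wedge a b * wedge x y = wedge x b * wedge a y + wedge a x * wedge b y"
  by (simp add: wedge_def algebra_simps)

lemma convex_wedge_ge: "convex {z. wedge a (z - b) \<ge> 0}" "convex {z. wedge a (z - b) > 0}"
proof -
  have "{z. wedge a (z - b) \<ge> 0} = {z. (\<i> * a) \<bullet> z \<ge> wedge a b}"
    "{z. wedge a (z - b) > 0} = {z. (\<i> * a) \<bullet> z > wedge a b}"
    by (auto simp: inner_i_times wedge_lin)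
  then show "convex {z. wedge a (z - b) \<ge> 0}" "convex {z. wedge a (z - b) > 0}"
    by (simp_all add: convex_halfspace_ge convex_halfspace_gt)
qed

lemma wedge_eq_0_scale:
  assumes "wedge a b = 0" "a \<noteq> 0"
  obtains r where "b = r *\<^sub>R a"
proof -
  let ?r = "(a \<bullet> b) / (a \<bullet> a)"
  have "(a \<bullet> a) *\<^sub>R b = (a \<bullet> b) *\<^sub>R a + wedge a b *\<^sub>R (\<i> * a)"
    by (simp add: wedge_def complex_eq_iff inner_complex_def algebra_simps)
  then have eq: "(a \<bullet> a) *\<^sub>R b = (a \<bullet> b) *\<^sub>R a" using assms by simp
  have "b = (1 / (a \<bullet> a)) *\<^sub>R ((a \<bullet> a) *\<^sub>R b)" using assms(2) by simp
  also have "\<dots> = ?r *\<^sub>R a" unfolding eq by simp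
  finally have "b = ?r *\<^sub>R a" .
  then show ?thesis using that by blast
qed

lemma wedge_eq_0_unit:
  assumes "wedge a b = 0" "norm a = 1" "norm b = 1"
  shows "b = a \<or> b = - a"
proof -
  have "a \<noteq> 0" using assms by auto
  then obtain r where r: "b = r *\<^sub>R a" using wedge_eq_0_scale assms(1) by metis
  then have "\<bar>r\<bar> = 1" using assms by simp
  then show ?thesis using r by (auto simp: abs_if split: if_splits)
qed

text \<open>At a point in the relative interior of a side, a convex body with an interior point to the left of
  the side contains a small half disc: a short step to the left is a convex combination of a point of the side and
  the given interior point.\<close>

lemma convex_half_disc:
  fixes p q w c :: complex
  assumes Q: "convex Q" "p \<in> Q" "q \<in> Q" "c \<in> interior Q"
    and c: "wedge (q - p) (c - p) > 0" and w: "wedge (q - p) w > 0"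
    and m: "m = p + \<theta> *\<^sub>R (q - p)" "0 < \<theta>" "\<theta> < 1"
  obtains \<delta>0 where "\<delta>0 > 0" "\<And>\<delta>. 0 < \<delta> \<Longrightarrow> \<delta> < \<delta>0 \<Longrightarrow> m + \<delta> *\<^sub>R w \<in> interior Q"
proof -
  define s where "s = q - p"
  have sm: "wedge s (c - m) = wedge s (c - p)" by (simp add: m s_def algebra_simps wedge_lin wedge_commute[of q p])
  define k where "k = wedge s (c - m)"
  have k: "k > 0" using c sm by (simp add: k_def s_def)
  define \<alpha> where "\<alpha> = wedge w (c - m) / k"
  define \<beta> where "\<beta> = wedge s w / k"
  have \<beta>: "\<beta> > 0" using w k by (simp add: \<beta>_def s_def)
  have "k *\<^sub>R w = wedge w (c - m) *\<^sub>R s + wedge s w *\<^sub>R (c - m)"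
    unfolding k_def by (rule wedge_cramer)
  then have "(1/k) *\<^sub>R (k *\<^sub>R w) = \<alpha> *\<^sub>R s + \<beta> *\<^sub>R (c - m)"
    by (simp add: \<alpha>_def \<beta>_def scaleR_add_right)
  then have w_eq: "w = \<alpha> *\<^sub>R s + \<beta> *\<^sub>R (c - m)" using k by simp
  define \<mu> where "\<mu> = min \<theta> (1 - \<theta>)"
  have \<mu>: "\<mu> > 0" using m by (simp add: \<mu>_def)
  \<comment> \<open>The first bound keeps the weight of \<open>c\<close> below one half, the second one keeps the foot point on the side.\<close>
  define \<delta>0 where "\<delta>0 = min (1 / (2 * \<beta>)) (\<mu> / (2 * (\<bar>\<alpha>\<bar> + 1)))"
  have pos: "\<delta>0 > 0" using \<beta> \<mu> by (simp add: \<delta>0_def)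
  moreover have "m + \<delta> *\<^sub>R w \<in> interior Q" if \<delta>: "0 < \<delta>" "\<delta> < \<delta>0" for \<delta>
  proof -
    have b: "\<delta> * \<beta> < 1/2" using \<delta> \<beta> by (simp add: \<delta>0_def field_simps)
    have "\<delta> * (2 * (\<bar>\<alpha>\<bar> + 1)) < \<mu>"
      using \<delta> by (simp add: \<delta>0_def less_divide_eq)
    then have a2: "2 * (\<delta> * \<bar>\<alpha>\<bar>) < \<mu>" using \<delta> by (simp add: algebra_simps)
    define \<rho> where "\<rho> = \<delta> * \<alpha> / (1 - \<delta> * \<beta>)"
    have "\<bar>\<rho>\<bar> = \<delta> * \<bar>\<alpha>\<bar> / (1 - \<delta> * \<beta>)" using b \<delta> by (simp add: \<rho>_def abs_mult)
    also have "\<dots> \<le> 2 * (\<delta> * \<bar>\<alpha>\<bar>)"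
    proof -
      have "\<delta> * \<bar>\<alpha>\<bar> * 1 \<le> \<delta> * \<bar>\<alpha>\<bar> * (2 * (1 - \<delta> * \<beta>))"
        using b \<delta> by (intro mult_left_mono) auto
      then show ?thesis using b by (simp add: field_simps)
    qed
    finally have l: "\<bar>\<rho>\<bar> < \<mu>" using a2 by simp
    define z where "z = m + \<rho> *\<^sub>R s"
    have z: "z = p + (\<theta> + \<rho>) *\<^sub>R (q - p)" by (simp add: z_def m s_def algebra_simps)
    have "0 \<le> \<theta> + \<rho>" "\<theta> + \<rho> \<le> 1" using l by (auto simp: \<mu>_def)
    then have "(1 - (\<theta> + \<rho>)) *\<^sub>R p + (\<theta> + \<rho>) *\<^sub>R q \<in> Q" using Q by (intro convexD) auto
    then have zQ: "z \<in> Q" by (simp add: z algebra_simps)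
    have "\<delta> *\<^sub>R w = ((1 - \<delta> * \<beta>) * \<rho>) *\<^sub>R s + (\<delta> * \<beta>) *\<^sub>R (c - m)"
      using b by (simp add: w_eq \<rho>_def scaleR_add_right)
    then have "m + \<delta> *\<^sub>R w = z - (\<delta> * \<beta>) *\<^sub>R (z - c)"
      by (simp add: z_def algebra_simps)
    moreover have "z - (\<delta> * \<beta>) *\<^sub>R (z - c) \<in> interior Q"
      by (rule mem_interior_convex_shrink) (use Q zQ \<delta> \<beta> b in auto)
    ultimately show ?thesis by simp
  qed
  ultimately show ?thesis using that by blast
qed

lemma point_reflection_simps [simp]:
  "point_reflection c (point_reflection c x) = x"
  "point_reflection c x - point_reflection c y = y - x"
  by (simp_all add: point_reflection_def)

lemma inj_point_reflection: "inj (point_reflection c)"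
  by (metis injI point_reflection_simps(1))

lemma extreme_point_of_open_segment:
  "x extreme_point_of S \<Longrightarrow> a \<in> S \<Longrightarrow> b \<in> S \<Longrightarrow> x \<notin> open_segment a b"
  by (auto simp: extreme_point_of_def)

section \<open>Faces and edges of a zonotopal tiling\<close>

text \<open>Bounded faces are open sets. The closed polygon is what the geometric arguments need, and it is
  determined by its interior.\<close>

definition tile :: "complex ugraph \<Rightarrow> complex set \<Rightarrow> bool" where
  "tile T Q \<longleftrightarrow> symmetric_polygon Q \<and> interior Q \<in> bounded_faces T \<and>
    verts T \<inter> frontier Q = corners Q"

locale tiling =
  fixes P :: "complex set" and T :: "complex ugraph"
  assumes tiling: "zonotopal_tiling P T"
begin

lemma planar_drawing: "planar_drawing T"
  using tiling by (simp add: zonotopal_tiling_def)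

lemma finite_verts: "finite (verts T)"
  using planar_drawing by (simp add: planar_drawing_def)

lemma simple: "simple_graph T"
  using planar_drawing by (simp add: planar_drawing_def)

lemma edge_verts:
  assumes "{a, b} \<in> edges T"
  shows "a \<in> verts T" "b \<in> verts T" "a \<noteq> b" "norm (b - a) = 1"
proof -
  obtain u v where uv: "u \<in> verts T" "v \<in> verts T" "u \<noteq> v" "{a, b} = {u, v}"
    using simple assms unfolding simple_graph_def by blast
  then show "a \<in> verts T" "b \<in> verts T" "a \<noteq> b" by (auto simp: doubleton_eq_iff)
  have "dist a b = 1" using tiling assms by (simp add: zonotopal_tiling_def)
  then show "norm (b - a) = 1" by (simp add: dist_norm norm_minus_commute)
qed

lemma edgeE:
  assumes "e \<in> edges T"
  obtains a b where "e = {a, b}" "{a, b} \<in> edges T"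
proof -
  obtain u v where "e = {u, v}" using simple assms unfolding simple_graph_def by blast
  then show ?thesis using that[of u v] assms by simp
qed

lemma finite_edges: "finite (edges T)"
proof -
  have "edges T \<subseteq> Pow (verts T)"
    using edge_verts edgeE by (metis PowI empty_subsetI insert_subset subsetI)
  then show ?thesis using finite_verts finite_subset by blast
qed

lemma edge_inter_verts: "{a, b} \<in> edges T \<Longrightarrow> closed_segment a b \<inter> verts T = {a, b}"
  using planar_drawing by (simp add: planar_drawing_def segment_convex_hull)

lemma edge_drawn: "{a, b} \<in> edges T \<Longrightarrow> closed_segment a b \<subseteq> drawn T"
  by (auto simp: drawn_def segment_convex_hull)

lemma drawn_cases:
  assumes "z \<in> drawn T"
  obtains "z \<in> verts T" | a b where "{a, b} \<in> edges T" "z \<in> open_segment a b"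
proof -
  consider "z \<in> verts T" | e where "e \<in> edges T" "z \<in> convex hull e"
    using assms by (auto simp: drawn_def)
  then show ?thesis
  proof cases
    case 2
    obtain a b where e: "e = {a, b}" "{a, b} \<in> edges T" using edgeE[OF 2(1)] by metis
    then have "z \<in> closed_segment a b" using 2 by (simp add: segment_convex_hull)
    then consider "z = a" | "z = b" | "z \<in> open_segment a b" by (auto simp: open_segment_def)
    then show ?thesis by cases (use that e edge_verts[OF e(2)] in auto)
  qed (use that in blast)
qed

lemma hull_edge_compact: "e \<in> edges T \<Longrightarrow> compact (convex hull e)"
  by (erule edgeE) (simp add: compact_segment flip: segment_convex_hull)

lemma compact_drawn: "compact (drawn T)"
  unfolding drawn_def
  using finite_verts finite_edges hull_edge_compact
  by (intro compact_Un compact_UN) (auto simp: finite_imp_compact)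

lemma closed_drawn: "closed (drawn T)"
  by (rule compact_imp_closed[OF compact_drawn])

lemma P_eq: "P = drawn T \<union> \<Union>(bounded_faces T)"
  using tiling unfolding zonotopal_tiling_def by blast

lemma P_polygon: "symmetric_polygon P"
  using tiling unfolding zonotopal_tiling_def by blast

lemma P_compact: "compact P" and P_convex: "convex P" and P_interior: "interior P \<noteq> {}"
  and P_polytope: "polytope P"
  using P_polygon by (auto simp: symmetric_polygon_def polytope_imp_compact polytope_imp_convex)

lemma drawn_subset_P: "drawn T \<subseteq> P"
  using P_eq by blast

lemma verts_P: "v \<in> verts T \<Longrightarrow> v \<in> P"
  using drawn_subset_P by (auto simp: drawn_def)

lemma verts_drawn: "v \<in> verts T \<Longrightarrow> v \<in> drawn T"
  by (auto simp: drawn_def)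

lemma face_tile:
  assumes "F \<in> bounded_faces T"
  obtains Q where "tile T Q" "F = interior Q"
  using assms tiling unfolding zonotopal_tiling_def tile_def by (metis (no_types, lifting))

lemma tile_props:
  assumes "tile T Q"
  shows "compact Q" "convex Q" "interior Q \<noteq> {}" "interior Q \<inter> drawn T = {}"
    "frontier Q \<subseteq> drawn T" "Q \<subseteq> P" "closure (interior Q) = Q" "corners Q \<subseteq> verts T"
    "verts T \<inter> Q = corners Q" "Q = convex hull (corners Q)" "finite (corners Q)"
    "frontier Q = Q - interior Q"
proof -
  have poly: "polytope Q" "interior Q \<noteq> {}" and face: "interior Q \<in> bounded_faces T"
    and cor: "verts T \<inter> frontier Q = corners Q"
    using assms by (auto simp: tile_def symmetric_polygon_def)
  show Q: "compact Q" "convex Q" "interior Q \<noteq> {}"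
    using poly by (auto simp: polytope_imp_compact polytope_imp_convex)
  have comp: "interior Q \<in> components (- drawn T)" using face by (simp add: bounded_faces_def)
  then show disj: "interior Q \<inter> drawn T = {}" using in_components_subset by blast
  show cl: "closure (interior Q) = Q"
    using Q convex_closure_interior[of Q] by (simp add: compact_imp_closed closure_closed)
  have fr: "frontier (interior Q) = frontier Q"
    using cl by (simp add: frontier_def closure_closed Q compact_imp_closed)
  then show frd: "frontier Q \<subseteq> drawn T"
    using frontier_of_components_closed_complement[OF closed_drawn comp] by simp
  show fr2: "frontier Q = Q - interior Q"
    using Q by (simp add: frontier_def compact_imp_closed closure_closed)
  have "interior Q \<subseteq> P" using face P_eq by blast
  then show "Q \<subseteq> P" using fr2 frd drawn_subset_P by blast
  show "corners Q \<subseteq> verts T" using cor by blast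
  show "verts T \<inter> Q = corners Q" using cor disj fr2 verts_drawn by blast
  show "Q = convex hull (corners Q)"
    using Krein_Milman_Minkowski[OF Q(1,2)] by (simp add: corners_def)
  show "finite (corners Q)" using cor finite_verts by (metis finite_Int)
qed

lemma tile_unique:
  assumes "tile T Q" "tile T Q'" "z \<in> interior Q" "z \<in> interior Q'"
  shows "Q = Q'"
proof -
  have "interior Q \<in> components (- drawn T)" "interior Q' \<in> components (- drawn T)"
    using assms by (auto simp: tile_def bounded_faces_def)
  then have "interior Q = interior Q'" using components_eq assms by blast
  then show ?thesis using tile_props(7) assms by metis
qed

lemma connected_in_tile:
  assumes "connected H" "H \<inter> drawn T = {}" "z \<in> H" "z \<in> P"
  obtains Q where "tile T Q" "H \<subseteq> interior Q"
proof -
  obtain F where F: "F \<in> bounded_faces T" "z \<in> F" using P_eq assms by blast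
  obtain Q where Q: "tile T Q" "F = interior Q" using face_tile F by metis
  have "F \<in> components (- drawn T)" using F by (simp add: bounded_faces_def)
  moreover have "H \<subseteq> - drawn T" "F \<inter> H \<noteq> {}" using assms F by auto
  ultimately have "H \<subseteq> F" using assms(1) by (metis components_maximal)
  then show ?thesis using that Q by simp
qed

lemma edge_not_interior:
  assumes "tile T Q" "{a, b} \<in> edges T" "z \<in> closed_segment a b" shows "z \<notin> interior Q"
  using tile_props(4)[OF assms(1)] edge_drawn assms by blast

text \<open>There are finitely many edges, and those avoiding the vertex have positive distance from it.\<close>

lemma star:
  assumes v: "v \<in> verts T"
  shows "\<exists>\<epsilon>>0. \<forall>z\<in>drawn T. dist v z < \<epsilon> \<longrightarrow> z \<noteq> v \<longrightarrow>
    (\<exists>y. {v, y} \<in> edges T \<and> z \<in> closed_segment v y)"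
proof -
  define K where "K = (verts T - {v}) \<union> (\<Union>e\<in>{e \<in> edges T. v \<notin> e}. convex hull e)"
  have "closed K" unfolding K_def
    by (intro closed_Un finite_imp_closed closed_UN) (use finite_verts finite_edges hull_edge_compact compact_imp_closed in auto)
  moreover have "v \<notin> K"
    using planar_drawing v by (auto simp: K_def planar_drawing_def)
  ultimately obtain \<epsilon> where e: "\<epsilon> > 0" "ball v \<epsilon> \<inter> K = {}"
    using separate_point_closed by (metis disjoint_iff dist_commute mem_ball not_le)
  have "\<exists>y. {v, y} \<in> edges T \<and> z \<in> closed_segment v y"
    if "z \<in> drawn T" "dist v z < \<epsilon>" "z \<noteq> v" for z
  proof -
    have "z \<notin> K" using that e by auto
    then have "\<exists>e'. e' \<in> edges T \<and> z \<in> convex hull e' \<and> v \<in> e'"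
      using that by (auto simp: drawn_def K_def)
    then obtain e' where e': "e' \<in> edges T" "z \<in> convex hull e'" "v \<in> e'" by blast
    obtain a b where "e' = {a, b}" "{a, b} \<in> edges T" using edgeE e' by metis
    then have "e' = {v, a} \<or> e' = {v, b}" using e' by blast
    then show ?thesis using e' by (auto simp: segment_convex_hull)
  qed
  then show ?thesis using e by blast
qed

text \<open>A direction at a vertex that points into the polygon and is not the direction of an edge starts
  inside a single tile, because a short half-open segment is connected and meets nothing that is drawn.\<close>

lemma direction_tile:
  assumes v: "v \<in> verts T" and m: "m \<noteq> 0" "v + m \<in> P"
    and no: "\<And>y. {v, y} \<in> edges T \<Longrightarrow> \<not> (\<exists>r>0. m = r *\<^sub>R (y - v))"
  shows "\<exists>Q \<delta>. tile T Q \<and> v \<in> corners Q \<and> 0 < \<delta> \<and>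
    (\<forall>t. 0 < t \<longrightarrow> t \<le> \<delta> \<longrightarrow> v + t *\<^sub>R m \<in> interior Q)"
proof -
  obtain \<epsilon> where e: "\<epsilon> > 0"
    "\<And>z. z \<in> drawn T \<Longrightarrow> dist v z < \<epsilon> \<Longrightarrow> z \<noteq> v \<Longrightarrow> \<exists>y. {v, y} \<in> edges T \<and> z \<in> closed_segment v y"
    using star[OF v] by metis
  define \<delta> where "\<delta> = min 1 (\<epsilon> / (2 * norm m))"
  have \<delta>: "0 < \<delta>" "\<delta> \<le> 1" using e m by (auto simp: \<delta>_def)
  define H where "H = (\<lambda>t. v + t *\<^sub>R m) ` {0<..\<delta>}"
  have "connected H" unfolding H_def
    by (intro connected_continuous_image continuous_intros) simp
  moreover have "H \<inter> drawn T = {}"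
  proof (rule ccontr)
    assume "H \<inter> drawn T \<noteq> {}"
    then obtain t where t: "0 < t" "t \<le> \<delta>" "v + t *\<^sub>R m \<in> drawn T" by (auto simp: H_def)
    have "dist v (v + t *\<^sub>R m) = t * norm m" using t by (simp add: dist_norm)
    also have "\<dots> \<le> \<delta> * norm m" using t by (intro mult_right_mono) auto
    also have "\<dots> \<le> \<epsilon> / (2 * norm m) * norm m" by (intro mult_right_mono) (auto simp: \<delta>_def)
    also have "\<dots> < \<epsilon>" using m e by simp
    finally obtain y where y: "{v, y} \<in> edges T" "v + t *\<^sub>R m \<in> closed_segment v y"
      using e(2)[OF t(3)] t m by auto
    obtain s where s: "0 \<le> s" "v + t *\<^sub>R m = v + s *\<^sub>R (y - v)"
      using y(2) by (auto simp: in_segment algebra_simps)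
    have "t *\<^sub>R m = s *\<^sub>R (y - v)" using s by simp
    then have "(1/t) *\<^sub>R (t *\<^sub>R m) = (s/t) *\<^sub>R (y - v)" by simp
    then have "m = (s / t) *\<^sub>R (y - v)" using t by simp
    moreover have "s \<noteq> 0" using s t m by auto
    ultimately show False using no[OF y(1)] s t by (metis divide_pos_pos order_le_less)
  qed
  moreover have dH: "v + \<delta> *\<^sub>R m \<in> H" using \<delta> by (auto simp: H_def)
  moreover have "v + \<delta> *\<^sub>R m \<in> P"
  proof -
    have "(1 - \<delta>) *\<^sub>R v + \<delta> *\<^sub>R (v + m) \<in> P"
      using P_convex m verts_P[OF v] \<delta> by (intro convexD) auto
    then show ?thesis by (simp add: algebra_simps)
  qed
  ultimately obtain Q where Q: "tile T Q" "H \<subseteq> interior Q"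
    by (rule connected_in_tile)
  have int: "v + t *\<^sub>R m \<in> interior Q" if "0 < t" "t \<le> \<delta>" for t
    using Q(2) that unfolding H_def by (meson greaterThanAtMost_iff image_eqI subsetD)
  have "((\<lambda>t. v + t *\<^sub>R m) \<longlongrightarrow> v + 0 *\<^sub>R m) (at_right 0)"
    by (intro tendsto_intros)
  moreover have "\<forall>\<^sub>F t in at_right 0. v + t *\<^sub>R m \<in> Q"
    by (rule eventually_at_rightI[of 0 \<delta>]) (use \<delta>(1) int interior_subset in force)+
  ultimately have "v \<in> Q"
    using Lim_in_closed_set[of Q "\<lambda>t. v + t *\<^sub>R m" "at_right 0" v] tile_props(1)[OF Q(1)]
    by (simp add: compact_imp_closed)
  then have "v \<in> corners Q" using tile_props(9)[OF Q(1)] v by blast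
  then show ?thesis using Q int \<delta> by blast
qed

end

lemma small_step:
  fixes w :: "'a::real_normed_vector"
  assumes "e > 0"
  obtains \<delta> where "0 < \<delta>" "\<delta> \<le> 1" "\<delta> * norm w < e"
proof -
  define \<delta> where "\<delta> = min 1 (e / (norm w + 1))"
  have n: "norm w + 1 > 0" by (simp add: add_nonneg_pos)
  have "\<delta> * norm w < \<delta> * (norm w + 1)" using assms n by (simp add: \<delta>_def)
  also have "\<dots> \<le> e / (norm w + 1) * (norm w + 1)"
    using n by (intro mult_right_mono) (auto simp: \<delta>_def)
  finally have "\<delta> * norm w < e" using n by simp
  then show ?thesis using that[of \<delta>] assms n by (simp add: \<delta>_def)
qed

lemma interior_wedge_pos:
  assumes ge: "\<And>y. y \<in> Q \<Longrightarrow> wedge a (y - b) \<ge> 0" and a: "a \<noteq> 0" and x: "x \<in> interior Q"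
  shows "wedge a (x - b) > 0"
proof -
  obtain e where e: "e > 0" "ball x e \<subseteq> Q" using x by (meson mem_interior)
  obtain \<delta> where d: "0 < \<delta>" "\<delta> * norm (\<i> * a) < e" using small_step[OF e(1)] by metis
  define y where "y = x - \<delta> *\<^sub>R (\<i> * a)"
  have "y \<in> Q" using e d by (auto simp: y_def dist_norm norm_mult)
  then have "wedge a (y - b) \<ge> 0" using ge by simp
  moreover have "y - b = (x - b) - \<delta> *\<^sub>R (\<i> * a)" by (simp add: y_def)
  moreover have "wedge a (\<i> * a) = (norm a)\<^sup>2"
    unfolding cmod_power2 by (simp add: wedge_def power2_eq_square)
  ultimately have "\<delta> * (norm a)\<^sup>2 \<le> wedge a (x - b)" by (simp add: wedge_lin)
  moreover have "\<delta> * (norm a)\<^sup>2 > 0" using d a by simp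
  ultimately show ?thesis by linarith
qed

context tiling
begin

text \<open>Near the midpoint of an edge only the edge itself is drawn, so the open half disc on a side that
  contains points of the polygon lies in one tile. The tile cannot reach over the line of the edge, as the midpoint
  would become interior, and it reaches both endpoints, as an earlier end of its intersection with the line would be a corner and hence
  a vertex inside the edge.\<close>

lemma side_tile:
  assumes ab: "{a, b} \<in> edges T" and t: "t \<in> P" "wedge (b - a) (t - a) > 0"
  shows "\<exists>Q. tile T Q \<and> a \<in> Q \<and> b \<in> Q \<and> (\<forall>y\<in>Q. wedge (b - a) (y - a) \<ge> 0)"
proof -
  define m where "m = midpoint a b"
  note ab' = edge_verts[OF ab]
  have m_in: "m \<in> closed_segment a b" by (simp add: m_def)
  have wm: "wedge (b - a) (y - m) = wedge (b - a) (y - a)" for y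
    by (simp add: m_def midpoint_def wedge_lin wedge_commute[of b a] algebra_simps)
  define K where "K = verts T \<union> (\<Union>e\<in>edges T - {{a, b}}. convex hull e)"
  have "closed K" unfolding K_def
    using finite_verts finite_edges hull_edge_compact compact_imp_closed
    by (intro closed_Un closed_UN) (auto simp: finite_imp_closed)
  moreover have "m \<notin> K"
  proof
    assume "m \<in> K"
    have mo: "m \<noteq> a" "m \<noteq> b" using ab' by (auto simp: m_def midpoint_eq_endpoint)
    from \<open>m \<in> K\<close> consider "m \<in> verts T" | e where "e \<in> edges T" "e \<noteq> {a, b}" "m \<in> convex hull e"
      by (auto simp: K_def)
    then show False
    proof cases
      case 1 then show False using edge_inter_verts[OF ab] m_in mo by blast
    next
      case 2
      then show False
        using planar_drawing ab m_in mo unfolding planar_drawing_def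
        by (metis IntE IntI insertE segment_convex_hull singletonD)
    qed
  qed
  ultimately obtain \<epsilon> where e: "\<epsilon> > 0" "\<And>z. z \<in> K \<Longrightarrow> \<epsilon> \<le> dist m z"
    using separate_point_closed by metis
  define H where "H = ball m \<epsilon> \<inter> {z. wedge (b - a) (z - a) > 0}"
  have Hin: "m + \<delta> *\<^sub>R w \<in> H" if "wedge (b - a) w > 0" "0 < \<delta>" "\<delta> * norm w < \<epsilon>" for \<delta> w
  proof -
    have "wedge (b - a) (m + \<delta> *\<^sub>R w - m) = \<delta> * wedge (b - a) w"
      by (simp add: wedge_lin(8))
    then have "wedge (b - a) (m + \<delta> *\<^sub>R w - a) > 0"
      unfolding wm using that by (metis mult_pos_pos)
    then show ?thesis using that by (simp add: H_def dist_norm)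
  qed
  have conH: "connected H" unfolding H_def
    by (intro convex_connected convex_Int convex_ball convex_wedge_ge)
  have disjH: "H \<inter> drawn T = {}"
  proof -
    have "z \<notin> drawn T" if z: "z \<in> H" for z
    proof
      assume "z \<in> drawn T"
      moreover have "z \<notin> K" using e z by (force simp: H_def)
      ultimately have "z \<in> closed_segment a b"
        by (auto simp: drawn_def K_def segment_convex_hull)
      then obtain u where "z = (1 - u) *\<^sub>R a + u *\<^sub>R b" by (auto simp: in_segment)
      then have "z - a = u *\<^sub>R (b - a)" by (simp add: algebra_simps)
      then have "wedge (b - a) (z - a) = 0" by (simp add: wedge_lin(8))
      then show False using z by (simp add: H_def)
    qed
    then show ?thesis by blast
  qed
  obtain \<delta>1 where \<delta>1: "0 < \<delta>1" "\<delta>1 \<le> 1" "\<delta>1 * norm (t - m) < \<epsilon>"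
    using small_step[OF e(1)] by blast
  then have zH: "m + \<delta>1 *\<^sub>R (t - m) \<in> H" using t wm by (intro Hin) auto
  have "m \<in> P" using m_in edge_drawn[OF ab] drawn_subset_P by blast
  then have "(1 - \<delta>1) *\<^sub>R m + \<delta>1 *\<^sub>R t \<in> P" using P_convex t \<delta>1 by (intro convexD) auto
  then have zP: "m + \<delta>1 *\<^sub>R (t - m) \<in> P" by (simp add: algebra_simps)
  obtain Q where Q: "tile T Q" "H \<subseteq> interior Q" by (rule connected_in_tile[OF conH disjH zH zP])
  note Qp = tile_props[OF Q(1)]
  have pert: "\<exists>\<delta>. 0 < \<delta> \<and> \<delta> \<le> 1 \<and> m + \<delta> *\<^sub>R w \<in> interior Q" if w: "wedge (b - a) w > 0" for w
  proof -
    obtain \<delta> where d: "0 < \<delta>" "\<delta> \<le> 1" "\<delta> * norm w < \<epsilon>"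
      using small_step[OF e(1)] by blast
    then show ?thesis using Hin[OF w d(1,3)] Q(2) by blast
  qed
  have mQ: "m \<in> Q"
  proof -
    have "m \<in> closure H"
    proof (subst closure_approachable, intro allI impI)
      fix r :: real assume r: "r > 0"
      obtain \<delta> where d: "0 < \<delta>" "\<delta> * norm (t - m) < min r \<epsilon>"
        using small_step[of "min r \<epsilon>" "t - m"] r e(1) by auto
      then have "m + \<delta> *\<^sub>R (t - m) \<in> H" using t wm by (intro Hin) auto
      moreover have "dist (m + \<delta> *\<^sub>R (t - m)) m < r" using d by (simp add: dist_norm)
      ultimately show "\<exists>y\<in>H. dist y m < r" by blast
    qed
    then show ?thesis using Q(2) Qp(7) closure_mono by blast
  qed
  have m_int: "m \<notin> interior Q" using edge_not_interior[OF Q(1) ab m_in] .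
  have ge: "wedge (b - a) (y - a) \<ge> 0" if y: "y \<in> Q" for y
  proof (rule ccontr)
    assume "\<not> ?thesis"
    then have neg: "wedge (b - a) (y - m) < 0" by (simp add: wm)
    then have "wedge (b - a) (m - y) > 0" by (simp add: wedge_lin)
    then obtain \<delta> where d: "0 < \<delta>" "\<delta> \<le> 1" "m + \<delta> *\<^sub>R (m - y) \<in> interior Q"
      using pert by blast
    define z where "z = m + \<delta> *\<^sub>R (m - y)"
    have "y - (1 / (1 + \<delta>)) *\<^sub>R (y - z) \<in> interior Q"
      by (rule mem_interior_convex_shrink) (use Qp y d z_def in auto)
    moreover have "y - (1 / (1 + \<delta>)) *\<^sub>R (y - z) = m"
    proof -
      have "y - z = (1 + \<delta>) *\<^sub>R (y - m)" by (simp add: z_def algebra_simps)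
      then show ?thesis using d by simp
    qed
    ultimately show False using m_int by simp
  qed
  have reach: "c \<in> Q" if c: "c \<in> {a, b}" for c
  proof (rule ccontr)
    assume nc: "c \<notin> Q"
    have cm: "c \<noteq> m" using nc mQ by blast
    define S where "S = {s \<in> {0..1::real}. m + s *\<^sub>R (c - m) \<in> Q}"
    have S_eq: "S = {0..1} \<inter> (\<lambda>s. m + s *\<^sub>R (c - m)) -` Q" by (auto simp: S_def)
    have "continuous_on UNIV (\<lambda>s. m + s *\<^sub>R (c - m))" by (intro continuous_intros)
    then have "closed ((\<lambda>s. m + s *\<^sub>R (c - m)) -` Q)"
      using closed_vimage compact_imp_closed[OF Qp(1)] by blast
    then have "compact S" unfolding S_eq using compact_Icc by (rule compact_Int_closed[rotated])
    moreover have "0 \<in> S" using mQ by (simp add: S_def)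
    ultimately obtain s where s: "s \<in> S" "\<forall>s'\<in>S. s' \<le> s"
      using compact_attains_sup[of S] by blast
    define z where "z = m + s *\<^sub>R (c - m)"
    have s0: "0 \<le> s" "s \<le> 1" using s(1) by (simp_all add: S_def)
    have "s \<noteq> 1"
    proof
      assume "s = 1"
      then have "c \<in> Q" using s(1) by (simp add: S_def)
      then show False using nc by simp
    qed
    with s0 have s1: "0 \<le> s" "s < 1" by simp_all
    have zQ: "z \<in> Q" using s by (simp add: S_def z_def)
    have zseg: "z \<in> closed_segment a b"
    proof -
      have "z \<in> closed_segment m c" using s1 unfolding in_segment z_def
        by (intro exI[of _ s]) (simp add: algebra_simps)
      moreover have "c \<in> closed_segment a b" using c by auto
      ultimately show ?thesis using m_in by (meson closed_segment_subset convex_closed_segment subsetD)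
    qed
    have wc: "wedge (b - a) (c - m) = 0" using c wm[of c] by (auto simp: wedge_lin wedge_commute[of b a])
    have wz: "wedge (b - a) (z - a) = 0" using wm[of z] wc by (simp add: z_def wedge_lin(8))
    have "z extreme_point_of Q"
      unfolding extreme_point_of_def
    proof (intro conjI ballI zQ notI)
      fix x y assume xy: "x \<in> Q" "y \<in> Q" "z \<in> open_segment x y"
      then obtain u where u: "0 < u" "u < 1" "z = (1 - u) *\<^sub>R x + u *\<^sub>R y" "x \<noteq> y"
        by (auto simp: in_segment)
      have eq: "wedge (b - a) (z - a) = (1 - u) * wedge (b - a) (x - a) + u * wedge (b - a) (y - a)"
        by (simp add: u(3) wedge_lin algebra_simps)
      have xy0: "wedge (b - a) (x - a) = 0" "wedge (b - a) (y - a) = 0"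
        using eq wz ge[OF xy(1)] ge[OF xy(2)] u
        by (smt (verit) mult_nonneg_nonneg mult_pos_pos)+
      have par: "\<exists>r. x' = m + r *\<^sub>R (c - m)" if "wedge (b - a) (x' - a) = 0" for x'
      proof -
        have "b - a \<noteq> 0" using ab' by simp
        have "wedge (b - a) (x' - m) = 0" using that by (simp add: wm)
        then obtain r where r: "x' - m = r *\<^sub>R (b - a)" using wedge_eq_0_scale[OF _ \<open>b - a \<noteq> 0\<close>] by metis
        obtain r' where r': "c - m = r' *\<^sub>R (b - a)" using wedge_eq_0_scale[OF wc \<open>b - a \<noteq> 0\<close>] by metis
        then have "r' \<noteq> 0" using cm by auto
        then have "x' - m = (r / r') *\<^sub>R (c - m)" using r r' by simp
        then have "x' = m + (r / r') *\<^sub>R (c - m)" by (simp add: algebra_simps)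
        then show ?thesis by blast
      qed
      obtain r1 r2 where r: "x = m + r1 *\<^sub>R (c - m)" "y = m + r2 *\<^sub>R (c - m)"
        using par xy0 by metis
      have "z = m + ((1 - u) * r1 + u * r2) *\<^sub>R (c - m)" by (simp add: u r algebra_simps)
      then have "s *\<^sub>R (c - m) = ((1 - u) * r1 + u * r2) *\<^sub>R (c - m)" by (simp add: z_def)
      then have s_eq: "s = (1 - u) * r1 + u * r2" using cm by simp
      have ler: "r \<le> s" if "m + r *\<^sub>R (c - m) \<in> Q" for r
      proof (rule ccontr)
        assume "\<not> r \<le> s"
        define r' where "r' = min r 1"
        have r': "s < r'" "r' \<le> r" "r' \<le> 1" using \<open>\<not> r \<le> s\<close> s1 by (auto simp: r'_def)
        have "0 < r" using \<open>\<not> r \<le> s\<close> s1 by simp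
        have "(1 - r' / r) *\<^sub>R m + (r' / r) *\<^sub>R (m + r *\<^sub>R (c - m)) \<in> Q"
          using Qp mQ that r' s1 \<open>0 < r\<close> by (intro convexD) auto
        then have "m + r' *\<^sub>R (c - m) \<in> Q" using \<open>0 < r\<close> by (simp add: algebra_simps)
        then have "r' \<in> S" using r' s1 by (simp add: S_def)
        then show False using s r' by fastforce
      qed
      have le: "r1 \<le> s" "r2 \<le> s" using ler xy r by auto
      have "r1 \<noteq> r2" using u r by auto
      then have "(1 - u) * r1 + u * r2 < s"
      proof -
        have "(1 - u) * r1 \<le> (1 - u) * s" "u * r2 \<le> u * s" using le u by (auto intro: mult_left_mono)
        moreover have "(1 - u) * r1 < (1 - u) * s \<or> u * r2 < u * s"
          using le u \<open>r1 \<noteq> r2\<close> by auto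
        ultimately show ?thesis by (auto simp: algebra_simps)
      qed
      then show False using s_eq by simp
    qed
    then have "z \<in> verts T" using Qp by (auto simp: corners_def)
    then have "z \<in> {a, b}" using edge_inter_verts[OF ab] zseg by blast
    moreover have "z \<noteq> a" "z \<noteq> b"
    proof -
      have eqd: "dist c m = dist a m" "dist a m = dist b m"
        using c by (auto simp: m_def dist_midpoint)
      have "dist z m = s * dist c m" using s1 by (simp add: z_def dist_norm)
      also have "\<dots> < dist c m" using s1 cm by simp
      finally show "z \<noteq> a" "z \<noteq> b" using eqd by auto
    qed
    ultimately show False by blast
  qed
  show ?thesis using Q(1) reach ge by blast
qed

text \<open>The midpoint of a side of a tile is drawn but is not a vertex, so it lies on an edge. The edge cannot
  leave the line of the side, since it would enter the tile. The endpoints of the side and of the edge are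
  vertices, and neither segment has a vertex in its relative interior, so the two segments agree.\<close>

lemma side_edge:
  assumes Q: "tile T Q" and p: "p \<in> corners Q" and q: "q \<in> corners Q" and pq: "p \<noteq> q"
    and ge: "\<And>y. y \<in> Q \<Longrightarrow> wedge (q - p) (y - p) \<ge> 0"
  shows "{p, q} \<in> edges T"
proof -
  note Qp = tile_props[OF Q]
  have pqQ: "p \<in> Q" "q \<in> Q" using p q by (auto simp: corners_def extreme_point_of_def)
  have pqv: "p \<in> verts T" "q \<in> verts T" using p q Qp by auto
  define s where "s = q - p"
  have s0: "s \<noteq> 0" using pq by (simp add: s_def)
  have seg_Q: "p + r *\<^sub>R s \<in> Q" if "0 \<le> r" "r \<le> 1" for r
  proof -
    have "(1 - r) *\<^sub>R p + r *\<^sub>R q \<in> Q" using pqQ Qp that by (intro convexD) auto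
    then show ?thesis by (simp add: s_def algebra_simps)
  qed
  have line_out: "p + r *\<^sub>R s \<notin> interior Q" for r
  proof
    assume "p + r *\<^sub>R s \<in> interior Q"
    then have "wedge s (p + r *\<^sub>R s - p) > 0"
      by (rule interior_wedge_pos[rotated 2]) (use ge s0 s_def in auto)
    then show False by (simp add: wedge_lin)
  qed
  have no_vert: "p + r *\<^sub>R s \<notin> verts T" if "0 < r" "r < 1" for r
  proof
    assume "p + r *\<^sub>R s \<in> verts T"
    then have "p + r *\<^sub>R s \<in> corners Q" using seg_Q[of r] that Qp(9) by auto
    then have "p + r *\<^sub>R s \<notin> open_segment p q"
      using extreme_point_of_open_segment pqQ by (auto simp: corners_def)
    then show False using that pq by (auto simp: in_segment s_def algebra_simps intro!: exI[of _ r])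
  qed
  define m where "m = p + (1/2) *\<^sub>R s"
  have "m \<in> Q" "m \<notin> interior Q" using seg_Q[of "1/2"] line_out[of "1/2"] by (auto simp: m_def)
  then have "m \<in> drawn T" using Qp(5,12) by blast
  moreover have "m \<notin> verts T" using no_vert[of "1/2"] by (simp add: m_def)
  ultimately obtain c d where cd: "{c, d} \<in> edges T" "m \<in> open_segment c d"
    by (metis drawn_cases)
  then obtain u where u: "0 < u" "u < 1" "m = c + u *\<^sub>R (d - c)" "c \<noteq> d"
    by (auto simp: in_segment algebra_simps)
  have cdv: "c \<in> verts T" "d \<in> verts T" using edge_verts cd by auto
  obtain o' where o': "o' \<in> interior Q" using Qp by blast
  have o_pos: "wedge (q - p) (o' - p) > 0"
    using interior_wedge_pos[of Q "q - p" p] ge o' pq by auto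
  have not_pos: "\<not> wedge s w > 0" if w: "w = d - c \<or> w = c - d" for w
  proof
    assume "wedge s w > 0"
    then obtain \<delta>0 where d0: "\<delta>0 > 0" "\<And>\<delta>. 0 < \<delta> \<Longrightarrow> \<delta> < \<delta>0 \<Longrightarrow> m + \<delta> *\<^sub>R w \<in> interior Q"
      using convex_half_disc[OF Qp(2) pqQ o' o_pos, of w m "1/2"] by (auto simp: s_def m_def)
    define \<delta> where "\<delta> = min (\<delta>0 / 2) (min u (1 - u))"
    have \<delta>: "0 < \<delta>" "\<delta> < \<delta>0" "\<delta> \<le> u" "\<delta> \<le> 1 - u" using d0 u by (auto simp: \<delta>_def)
    have "m + \<delta> *\<^sub>R w = c + (u + \<delta>) *\<^sub>R (d - c) \<or> m + \<delta> *\<^sub>R w = c + (u - \<delta>) *\<^sub>R (d - c)"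
      using w by (auto simp: u algebra_simps)
    moreover have "c + r *\<^sub>R (d - c) \<in> closed_segment c d" if "0 \<le> r" "r \<le> 1" for r
      using that by (auto simp: in_segment algebra_simps intro!: exI[of _ r])
    moreover have "0 \<le> u + \<delta>" "u + \<delta> \<le> 1" "0 \<le> u - \<delta>" "u - \<delta> \<le> 1" using \<delta> u by auto
    ultimately have "m + \<delta> *\<^sub>R w \<in> closed_segment c d" by metis
    then show False using edge_not_interior[OF Q cd(1)] d0(2)[OF \<delta>(1,2)] by blast
  qed
  have "wedge s (d - c) = 0"
    using not_pos[of "d - c"] not_pos[of "c - d"] by (simp add: wedge_lin)
  then obtain k where k: "d - c = k *\<^sub>R s" using wedge_eq_0_scale s0 by metis
  have k0: "k \<noteq> 0" using k u by auto
  define g h where "g = 1/2 - u * k" and "h = 1/2 + (1 - u) * k"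
  have c_eq: "c = p + g *\<^sub>R s"
  proof -
    have "c = m - u *\<^sub>R (d - c)" using u(3) by (simp add: algebra_simps)
    also have "\<dots> = p + g *\<^sub>R s" unfolding k by (simp add: m_def g_def algebra_simps)
    finally show ?thesis .
  qed
  have d_eq: "d = p + h *\<^sub>R s"
  proof -
    have "d = c + k *\<^sub>R s" by (metis k add.commute diff_add_cancel)
    also have "\<dots> = p + h *\<^sub>R s" unfolding c_eq by (simp add: h_def g_def algebra_simps)
    finally show ?thesis .
  qed
  have cdp: "p + r *\<^sub>R s \<in> closed_segment c d" if "(g \<le> r \<and> r \<le> h) \<or> (h \<le> r \<and> r \<le> g)" for r
  proof -
    have hg: "h - g = k" by (simp add: h_def g_def algebra_simps)
    define v where "v = (r - g) / k"
    have "0 \<le> v" "v \<le> 1" using that k0 hg unfolding v_def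
      by (auto simp: divide_simps split: if_splits)
    moreover have "p + r *\<^sub>R s = (1 - v) *\<^sub>R c + v *\<^sub>R d"
    proof -
      have "r = g + v * (h - g)" using k0 hg by (simp add: v_def)
      then have "p + r *\<^sub>R s = p + (g + v * (h - g)) *\<^sub>R s" by (rule arg_cong)
      then show ?thesis unfolding c_eq d_eq by (simp add: algebra_simps)
    qed
    ultimately show ?thesis by (auto simp: in_segment)
  qed
  have gh: "\<not> (0 < g \<and> g < 1)" "\<not> (0 < h \<and> h < 1)"
    using no_vert[of g] no_vert[of h] cdv c_eq d_eq by auto
  have ends: "p + 0 *\<^sub>R s = p" "p + 1 *\<^sub>R s = q" by (simp_all add: s_def)
  have pin: "p \<in> closed_segment c d \<and> q \<in> closed_segment c d"
  proof (cases "k > 0")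
    case True
    then have "u * k > 0" "(1 - u) * k > 0" using u by auto
    then have "g \<le> 0" "h \<ge> 1" using gh unfolding g_def h_def by linarith+
    then show ?thesis using cdp[of 0] cdp[of 1] ends by auto
  next
    case False
    then have "u * k < 0" "(1 - u) * k < 0" using u k0 by (auto simp: mult_pos_neg)
    then have "h \<le> 0" "g \<ge> 1" using gh unfolding g_def h_def by linarith+
    then show ?thesis using cdp[of 0] cdp[of 1] ends by auto
  qed
  then have "p \<in> {c, d}" "q \<in> {c, d}" using edge_inter_verts[OF cd(1)] pqv by blast+
  then have "{p, q} = {c, d}" using pq by auto
  then show ?thesis using cd by simp
qed

end

context tiling
begin

text \<open>A corner is separated from the convex hull of the other corners by a linear functional. Seen from the
  corner, the other corners then have slopes, and those of least and greatest slope give the two sides.\<close>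

lemma corner_cone:
  assumes Q: "tile T Q" and v: "v \<in> corners Q"
  shows "\<exists>y1 y2. {v, y1} \<in> edges T \<and> {v, y2} \<in> edges T \<and> y1 \<in> corners Q \<and> y2 \<in> corners Q \<and>
    wedge (y1 - v) (y2 - v) > 0 \<and>
    (\<forall>y\<in>Q. wedge (y1 - v) (y - v) \<ge> 0 \<and> wedge (y - v) (y2 - v) \<ge> 0)"
proof -
  note Qp = tile_props[OF Q]
  define V where "V = corners Q - {v}"
  have fin: "finite V" using Qp by (simp add: V_def)
  have vQ: "v extreme_point_of Q" using v by (simp add: corners_def)
  have VQ: "V \<subseteq> Q - {v}" by (auto simp: V_def corners_def extreme_point_of_def)
  have "convex (Q - {v})" using vQ Qp(2) extreme_point_of_stillconvex by blast
  then have hullV: "v \<notin> convex hull V" using VQ hull_minimal[of V "Q - {v}" convex] by blast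
  obtain l b where lb: "l \<bullet> v < b" "\<forall>x\<in>convex hull V. b < l \<bullet> x"
    using separating_hyperplane_closed_point[OF convex_convex_hull _ hullV]
      finite_imp_compact_convex_hull[OF fin] compact_imp_closed by blast
  have pos: "l \<bullet> (z - v) > 0" if "z \<in> V" for z
    using lb hull_inc[OF that, of convex] by (simp add: inner_diff_right) fastforce
  have ne: "V \<noteq> {}"
  proof
    assume "V = {}"
    then have "Q \<subseteq> {v}" using Qp(10) V_def by (metis Diff_eq_empty_iff convex_hull_singleton hull_mono)
    then have "interior Q \<subseteq> interior {v}" by (rule interior_mono)
    then show False using Qp(3) by simp
  qed
  then have l0: "l \<noteq> 0" using pos by fastforce
  define \<sigma> where "\<sigma> z = wedge l (z - v) / (l \<bullet> (z - v))" for z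
  have key: "(l \<bullet> l) * wedge (a - v) (z - v) = (l \<bullet> (a - v)) * (l \<bullet> (z - v)) * (\<sigma> z - \<sigma> a)"
    if "a \<in> V" "z \<in> V" for a z
  proof -
    have "(l \<bullet> l) * wedge (a - v) (z - v)
      = (l \<bullet> (a - v)) * wedge l (z - v) - wedge l (a - v) * (l \<bullet> (z - v))"
      by (simp add: wedge_def inner_complex_def algebra_simps)
    also have "\<dots> = (l \<bullet> (a - v)) * (l \<bullet> (z - v)) * (\<sigma> z - \<sigma> a)"
      using pos[OF that(1)] pos[OF that(2)] by (simp add: \<sigma>_def field_simps)
    finally show ?thesis .
  qed
  have mono: "wedge (a - v) (z - v) \<ge> 0" if "a \<in> V" "z \<in> V" "\<sigma> a \<le> \<sigma> z" for a z
  proof -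
    have "(l \<bullet> l) * wedge (a - v) (z - v) \<ge> 0" using key pos that by (simp add: less_imp_le)
    moreover have "l \<bullet> l > 0" using l0 by simp
    ultimately show ?thesis by (smt (verit) mult_pos_neg)
  qed
  obtain y1 where y1: "y1 \<in> V" "\<forall>z\<in>V. \<sigma> y1 \<le> \<sigma> z"
    using ex_is_arg_min_if_finite[OF fin ne, of \<sigma>] by (auto simp: is_arg_min_linorder)
  obtain y2 where y2: "y2 \<in> V" "\<forall>z\<in>V. \<sigma> z \<le> \<sigma> y2"
    using ex_is_arg_min_if_finite[OF fin ne, of "\<lambda>z. - \<sigma> z"] by (auto simp: is_arg_min_linorder)
  have c1: "wedge (y1 - v) (y - v) \<ge> 0" if "y \<in> Q" for y
  proof -
    have "corners Q \<subseteq> {z. wedge (y1 - v) (z - v) \<ge> 0}" using mono y1 V_def by force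
    then have "Q \<subseteq> {z. wedge (y1 - v) (z - v) \<ge> 0}"
      using Qp(10) hull_minimal convex_wedge_ge(1) by metis
    then show ?thesis using that by blast
  qed
  have c2': "wedge (v - y2) (y - v) \<ge> 0" if "y \<in> Q" for y
  proof -
    have "wedge (v - y2) (z - v) = wedge (z - v) (y2 - v)" for z
      by (simp add: wedge_def algebra_simps)
    then have "corners Q \<subseteq> {z. wedge (v - y2) (z - v) \<ge> 0}" using mono y2 V_def by force
    then have "Q \<subseteq> {z. wedge (v - y2) (z - v) \<ge> 0}"
      using Qp(10) hull_minimal convex_wedge_ge(1) by metis
    then show ?thesis using that by blast
  qed
  have c2: "wedge (y - v) (y2 - v) \<ge> 0" if "y \<in> Q" for y
    using c2'[OF that] by (simp add: wedge_def algebra_simps)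
  have ne12: "y1 \<noteq> v" "y2 \<noteq> v" and co: "y1 \<in> corners Q" "y2 \<in> corners Q" using y1 y2 by (auto simp: V_def)
  have strict: "wedge (y1 - v) (y2 - v) > 0"
  proof (rule ccontr)
    assume n: "\<not> ?thesis"
    obtain x where x: "x \<in> interior Q" using Qp by blast
    have "wedge (y1 - v) (x - v) > 0" using interior_wedge_pos[OF _ _ x] c1 ne12 by simp
    moreover have "wedge (v - y2) (x - v) > 0" using interior_wedge_pos[OF _ _ x] c2' ne12 by simp
    moreover have "wedge (y1 - v) (y2 - v) = 0" using n c1[of y2] co
      by (simp add: corners_def extreme_point_of_def)
    then have "y2 - v \<noteq> 0" "wedge (y1 - v) (y2 - v) = 0" using ne12 by auto
    then obtain r where r: "y2 - v = r *\<^sub>R (y1 - v)" using wedge_eq_0_scale[of "y1 - v" "y2 - v"] ne12 by auto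
    have "l \<bullet> (y2 - v) = r * (l \<bullet> (y1 - v))" unfolding r by simp
    then have "r > 0" using pos[OF y1(1)] pos[OF y2(1)] by (simp add: zero_less_mult_iff)
    moreover have "wedge (v - y2) (x - v) = - r * wedge (y1 - v) (x - v)"
    proof -
      have "v - y2 = (- r) *\<^sub>R (y1 - v)" using r by (simp add: algebra_simps)
      then show ?thesis by (simp only: wedge_lin(7))
    qed
    ultimately show False by (simp add: zero_less_mult_iff mult_less_0_iff)
  qed
  have "{v, y1} \<in> edges T" using side_edge[OF Q v co(1)] ne12 c1 by auto
  moreover have "{y2, v} \<in> edges T"
  proof (rule side_edge[OF Q co(2) v ne12(2)])
    fix y assume "y \<in> Q"
    from c2[OF this] show "wedge (v - y2) (y - y2) \<ge> 0" by (simp add: wedge_def algebra_simps)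
  qed
  then have "{v, y2} \<in> edges T" by (simp add: insert_commute)
  ultimately show ?thesis using co strict c1 c2 by blast
qed

lemma tile_ascend:
  assumes Q: "tile T Q" and v: "v \<in> corners Q" and z: "z \<in> Q" "c \<bullet> v < c \<bullet> z"
  shows "\<exists>y. {v, y} \<in> edges T \<and> y \<in> corners Q \<and> c \<bullet> v < c \<bullet> y"
proof -
  obtain y1 y2 where y: "{v, y1} \<in> edges T" "{v, y2} \<in> edges T" "y1 \<in> corners Q" "y2 \<in> corners Q"
    "wedge (y1 - v) (y2 - v) > 0" "wedge (y1 - v) (z - v) \<ge> 0" "wedge (z - v) (y2 - v) \<ge> 0"
    using corner_cone[OF Q v] z by blast
  have "wedge (y1 - v) (y2 - v) * (c \<bullet> (z - v))
    = wedge (z - v) (y2 - v) * (c \<bullet> (y1 - v)) + wedge (y1 - v) (z - v) * (c \<bullet> (y2 - v))"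
    by (rule wedge_cramer_inner)
  moreover have "wedge (y1 - v) (y2 - v) * (c \<bullet> (z - v)) > 0" using y z by (simp add: inner_diff_right)
  ultimately have "c \<bullet> (y1 - v) > 0 \<or> c \<bullet> (y2 - v) > 0" using y
    by (smt (verit) mult_nonneg_nonneg mult_less_0_iff zero_less_mult_iff)
  then show ?thesis using y by (auto simp: inner_diff_right)
qed

lemma ascend:
  assumes v: "v \<in> verts T" and z: "z \<in> P" "c \<bullet> v < c \<bullet> z"
  shows "\<exists>y. {v, y} \<in> edges T \<and> c \<bullet> v < c \<bullet> y"
proof (cases "\<exists>y r. {v, y} \<in> edges T \<and> r > 0 \<and> z - v = r *\<^sub>R (y - v)")
  case True
  then obtain y r where y: "{v, y} \<in> edges T" "r > 0" "z - v = r *\<^sub>R (y - v)" by blast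
  have "c \<bullet> (z - v) = r * (c \<bullet> (y - v))" unfolding y by simp
  moreover have "c \<bullet> (z - v) > 0" using z by (simp add: inner_diff_right)
  ultimately have "c \<bullet> (y - v) > 0" using y(2) by (simp add: zero_less_mult_iff)
  then show ?thesis using y by (auto simp: inner_diff_right)
next
  case False
  have "z - v \<noteq> 0" using z by auto
  then obtain Q \<delta> where Q: "tile T Q" "v \<in> corners Q" "0 < \<delta>" "v + \<delta> *\<^sub>R (z - v) \<in> interior Q"
    using direction_tile[OF v, of "z - v"] False z by auto
  have "c \<bullet> v < c \<bullet> (v + \<delta> *\<^sub>R (z - v))" using Q z by (simp add: inner_right_distrib inner_diff_right)
  then show ?thesis using tile_ascend[OF Q(1,2)] Q(4) interior_subset by blast
qed

text \<open>The central reflection of a tile.\<close>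

definition rfl :: "complex set \<Rightarrow> complex \<Rightarrow> complex" where
  "rfl Q = point_reflection (SOME c. point_reflection c ` Q = Q)"

lemma rfl:
  assumes "tile T Q"
  shows "rfl Q ` Q = Q" "rfl Q (rfl Q x) = x" "rfl Q x - rfl Q y = y - x" "x \<in> Q \<Longrightarrow> rfl Q x \<in> Q"
proof -
  have "\<exists>c. point_reflection c ` Q = Q" using assms by (simp add: tile_def symmetric_polygon_def)
  then show im: "rfl Q ` Q = Q" unfolding rfl_def by (rule someI_ex)
  show "rfl Q (rfl Q x) = x" "rfl Q x - rfl Q y = y - x" by (simp_all add: rfl_def)
  show "x \<in> Q \<Longrightarrow> rfl Q x \<in> Q" using im by blast
qed

lemma rfl_corner:
  assumes Q: "tile T Q" and p: "p \<in> corners Q"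
  shows "rfl Q p \<in> corners Q"
proof -
  have "rfl Q p \<in> Q" using rfl(4)[OF Q] p by (auto simp: corners_def extreme_point_of_def)
  moreover have "rfl Q p \<notin> open_segment a b" if ab: "a \<in> Q" "b \<in> Q" for a b
  proof
    assume "rfl Q p \<in> open_segment a b"
    then obtain u where u: "0 < u" "u < 1" "a \<noteq> b" "rfl Q p = (1 - u) *\<^sub>R a + u *\<^sub>R b"
      by (auto simp: in_segment)
    have "p = rfl Q ((1 - u) *\<^sub>R a + u *\<^sub>R b)" using u rfl(2)[OF Q] by metis
    also have "\<dots> = (1 - u) *\<^sub>R rfl Q a + u *\<^sub>R rfl Q b"
      by (simp add: rfl_def point_reflection_def algebra_simps)
    finally have "p \<in> open_segment (rfl Q a) (rfl Q b)"
      using u rfl(2)[OF Q] by (metis in_segment(2))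
    then show False using p ab rfl(4)[OF Q] extreme_point_of_open_segment by (metis corners_def mem_Collect_eq)
  qed
  ultimately show ?thesis by (simp add: corners_def extreme_point_of_def)
qed

lemma edge_in_tile_corners:
  assumes Q: "tile T Q" and ab: "{a, b} \<in> edges T" "a \<in> Q" "b \<in> Q"
  shows "a \<in> corners Q" "b \<in> corners Q"
  using tile_props(9)[OF Q] edge_verts[OF ab(1)] ab by blast+

text \<open>An edge cannot cut through a tile: with interior points on both sides of its line, convexity would put the
  midpoint of the edge into the interior of the tile, which no edge meets.\<close>

lemma edge_side:
  assumes Q: "tile T Q" and ab: "{a, b} \<in> edges T" "a \<in> Q" "b \<in> Q"
  shows "(\<forall>y\<in>Q. wedge (b - a) (y - a) \<ge> 0) \<or> (\<forall>y\<in>Q. wedge (b - a) (y - a) \<le> 0)"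
proof (rule ccontr)
  assume "\<not> ?thesis"
  then obtain x y where xy: "x \<in> Q" "y \<in> Q" "wedge (b - a) (x - a) < 0" "wedge (b - a) (y - a) > 0"
    by (metis not_le)
  note Qp = tile_props[OF Q]
  have strict: "\<exists>z\<in>interior Q. s * wedge (b - a) (z - a) > 0" if "y \<in> Q" "s * wedge (b - a) (y - a) > 0" for s y
  proof -
    have "open {z. s * wedge (b - a) (z - a) > 0}"
      unfolding wedge_def by (intro open_Collect_less continuous_intros)
    moreover have "y \<in> closure (interior Q)" using that Qp by simp
    ultimately show ?thesis using that by (auto simp: closure_iff_nhds_not_empty open_Int_closure_eq_empty)
  qed
  obtain z1 z2 where z: "z1 \<in> interior Q" "wedge (b - a) (z1 - a) < 0"
    "z2 \<in> interior Q" "wedge (b - a) (z2 - a) > 0"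
    using strict[of x "-1"] strict[of y 1] xy by auto
  define m where "m = midpoint a b"
  have ab0: "a \<noteq> b" using edge_verts ab by auto
  have meq: "m = a + (1/2) *\<^sub>R (b - a)" by (simp add: m_def midpoint_def complex_eq_iff field_simps)
  obtain d where d: "d > 0" "\<And>\<delta>. 0 < \<delta> \<Longrightarrow> \<delta> < d \<Longrightarrow> m + \<delta> *\<^sub>R (m - z1) \<in> interior Q"
  proof (rule convex_half_disc[OF Qp(2) ab(2,3) z(3,4), of "m - z1" m "1/2"])
    show "wedge (b - a) (m - z1) > 0" using z unfolding meq by (simp add: wedge_lin)
  qed (use meq in auto)
  define \<delta> where "\<delta> = d / 2"
  have \<delta>: "0 < \<delta>" "\<delta> < d" using d by (auto simp: \<delta>_def)
  define w where "w = m + \<delta> *\<^sub>R (m - z1)"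
  have "w \<in> interior Q" using d \<delta> by (simp add: w_def)
  then have "w \<in> Q" using interior_subset by blast
  then have "w - (\<delta> / (1 + \<delta>)) *\<^sub>R (w - z1) \<in> interior Q"
    using \<delta> z(1) Qp(2) by (intro mem_interior_convex_shrink) auto
  moreover have "w - (\<delta> / (1 + \<delta>)) *\<^sub>R (w - z1) = m"
  proof -
    have "w - z1 = (1 + \<delta>) *\<^sub>R (m - z1)" by (simp add: w_def algebra_simps)
    then show ?thesis using \<delta> by (simp add: w_def)
  qed
  ultimately show False using edge_not_interior[OF Q ab(1), of m] by (simp add: m_def)
qed

text \<open>The reflection maps sides of a tile to sides of the tile, and sides are edges.\<close>

lemma opposite_edge:
  assumes Q: "tile T Q" and ab: "{a, b} \<in> edges T" "a \<in> Q" "b \<in> Q"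
  shows "{rfl Q a, rfl Q b} \<in> edges T"
proof -
  have main: "{rfl Q a, rfl Q b} \<in> edges T"
    if ab: "{a, b} \<in> edges T" "a \<in> Q" "b \<in> Q" and ge: "\<forall>y\<in>Q. wedge (b - a) (y - a) \<ge> 0" for a b
  proof (rule side_edge[OF Q])
    note c = edge_in_tile_corners[OF Q ab]
    show "rfl Q a \<in> corners Q" "rfl Q b \<in> corners Q" using rfl_corner[OF Q] c by auto
    show "rfl Q a \<noteq> rfl Q b" using edge_verts[OF ab(1)] rfl(2)[OF Q] by metis
    fix y assume "y \<in> Q"
    then have "wedge (b - a) (rfl Q y - a) \<ge> 0" using ge rfl(4)[OF Q] by blast
    moreover have "rfl Q b - rfl Q a = - (b - a)" "y - rfl Q a = - (rfl Q y - a)"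
      using rfl(3)[OF Q, of b a] rfl(3)[OF Q, of "rfl Q y" a] rfl(2)[OF Q] by auto
    ultimately show "wedge (rfl Q b - rfl Q a) (y - rfl Q a) \<ge> 0" by (simp only: wedge_lin)
  qed
  show ?thesis
  proof (cases "\<forall>y\<in>Q. wedge (b - a) (y - a) \<ge> 0")
    case True then show ?thesis using main ab by blast
  next
    case False
    then have le: "\<forall>y\<in>Q. wedge (b - a) (y - a) \<le> 0" using edge_side[OF Q ab] by blast
    have "{rfl Q b, rfl Q a} \<in> edges T"
    proof (rule main)
      show "{b, a} \<in> edges T" using ab by (simp add: insert_commute)
      show "\<forall>y\<in>Q. wedge (a - b) (y - b) \<ge> 0"
        using le by (auto simp: wedge_def algebra_simps)
    qed (use ab in auto)
    then show ?thesis by (simp add: insert_commute)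
  qed
qed

text \<open>Two tiles on the same side of an edge share a half disc.\<close>

lemma side_tile_unique:
  assumes Q1: "tile T Q1" "a \<in> Q1" "b \<in> Q1" "\<forall>y\<in>Q1. wedge (b - a) (y - a) \<ge> 0"
    and Q2: "tile T Q2" "a \<in> Q2" "b \<in> Q2" "\<forall>y\<in>Q2. wedge (b - a) (y - a) \<ge> 0" and ab: "a \<noteq> b"
  shows "Q1 = Q2"
proof -
  note Q1p = tile_props[OF Q1(1)] and Q2p = tile_props[OF Q2(1)]
  obtain x1 x2 where x: "x1 \<in> interior Q1" "x2 \<in> interior Q2" using Q1p Q2p by blast
  have w: "wedge (b - a) (x1 - a) > 0" "wedge (b - a) (x2 - a) > 0"
    using interior_wedge_pos[of Q1 "b - a" a x1] interior_wedge_pos[of Q2 "b - a" a x2] x Q1 Q2 ab by auto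
  define m where "m = a + (1/2) *\<^sub>R (b - a)"
  obtain d1 where d1: "d1 > 0" "\<And>\<delta>. 0 < \<delta> \<Longrightarrow> \<delta> < d1 \<Longrightarrow> m + \<delta> *\<^sub>R (x1 - a) \<in> interior Q1"
    by (rule convex_half_disc[OF Q1p(2) Q1(2,3) x(1) w(1,1) m_def]) auto
  obtain d2 where d2: "d2 > 0" "\<And>\<delta>. 0 < \<delta> \<Longrightarrow> \<delta> < d2 \<Longrightarrow> m + \<delta> *\<^sub>R (x1 - a) \<in> interior Q2"
    by (rule convex_half_disc[OF Q2p(2) Q2(2,3) x(2) w(2,1) m_def]) auto
  define \<delta> where "\<delta> = min d1 d2 / 2"
  have "0 < \<delta>" "\<delta> < d1" "\<delta> < d2" using d1 d2 by (auto simp: \<delta>_def)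
  then show ?thesis using tile_unique[OF Q1(1) Q2(1)] d1 d2 by blast
qed

text \<open>An extreme point of the polygon lies neither in an open face nor inside an edge.\<close>

lemma corners_P_verts: "corners P \<subseteq> verts T"
proof
  fix p assume "p \<in> corners P"
  then have p: "p extreme_point_of P" by (simp add: corners_def)
  then have "p \<notin> interior P" by (rule extreme_point_not_in_interior)
  have "p \<notin> \<Union> (bounded_faces T)"
  proof
    assume "p \<in> \<Union> (bounded_faces T)"
    then obtain Q where "tile T Q" "p \<in> interior Q" by (metis UnionE face_tile)
    then show False using tile_props(6) interior_mono \<open>p \<notin> interior P\<close> by blast
  qed
  then have "p \<in> drawn T" using p P_eq by (auto simp: extreme_point_of_def)
  then show "p \<in> verts T"
  proof (cases rule: drawn_cases)
    case (2 a b)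
    then show ?thesis using extreme_point_of_open_segment[OF p] edge_verts verts_P by blast
  qed
qed

end

section \<open>A height function for each edge direction\<close>

text \<open>Each vector rules out only a hyperplane, so a small perturbation avoids finitely many of them.\<close>

lemma generic_near:
  fixes k :: "'a::real_inner"
  assumes "finite D" "0 \<notin> D" "e > 0"
  shows "\<exists>c. dist c k < e \<and> (\<forall>d\<in>D. c \<bullet> d \<noteq> 0)"
  using assms
proof (induction D rule: finite_induct)
  case empty
  then show ?case by (intro exI[of _ k]) auto
next
  case (insert d D)
  then obtain c where c: "dist c k < e" "\<forall>d\<in>D. c \<bullet> d \<noteq> 0" by auto
  show ?case
  proof (cases "c \<bullet> d = 0")
    case False
    then show ?thesis using c by auto
  next
    case True
    have lim: "((\<lambda>\<delta>. c + \<delta> *\<^sub>R d) \<longlongrightarrow> c + 0 *\<^sub>R d) (at_right 0)" by (intro tendsto_intros)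
    have "((\<lambda>\<delta>. dist (c + \<delta> *\<^sub>R d) k) \<longlongrightarrow> dist (c + 0 *\<^sub>R d) k) (at_right 0)"
      by (intro tendsto_intros lim)
    then have e1: "\<forall>\<^sub>F \<delta> in at_right 0. dist (c + \<delta> *\<^sub>R d) k < e"
      by (rule order_tendstoD) (use c in simp)
    have e2: "\<forall>\<^sub>F \<delta> in at_right 0. \<forall>d'\<in>D. (c + \<delta> *\<^sub>R d) \<bullet> d' \<noteq> 0"
    proof (rule eventually_ball_finite[OF insert(1)], rule ballI)
      fix d' assume "d' \<in> D"
      have "((\<lambda>\<delta>. (c + \<delta> *\<^sub>R d) \<bullet> d') \<longlongrightarrow> (c + 0 *\<^sub>R d) \<bullet> d') (at_right 0)"
        by (intro tendsto_intros lim)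
      then show "\<forall>\<^sub>F \<delta> in at_right 0. (c + \<delta> *\<^sub>R d) \<bullet> d' \<noteq> 0"
        by (rule tendsto_imp_eventually_ne) (use c \<open>d' \<in> D\<close> in simp)
    qed
    have "\<forall>\<^sub>F \<delta> in at_right (0::real). \<delta> > 0" by (rule eventually_at_right_less)
    with e1 e2 have "\<forall>\<^sub>F \<delta> in at_right 0. dist (c + \<delta> *\<^sub>R d) k < e \<and>
      (\<forall>d'\<in>D. (c + \<delta> *\<^sub>R d) \<bullet> d' \<noteq> 0) \<and> \<delta> > 0"
      by eventually_elim auto
    then obtain \<delta> where d: "dist (c + \<delta> *\<^sub>R d) k < e" "\<forall>d'\<in>D. (c + \<delta> *\<^sub>R d) \<bullet> d' \<noteq> 0" "\<delta> > 0"
      using eventually_happens'[OF trivial_limit_at_right_real] by blast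
    moreover have "(c + \<delta> *\<^sub>R d) \<bullet> d \<noteq> 0"
      using True d insert.prems by (simp add: inner_left_distrib)
    ultimately show ?thesis by (intro exI[of _ "c + \<delta> *\<^sub>R d"]) auto
  qed
qed

lemma not_collinear_wedge:
  assumes "wedge (z1 - v) (z2 - v) \<noteq> 0"
  shows "\<not> collinear {v, z1, z2}"
proof
  assume "collinear {v, z1, z2}"
  then have "collinear {z1, v, z2}" by (simp add: insert_commute)
  then have "collinear {0, z1 - v, z2 - v}" by (simp add: collinear_3)
  then have "z1 - v = 0 \<or> z2 - v = 0 \<or> (\<exists>c. z2 - v = c *\<^sub>R (z1 - v))"
    by (simp only: collinear_lemma)
  then show False using assms by (auto simp: wedge_lin(8))
qed

lemma convex_corner_interior:
  fixes v w :: complex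
  assumes Q: "convex Q" "v \<in> Q" "z1 \<in> Q" "z2 \<in> Q"
    and w: "wedge (z1 - v) (z2 - v) > 0" "wedge (z1 - v) w > 0" "wedge w (z2 - v) > 0"
  obtains \<delta>0 where "\<delta>0 > 0" "\<And>\<delta>. 0 < \<delta> \<Longrightarrow> \<delta> < \<delta>0 \<Longrightarrow> v + \<delta> *\<^sub>R w \<in> interior Q"
proof -
  define k where "k = wedge (z1 - v) (z2 - v)"
  define \<alpha> where "\<alpha> = wedge w (z2 - v) / k"
  define \<beta> where "\<beta> = wedge (z1 - v) w / k"
  have k: "k > 0" using w by (simp add: k_def)
  have ab: "\<alpha> > 0" "\<beta> > 0" using w k by (auto simp: \<alpha>_def \<beta>_def)
  have "k *\<^sub>R w = wedge w (z2 - v) *\<^sub>R (z1 - v) + wedge (z1 - v) w *\<^sub>R (z2 - v)"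
    unfolding k_def by (rule wedge_cramer)
  then have "(1/k) *\<^sub>R (k *\<^sub>R w) = \<alpha> *\<^sub>R (z1 - v) + \<beta> *\<^sub>R (z2 - v)"
    by (simp add: \<alpha>_def \<beta>_def scaleR_add_right)
  then have w_eq: "w = \<alpha> *\<^sub>R (z1 - v) + \<beta> *\<^sub>R (z2 - v)" using k by simp
  have hull: "convex hull {v, z1, z2} \<subseteq> Q" using Q by (intro hull_minimal) auto
  have "v + \<delta> *\<^sub>R w \<in> interior Q" if d: "0 < \<delta>" "\<delta> < 1 / (\<alpha> + \<beta>)" for \<delta>
  proof -
    have "\<delta> * (\<alpha> + \<beta>) < 1" using d ab by (simp add: field_simps)
    then have pos: "0 < 1 - \<delta> * \<alpha> - \<delta> * \<beta>" "0 < \<delta> * \<alpha>" "0 < \<delta> * \<beta>" using d ab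
      by (auto simp: algebra_simps)
    have "v + \<delta> *\<^sub>R w = (1 - \<delta> * \<alpha> - \<delta> * \<beta>) *\<^sub>R v + (\<delta> * \<alpha>) *\<^sub>R z1 + (\<delta> * \<beta>) *\<^sub>R z2"
      unfolding w_eq by (simp add: algebra_simps)
    moreover have "1 - \<delta> * \<alpha> - \<delta> * \<beta> + \<delta> * \<alpha> + \<delta> * \<beta> = 1" by simp
    ultimately have "v + \<delta> *\<^sub>R w \<in> interior (convex hull {v, z1, z2})"
      using pos w(1) unfolding interior_convex_hull_3_minimal[OF not_collinear_wedge[of z1 v z2, OF less_imp_neq[OF w(1), symmetric]] DIM_complex]
      by (intro CollectI exI[of _ "1 - \<delta> * \<alpha> - \<delta> * \<beta>"] exI[of _ "\<delta> * \<alpha>"] exI[of _ "\<delta> * \<beta>"]) simp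
    then show ?thesis using hull interior_mono by blast
  qed
  then show ?thesis using that[of "1 / (\<alpha> + \<beta>)"] ab by simp
qed

text \<open>Two sectors with a common interior direction, neither of which contains a bounding direction of the
  other, have the same first bounding direction.\<close>

lemma same_first_direction:
  assumes "wedge Y1 Y2 > 0" "wedge Y1 M > 0" "wedge M Y2 > 0"
    and "wedge Z1 Z2 > 0" "wedge Z1 M > 0" "wedge M Z2 > 0"
    and "\<not> (wedge Z1 Y1 > 0 \<and> wedge Y1 Z2 > 0)" "\<not> (wedge Y1 Z1 > 0 \<and> wedge Z1 Y2 > 0)"
    and "norm Y1 = 1" "norm Z1 = 1"
  shows "Z1 = Y1"
proof (rule linorder_cases[of "wedge Y1 Z1" 0])
  assume a: "wedge Y1 Z1 > 0"
  have "wedge Y1 M * wedge Z1 Y2 = wedge Z1 M * wedge Y1 Y2 + wedge Y1 Z1 * wedge M Y2"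
    by (rule wedge_exchange)
  moreover have "wedge Z1 M * wedge Y1 Y2 > 0" "wedge Y1 Z1 * wedge M Y2 > 0" using assms a by auto
  ultimately have "wedge Z1 Y2 > 0" using assms(2) by (smt (verit) mult_nonneg_nonpos)
  then show ?thesis using a assms by blast
next
  assume "wedge Y1 Z1 < 0"
  then have a: "wedge Z1 Y1 > 0" by (simp add: wedge_commute[of Z1])
  have "wedge Z1 M * wedge Y1 Z2 = wedge Y1 M * wedge Z1 Z2 + wedge Z1 Y1 * wedge M Z2"
    by (rule wedge_exchange)
  moreover have "wedge Y1 M * wedge Z1 Z2 > 0" "wedge Z1 Y1 * wedge M Z2 > 0" using assms a by auto
  ultimately have "wedge Y1 Z2 > 0" using assms(5) by (smt (verit) mult_nonneg_nonpos)
  then show ?thesis using a assms by blast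
next
  assume "wedge Y1 Z1 = 0"
  then have "Z1 = Y1 \<or> Z1 = - Y1" using assms wedge_eq_0_unit by blast
  then show ?thesis using assms by (auto simp: wedge_lin)
qed

lemma wedge_cnj: "wedge (cnj a) (cnj b) = wedge b a"
  by (simp add: wedge_def)

text \<open>The mirror image of \<open>same_first_direction\<close>: complex conjugation reverses all determinants.\<close>

lemma same_last_direction:
  assumes "wedge Y1 Y2 > 0" "wedge Y1 M > 0" "wedge M Y2 > 0"
    and "wedge Z1 Z2 > 0" "wedge Z1 M > 0" "wedge M Z2 > 0"
    and "\<not> (wedge Z1 Y2 > 0 \<and> wedge Y2 Z2 > 0)" "\<not> (wedge Y1 Z2 > 0 \<and> wedge Z2 Y2 > 0)"
    and "norm Y2 = 1" "norm Z2 = 1"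
  shows "Z2 = Y2"
proof -
  have "cnj Z2 = cnj Y2"
    by (rule same_first_direction[of "cnj Y2" "cnj Y1" "cnj M" "cnj Z2" "cnj Z1"])
      (use assms in \<open>auto simp: wedge_cnj\<close>)
  then show ?thesis by simp
qed

context tiling
begin

lemma cone_edge_cases:
  assumes "{v, y1} \<in> edges T" "{v, y2} \<in> edges T" "wedge (y1 - v) (y2 - v) > 0"
    and x: "{v, x} \<in> edges T" "wedge (y1 - v) (x - v) \<ge> 0" "wedge (x - v) (y2 - v) \<ge> 0"
  shows "x = y1 \<or> x = y2 \<or> (wedge (y1 - v) (x - v) > 0 \<and> wedge (x - v) (y2 - v) > 0)"
proof -
  have n: "norm (y1 - v) = 1" "norm (y2 - v) = 1" "norm (x - v) = 1" using edge_verts assms by auto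
  consider "wedge (y1 - v) (x - v) = 0" | "wedge (x - v) (y2 - v) = 0" |
    "wedge (y1 - v) (x - v) > 0" "wedge (x - v) (y2 - v) > 0" using x by linarith
  then show ?thesis
  proof cases
    case 1
    then have "x - v = y1 - v \<or> x - v = - (y1 - v)" using wedge_eq_0_unit n by blast
    moreover have "x - v \<noteq> - (y1 - v)"
    proof
      assume h: "x - v = - (y1 - v)"
      show False using x(3) assms(3) unfolding h wedge_lin(5) by simp
    qed
    ultimately show ?thesis by auto
  next
    case 2
    then have "y2 - v = x - v \<or> y2 - v = - (x - v)" using wedge_eq_0_unit n by blast
    moreover have "y2 - v \<noteq> - (x - v)"
    proof
      assume h: "y2 - v = - (x - v)"
      show False using x(2) assms(3) unfolding h wedge_lin(6) by simp
    qed
    ultimately show ?thesis by auto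
  qed auto
qed

lemma edge_not_inside_tile_cone:
  assumes Q: "tile T Q" and z: "v \<in> Q" "z1 \<in> Q" "z2 \<in> Q" "wedge (z1 - v) (z2 - v) > 0" and y: "{v, y} \<in> edges T"
  shows "\<not> (wedge (z1 - v) (y - v) > 0 \<and> wedge (y - v) (z2 - v) > 0)"
proof
  assume a: "wedge (z1 - v) (y - v) > 0 \<and> wedge (y - v) (z2 - v) > 0"
  obtain d where d: "d > 0" "\<And>\<delta>. 0 < \<delta> \<Longrightarrow> \<delta> < d \<Longrightarrow> v + \<delta> *\<^sub>R (y - v) \<in> interior Q"
    by (rule convex_corner_interior[OF tile_props(2)[OF Q] z, of "y - v"]) (use a in auto)
  define \<delta> where "\<delta> = min 1 (d / 2)"
  have \<delta>: "0 < \<delta>" "\<delta> < d" "\<delta> \<le> 1" using d by (auto simp: \<delta>_def)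
  have "v + \<delta> *\<^sub>R (y - v) \<in> closed_segment v y"
    using \<delta> by (auto simp: in_segment algebra_simps intro!: exI[of _ \<delta>])
  then show False using edge_not_interior[OF Q y] d(2)[OF \<delta>(1,2)] by blast
qed

text \<open>The bisector of two angularly consecutive edges starts in a tile. The two sides of this tile at the
  vertex are edges with no edge between them, so they are the given ones.\<close>

lemma consecutive_edges_tile:
  assumes e: "{v, y1} \<in> edges T" "{v, y2} \<in> edges T" and w: "wedge (y1 - v) (y2 - v) > 0"
    and cons: "\<not> (\<exists>y. {v, y} \<in> edges T \<and> wedge (y1 - v) (y - v) > 0 \<and> wedge (y - v) (y2 - v) > 0)"
  shows "\<exists>Q. tile T Q \<and> v \<in> corners Q \<and> y1 \<in> corners Q \<and> y2 \<in> corners Q \<and>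
    (\<forall>y\<in>Q. wedge (y1 - v) (y - v) \<ge> 0 \<and> wedge (y - v) (y2 - v) \<ge> 0)"
proof -
  have v: "v \<in> verts T" and n: "norm (y1 - v) = 1" "norm (y2 - v) = 1" using edge_verts e by auto
  define m where "m = (1/2) *\<^sub>R ((y1 - v) + (y2 - v))"
  have wm: "wedge (y1 - v) m > 0" "wedge m (y2 - v) > 0"
    using w unfolding m_def wedge_lin(1,2,7,8) by auto
  have m0: "m \<noteq> 0" using wm by auto
  have "v + m = (1/2) *\<^sub>R y1 + (1/2) *\<^sub>R y2" by (simp add: m_def complex_eq_iff field_simps)
  moreover have "(1/2) *\<^sub>R y1 + (1/2) *\<^sub>R y2 \<in> P"
    using P_convex e edge_verts verts_P by (intro convexD) auto
  ultimately have vmP: "v + m \<in> P" by simp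
  have "\<not> (\<exists>r>0. m = r *\<^sub>R (y - v))" if y: "{v, y} \<in> edges T" for y
  proof
    assume "\<exists>r>0. m = r *\<^sub>R (y - v)"
    then obtain r where r: "r > 0" "m = r *\<^sub>R (y - v)" by blast
    then have "wedge (y1 - v) (y - v) > 0" "wedge (y - v) (y2 - v) > 0"
      using wm by (auto simp: wedge_lin(7,8) zero_less_mult_iff)
    then show False using cons y by blast
  qed
  then obtain Q \<delta> where Q: "tile T Q" "v \<in> corners Q" "0 < \<delta>" "v + \<delta> *\<^sub>R m \<in> interior Q"
    using direction_tile[OF v m0 vmP] by blast
  obtain z1 z2 where z: "{v, z1} \<in> edges T" "{v, z2} \<in> edges T" "z1 \<in> corners Q" "z2 \<in> corners Q"
    "wedge (z1 - v) (z2 - v) > 0"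
    "\<forall>y\<in>Q. wedge (z1 - v) (y - v) \<ge> 0 \<and> wedge (y - v) (z2 - v) \<ge> 0"
    using corner_cone[OF Q(1,2)] by blast
  have nz: "norm (z1 - v) = 1" "norm (z2 - v) = 1" using edge_verts z by auto
  have z0: "z1 - v \<noteq> 0" "v - z2 \<noteq> 0" using nz by auto
  have "wedge (z1 - v) (v + \<delta> *\<^sub>R m - v) > 0"
    using interior_wedge_pos[OF _ z0(1) Q(4), of v] z by blast
  then have zm1: "wedge (z1 - v) m > 0" using Q by (simp add: wedge_lin(8) zero_less_mult_iff)
  have "wedge (v - z2) (v + \<delta> *\<^sub>R m - v) > 0"
  proof (rule interior_wedge_pos[OF _ z0(2) Q(4)])
    fix y assume "y \<in> Q"
    then have "wedge (y - v) (z2 - v) \<ge> 0" using z by blast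
    then show "wedge (v - z2) (y - v) \<ge> 0" by (simp add: wedge_def algebra_simps)
  qed
  then have "wedge (v - z2) m > 0" using Q by (simp add: wedge_lin(8) zero_less_mult_iff)
  then have zm2: "wedge m (z2 - v) > 0" by (simp add: wedge_def algebra_simps)
  have inQ: "v \<in> Q" "z1 \<in> Q" "z2 \<in> Q" using Q z by (auto simp: corners_def extreme_point_of_def)
  note notin = edge_not_inside_tile_cone[OF Q(1) inQ z(5)]
  have z1: "z1 - v = y1 - v"
    by (rule same_first_direction[OF w wm z(5) zm1 zm2]) (use notin e cons z nz n in auto)
  have "z2 - v = y2 - v"
    by (rule same_last_direction[OF w wm z(5) zm1 zm2]) (use notin e cons z nz n in auto)
  then show ?thesis using z1 Q z by auto
qed

end

text \<open>The number of steps of a path that are translations by a given vector.\<close>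

fun steps :: "'a::minus \<Rightarrow> 'a list \<Rightarrow> nat" where
  "steps u (x # y # xs) = of_bool (y - x = u) + steps u (y # xs)"
| "steps u _ = 0"

lemma steps_snoc: "xs \<noteq> [] \<Longrightarrow> steps u (xs @ [y]) = steps u xs + of_bool (y - last xs = u)"
  by (induction xs rule: induct_list012) auto

lemma steps_reverse:
  assumes "\<And>x y. f x - f y = y - x"
  shows "steps u (map f (rev xs)) = steps u xs"
proof (induction xs rule: induct_list012)
  case (3 x y zs)
  have "steps u (map f (rev (x # y # zs))) = steps u (map f (rev (y # zs)) @ [f x])" by simp
  also have "\<dots> = steps u (map f (rev (y # zs))) + of_bool (f x - last (map f (rev (y # zs))) = u)"
    by (rule steps_snoc) simp
  also have "last (map f (rev (y # zs))) = f y" by (simp add: last_map)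
  finally show ?case using 3 assms by simp
qed auto

definition (in tiling) up :: "complex \<Rightarrow> complex \<Rightarrow> complex \<Rightarrow> bool" where
  "up c x y \<longleftrightarrow> {x, y} \<in> edges T \<and> c \<bullet> x < c \<bullet> y"

definition (in tiling) height :: "complex \<Rightarrow> complex \<Rightarrow> nat" where
  "height c v = card {w \<in> verts T. c \<bullet> v < c \<bullet> w}"

context tiling
begin

lemma height_less:
  assumes "y \<in> verts T" "c \<bullet> x < c \<bullet> y" shows "height c y < height c x"
  unfolding height_def by (rule psubset_card_mono) (use finite_verts assms in auto)

text \<open>The possible numbers of \<open>u\<close>-steps on maximal \<open>c\<close>-ascending paths. The value is unique, which is shown
  by induction from the top.\<close>

inductive cnt :: "complex \<Rightarrow> complex \<Rightarrow> complex \<Rightarrow> nat \<Rightarrow> bool" for c u where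
  top: "(\<And>y. \<not> up c x y) \<Longrightarrow> cnt c u x 0"
| step: "up c x y \<Longrightarrow> cnt c u y n \<Longrightarrow> cnt c u x (of_bool (y - x = u) + n)"

lemma cnt_ex: "\<exists>n. cnt c u x n"
proof (induction "height c x" arbitrary: x rule: less_induct)
  case less
  show ?case
  proof (cases "\<exists>y. up c x y")
    case True
    then obtain y where y: "up c x y" by blast
    then have "height c y < height c x" using height_less edge_verts unfolding up_def by blast
    then show ?thesis using less y cnt.step by blast
  qed (use cnt.top in blast)
qed

lemma cnt_path:
  "xs \<noteq> [] \<Longrightarrow> successively (up c) xs \<Longrightarrow> cnt c u (last xs) n \<Longrightarrow> cnt c u (hd xs) (steps u xs + n)"
proof (induction xs rule: induct_list012)
  case (3 x y zs)
  then have "up c x y" "cnt c u y (steps u (y # zs) + n)" by auto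
  from cnt.step[OF this] show ?case by (simp add: add.assoc)
qed auto

lemma tile_path_up:
  assumes Q: "tile T Q" and y: "y \<in> corners Q" and top: "\<And>z. z \<in> Q \<Longrightarrow> z \<noteq> t \<Longrightarrow> c \<bullet> z < c \<bullet> t" and t: "t \<in> Q"
  shows "\<exists>xs. xs \<noteq> [] \<and> successively (up c) xs \<and> set xs \<subseteq> corners Q \<and> hd xs = y \<and> last xs = t"
  using y
proof (induction "height c y" arbitrary: y rule: less_induct)
  case less
  show ?case
  proof (cases "y = t")
    case True
    then show ?thesis using less by (intro exI[of _ "[y]"]) auto
  next
    case False
    have "y \<in> Q" using less by (auto simp: corners_def extreme_point_of_def)
    then obtain z where z: "{y, z} \<in> edges T" "z \<in> corners Q" "c \<bullet> y < c \<bullet> z"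
      using tile_ascend[OF Q less(2) t] top False by blast
    then have "height c z < height c y" using height_less edge_verts by blast
    then obtain xs where "xs \<noteq> []" "successively (up c) xs" "set xs \<subseteq> corners Q" "hd xs = z" "last xs = t"
      using less(1) z by blast
    then show ?thesis using z less(2)
      by (intro exI[of _ "y # xs"]) (auto simp: successively_Cons up_def)
  qed
qed

text \<open>The centre of a tile is interior, as the midpoint of an interior point and its reflection. Hence the
  open diagonal between opposite corners is interior.\<close>

lemma tile_diagonal:
  assumes Q: "tile T Q" and v: "v \<in> Q" and r: "0 < r" "r < 1"
  shows "v + r *\<^sub>R (rfl Q v - v) \<in> interior Q"
proof -
  note Qp = tile_props[OF Q]
  obtain i where i: "i \<in> interior Q" using Qp by blast
  have iQ: "rfl Q i \<in> Q" "rfl Q v \<in> Q" using i rfl(4)[OF Q] interior_subset v by blast+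
  have ri: "rfl Q i = v + rfl Q v - i" using rfl(3)[OF Q, of i v] by (simp add: algebra_simps)
  have "rfl Q i - (1/2) *\<^sub>R (rfl Q i - i) \<in> interior Q"
    by (rule mem_interior_convex_shrink) (use Qp i iQ in auto)
  moreover have "rfl Q i - (1/2) *\<^sub>R (rfl Q i - i) = v + (1/2) *\<^sub>R (rfl Q v - v)"
    unfolding ri by (simp add: complex_eq_iff field_simps)
  ultimately have o: "v + (1/2) *\<^sub>R (rfl Q v - v) \<in> interior Q" (is "?o \<in> _") by simp
  show ?thesis
  proof (cases "r \<le> 1/2")
    case True
    have "v - (2 * r) *\<^sub>R (v - ?o) \<in> interior Q"
      by (rule mem_interior_convex_shrink) (use Qp v o True r in auto)
    then show ?thesis by simp
  next
    case False
    have "rfl Q v - (2 * (1 - r)) *\<^sub>R (rfl Q v - ?o) \<in> interior Q"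
      by (rule mem_interior_convex_shrink) (use Qp iQ o False r in auto)
    moreover have "rfl Q v - (2 * (1 - r)) *\<^sub>R (rfl Q v - ?o) = v + r *\<^sub>R (rfl Q v - v)"
      by (simp add: complex_eq_iff field_simps)
    ultimately show ?thesis by simp
  qed
qed

text \<open>An edge that changes the side of the diagonal from the lowest to the highest corner would cross
  the interior of the tile.\<close>

lemma diagonal_side_invariant:
  assumes Q: "tile T Q" and v: "v \<in> corners Q"
    and bot: "\<And>z. z \<in> Q \<Longrightarrow> z \<noteq> v \<Longrightarrow> c \<bullet> v < c \<bullet> z"
    and top: "\<And>z. z \<in> Q \<Longrightarrow> z \<noteq> rfl Q v \<Longrightarrow> c \<bullet> z < c \<bullet> rfl Q v"
    and y: "y \<in> Q" "y' \<in> Q" "up c y y'" and w: "wedge (y - v) (rfl Q v - v) > 0"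
  shows "wedge (y' - v) (rfl Q v - v) > 0 \<or> y' = rfl Q v"
proof (rule ccontr)
  define D where "D = rfl Q v - v"
  assume "\<not> ?thesis"
  then have n: "wedge (y' - v) D \<le> 0" "y' \<noteq> rfl Q v" by (auto simp: D_def)
  have e: "{y, y'} \<in> edges T" "c \<bullet> y < c \<bullet> y'" using y by (auto simp: up_def)
  have vQ: "v \<in> Q" using v by (auto simp: corners_def extreme_point_of_def)
  have v': "v \<in> verts T" "rfl Q v \<in> verts T" using v rfl_corner[OF Q v] tile_props(8)[OF Q] by auto
  have w': "wedge (y - v) D > 0" using w by (simp add: D_def)
  define s where "s = wedge (y - v) D / (wedge (y - v) D - wedge (y' - v) D)"
  have s: "0 < s" "s \<le> 1" using w' n by (auto simp: s_def field_simps)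
  define x where "x = y + s *\<^sub>R (y' - y)"
  have x_eq: "x = (1 - s) *\<^sub>R y + s *\<^sub>R y'" by (simp add: x_def algebra_simps)
  have xQ: "x \<in> Q" unfolding x_eq using tile_props(2)[OF Q] y s by (intro convexD) auto
  have xseg: "x \<in> closed_segment y y'" using s x_eq unfolding in_segment by (intro exI[of _ s]) simp
  have "wedge (x - v) D = (1 - s) * wedge (y - v) D + s * wedge (y' - v) D"
    by (simp add: x_eq wedge_lin algebra_simps)
  also have "\<dots> = 0" using w' n by (simp add: s_def divide_simps)
  finally have "wedge (x - v) D = 0" .
  then have "wedge D (x - v) = 0" by (simp add: wedge_commute[of D])
  moreover have "D \<noteq> 0" using w' by auto
  ultimately obtain r where r: "x - v = r *\<^sub>R D" using wedge_eq_0_scale by metis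
  have "x \<noteq> v" "x \<noteq> rfl Q v"
  proof -
    have "v \<noteq> y" using w' by auto
    moreover have "v \<noteq> y'" using bot[OF y(1)] e \<open>v \<noteq> y\<close> by auto
    ultimately show "x \<noteq> v" using edge_inter_verts[OF e(1)] xseg v' by auto
    have "rfl Q v \<noteq> y" using w' by (auto simp: D_def)
    then show "x \<noteq> rfl Q v" using edge_inter_verts[OF e(1)] xseg v' n by auto
  qed
  then have cx: "c \<bullet> v < c \<bullet> x" "c \<bullet> x < c \<bullet> rfl Q v" using bot top xQ by auto
  have "c \<bullet> (x - v) = r * (c \<bullet> D)" unfolding r by simp
  moreover have "c \<bullet> (x - v) > 0" "c \<bullet> (x - v) < c \<bullet> D" "c \<bullet> D > 0"
    using cx by (auto simp: D_def inner_diff_right)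
  ultimately have "r > 0" "r < 1" by (auto simp: zero_less_mult_iff)
  then have "v + r *\<^sub>R D \<in> interior Q" unfolding D_def by (rule tile_diagonal[OF Q vQ])
  moreover have "x = v + r *\<^sub>R D" using r by (simp add: algebra_simps)
  ultimately show False using edge_not_interior[OF Q e(1) xseg] by simp
qed

text \<open>Both consecutive edges continue to the highest corner of the tile that they span. The reversed
  reflection of an ascending path through the tile is again ascending and has the same steps. The first edge is
  exchanged, because the path stays on its side of the diagonal, so its last edge is opposite to the other
  edge at the bottom.\<close>

lemma tile_diamond:
  assumes y: "up c v y1" "up c v y2" and w: "wedge (y1 - v) (y2 - v) > 0"
    and cons: "\<not> (\<exists>y. {v, y} \<in> edges T \<and> wedge (y1 - v) (y - v) > 0 \<and> wedge (y - v) (y2 - v) > 0)"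
    and unique: "\<forall>y\<in>verts T. c \<bullet> v < c \<bullet> y \<longrightarrow> (\<forall>n m. cnt c u y n \<longrightarrow> cnt c u y m \<longrightarrow> n = m)"
    and n: "cnt c u y1 n1" "cnt c u y2 n2"
  shows "of_bool (y1 - v = u) + n1 = of_bool (y2 - v = u) + n2"
proof -
  have e: "{v, y1} \<in> edges T" "{v, y2} \<in> edges T" "c \<bullet> v < c \<bullet> y1" "c \<bullet> v < c \<bullet> y2"
    using y by (auto simp: up_def)
  obtain Q where Q: "tile T Q" "v \<in> corners Q" "y1 \<in> corners Q" "y2 \<in> corners Q"
    "\<forall>y\<in>Q. wedge (y1 - v) (y - v) \<ge> 0 \<and> wedge (y - v) (y2 - v) \<ge> 0"
    using consecutive_edges_tile[OF e(1,2) w cons] by blast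
  note Qp = tile_props[OF Q(1)]
  have inQ: "v \<in> Q" "y1 \<in> Q" "y2 \<in> Q" using Q by (auto simp: corners_def extreme_point_of_def)
  define t where "t = rfl Q v"
  define D where "D = t - v"
  have tc: "t \<in> corners Q" using rfl_corner Q by (simp add: t_def)
  have tQ: "t \<in> Q" using rfl(4)[OF Q(1)] inQ by (simp add: t_def)
  have bot: "c \<bullet> v < c \<bullet> z" if z: "z \<in> Q" "z \<noteq> v" for z
  proof -
    have "wedge (y1 - v) (y2 - v) *\<^sub>R (z - v)
      = wedge (z - v) (y2 - v) *\<^sub>R (y1 - v) + wedge (y1 - v) (z - v) *\<^sub>R (y2 - v)"
      by (rule wedge_cramer)
    moreover have "wedge (y1 - v) (y2 - v) *\<^sub>R (z - v) \<noteq> 0" using w z by simp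
    ultimately have "wedge (z - v) (y2 - v) \<noteq> 0 \<or> wedge (y1 - v) (z - v) \<noteq> 0" by auto
    then have p: "wedge (z - v) (y2 - v) > 0 \<or> wedge (y1 - v) (z - v) > 0"
      "wedge (z - v) (y2 - v) \<ge> 0" "wedge (y1 - v) (z - v) \<ge> 0" using Q z by force+
    have "wedge (y1 - v) (y2 - v) * (c \<bullet> (z - v))
      = wedge (z - v) (y2 - v) * (c \<bullet> (y1 - v)) + wedge (y1 - v) (z - v) * (c \<bullet> (y2 - v))"
      by (rule wedge_cramer_inner)
    moreover have "c \<bullet> (y1 - v) > 0" "c \<bullet> (y2 - v) > 0" using e by (auto simp: inner_diff_right)
    ultimately have "wedge (y1 - v) (y2 - v) * (c \<bullet> (z - v)) > 0"
      using p by (metis add_nonneg_pos add_pos_nonneg mult_nonneg_nonneg mult_pos_pos less_imp_le)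
    then show ?thesis using w by (simp add: inner_diff_right zero_less_mult_iff)
  qed
  have top: "c \<bullet> z < c \<bullet> t" if z: "z \<in> Q" "z \<noteq> t" for z
  proof -
    have "rfl Q z \<noteq> v" using z rfl(2)[OF Q(1)] t_def by metis
    then have "c \<bullet> v < c \<bullet> rfl Q z" using bot rfl(4)[OF Q(1)] z by blast
    moreover have "rfl Q z - v = t - z" using rfl(3)[OF Q(1), of z t] rfl(2)[OF Q(1)] by (simp add: t_def)
    then have "c \<bullet> rfl Q z - c \<bullet> v = c \<bullet> t - c \<bullet> z" by (metis inner_diff_right)
    ultimately show ?thesis by linarith
  qed
  obtain xs where xs: "xs \<noteq> []" "successively (up c) xs" "set xs \<subseteq> corners Q" "hd xs = y1" "last xs = t"
    using tile_path_up[OF Q(1,3) top tQ] by blast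
  have wD: "wedge (y1 - v) D > 0"
  proof -
    have "v + (1/2) *\<^sub>R (rfl Q v - v) \<in> interior Q" by (rule tile_diagonal[OF Q(1) inQ(1)]) auto
    moreover have "y1 - v \<noteq> 0" using w by auto
    ultimately have "wedge (y1 - v) (v + (1/2) *\<^sub>R (rfl Q v - v) - v) > 0"
      using interior_wedge_pos[of Q "y1 - v" v] Q(5) by blast
    moreover have "v + (1/2) *\<^sub>R (rfl Q v - v) - v = (1/2) *\<^sub>R D" by (simp add: D_def t_def)
    ultimately show ?thesis by (simp add: wedge_lin(8))
  qed
  have inv: "ys \<noteq> [] \<Longrightarrow> successively (up c) ys \<Longrightarrow> set ys \<subseteq> corners Q \<Longrightarrow>
    wedge (hd ys - v) D > 0 \<or> hd ys = t \<Longrightarrow> \<forall>z\<in>set ys. wedge (z - v) D > 0 \<or> z = t" for ys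
  proof (induction ys rule: induct_list012)
    case (3 x y zs)
    have xy: "up c x y" "x \<in> Q" "y \<in> Q" using 3(4,5) tile_props(9)[OF Q(1)] by auto
    have "x \<noteq> t" using top[OF xy(3)] xy(1) unfolding up_def by (cases "y = t") auto
    then have x: "wedge (x - v) D > 0" using 3(6) by simp
    then have y: "wedge (y - v) D > 0 \<or> y = t"
      using diagonal_side_invariant[OF Q(1,2) bot top[unfolded t_def] xy(2,3,1)] by (simp add: D_def t_def)
    have "\<forall>z\<in>set (y # zs). wedge (z - v) D > 0 \<or> z = t"
      by (rule 3(2)) (use 3(4,5) y in simp_all)
    then show ?case using x by simp
  qed auto
  have inv_xs: "\<forall>z\<in>set xs. wedge (z - v) D > 0 \<or> z = t" using inv xs wD by blast
  \<comment> \<open>The reversed reflection of the path \<open>v # xs\<close> is \<open>zs @ [t]\<close>. It starts at \<open>v\<close> because \<open>xs\<close> ends in \<open>t\<close>.\<close>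
  define zs where "zs = map (rfl Q) (rev xs)"
  have hd_zs: "hd zs = v" using xs rfl(2)[OF Q(1)] by (simp add: zs_def hd_map hd_rev t_def)
  have last_zs: "last zs = rfl Q y1" using xs by (simp add: zs_def last_map last_rev)
  have zs0: "zs \<noteq> []" using xs by (simp add: zs_def)
  have xvQ: "set (v # xs) \<subseteq> corners Q" using xs Q by auto
  have up_rfl: "up c (rfl Q y) (rfl Q x)" if "up c x y" "x \<in> corners Q" "y \<in> corners Q" for x y
  proof -
    have "x \<in> Q" "y \<in> Q" using that by (auto simp: corners_def extreme_point_of_def)
    then have "{rfl Q x, rfl Q y} \<in> edges T" using opposite_edge[OF Q(1)] that by (auto simp: up_def)
    moreover have "c \<bullet> (rfl Q x - rfl Q y) = c \<bullet> (y - x)" using rfl(3)[OF Q(1)] by simp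
    ultimately show ?thesis using that by (auto simp: up_def inner_diff_right insert_commute)
  qed
  have "successively (up c) (v # xs)" using xs y by (cases xs) auto
  then have "successively (\<lambda>x y. up c (rfl Q y) (rfl Q x)) (v # xs)"
    by (rule successively_mono) (use up_rfl xvQ in auto)
  then have up_zst: "successively (up c) (map (rfl Q) (rev (v # xs)))"
    by (simp only: successively_map successively_rev)
  have split: "map (rfl Q) (rev (v # xs)) = zs @ [t]" by (simp add: zs_def t_def)
  then have up_zs: "successively (up c) (zs @ [t])" using up_zst by simp
  obtain x rest where rest: "zs @ [t] = v # x # rest"
  proof (cases zs)
    case (Cons a as)
    then show ?thesis using that hd_zs by (cases as) auto
  qed (use zs0 in simp)
  have vx: "up c v x" and up_rest: "successively (up c) (x # rest)" using up_zs rest by auto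
  have last_rest: "last (x # rest) = t" using rest by (metis last.simps last_snoc list.distinct(1))
  have xset: "x \<in> rfl Q ` set (v # xs)"
    using rest split by (metis (no_types, lifting) image_set list.set_intros(1,2) set_rev)
  then have xQ: "x \<in> Q" using xvQ rfl(4)[OF Q(1)] by (auto simp: corners_def extreme_point_of_def)
  have "x = y1 \<or> x = y2"
    using cone_edge_cases[OF e(1,2) w, of x] vx Q(5) xQ cons by (auto simp: up_def)
  moreover have "x \<noteq> y1"
  proof
    assume x: "x = y1"
    have "y1 \<noteq> t" using wD by (auto simp: D_def)
    obtain z where z: "z \<in> set (v # xs)" "y1 = rfl Q z" using xset x by blast
    have "z \<noteq> v" using z \<open>y1 \<noteq> t\<close> by (auto simp: t_def)
    then have "z \<in> set xs" using z by auto
    moreover have "z \<noteq> t" using z w rfl(2)[OF Q(1)] by (auto simp: t_def)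
    ultimately have "wedge (z - v) D > 0" using inv_xs by blast
    moreover have "z - v = D - (y1 - v)"
      using rfl(3)[OF Q(1), of z v] z(2) by (simp add: D_def t_def algebra_simps)
    ultimately show False using wD by (simp add: wedge_lin(3))
  qed
  ultimately have x: "x = y2" by blast
  obtain k where k: "cnt c u t k" using cnt_ex by blast
  have "cnt c u y1 (steps u xs + k)" using cnt_path[OF xs(1,2)] k xs by simp
  then have n1: "n1 = steps u xs + k" using unique n e edge_verts by blast
  have "cnt c u y2 (steps u (x # rest) + k)" using cnt_path[OF _ up_rest] last_rest k x by fastforce
  then have n2: "n2 = steps u (x # rest) + k" using unique n e edge_verts by blast
  have "steps u (v # x # rest) = steps u (v # xs)"
    using steps_reverse[of "rfl Q" u "v # xs"] rfl(3)[OF Q(1)] split rest by simp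
  moreover have "steps u (v # xs) = of_bool (y1 - v = u) + steps u xs" using xs by (cases xs) auto
  ultimately show ?thesis using n1 n2 x by simp
qed

end

text \<open>The set \<open>U\<close> contains one of the two orientations of each edge direction. Heights for opposite directions
  are negatives of each other, which lets later arguments choose the orientation that suits them.\<close>

definition potential :: "complex ugraph \<Rightarrow> complex set \<Rightarrow> (complex \<Rightarrow> complex \<Rightarrow> int) \<Rightarrow> bool" where
  "potential T U N \<longleftrightarrow> finite U \<and> 0 \<notin> U \<and> (\<forall>d\<in>U. - d \<notin> U) \<and>
    (\<forall>x y. {x, y} \<in> edges T \<longrightarrow> y - x \<in> U \<or> x - y \<in> U) \<and>
    (\<forall>x y d. {x, y} \<in> edges T \<longrightarrow> d \<noteq> 0 \<longrightarrow>
      N d y - N d x = (if y - x = d then 1 else if x - y = d then - 1 else 0)) \<and>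
    (\<forall>d x. N (- d) x = - N d x)"

context tiling
begin

text \<open>A corner is separated from the hull of the other corners.\<close>

lemma corner_exposed:
  assumes p: "p \<in> corners P"
  shows "\<exists>c. \<forall>z\<in>P. z \<noteq> p \<longrightarrow> c \<bullet> z < c \<bullet> p"
proof -
  define V where "V = corners P - {p}"
  have fin: "finite V" using corners_P_verts finite_verts finite_subset by (auto simp: V_def)
  have pP: "p extreme_point_of P" using p by (simp add: corners_def)
  have VP: "V \<subseteq> P - {p}" by (auto simp: V_def corners_def extreme_point_of_def)
  have "convex (P - {p})" using pP P_convex extreme_point_of_stillconvex by blast
  then have hullV: "p \<notin> convex hull V" using VP hull_minimal[of V "P - {p}" convex] by blast
  obtain l b where lb: "l \<bullet> p < b" "\<forall>x\<in>convex hull V. b < l \<bullet> x"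
    using separating_hyperplane_closed_point[OF convex_convex_hull _ hullV]
      finite_imp_compact_convex_hull[OF fin] compact_imp_closed by blast
  have P_eq: "P = convex hull (insert p V)"
    using Krein_Milman_Minkowski[OF P_compact P_convex] p by (simp add: V_def insert_absorb corners_def)
  have "(- l) \<bullet> z < (- l) \<bullet> p" if z: "z \<in> P" "z \<noteq> p" for z
  proof (cases "V = {}")
    case True
    then show ?thesis using z P_eq by simp
  next
    case False
    then obtain u t x where x: "u \<ge> 0" "t \<ge> 0" "u + t = 1" "x \<in> convex hull V" "z = u *\<^sub>R p + t *\<^sub>R x"
      using z P_eq convex_hull_insert[OF False, of p] by auto
    have "t > 0" using x z by (cases "t = 0") auto
    have "l \<bullet> x > l \<bullet> p" using lb x by force
    then have "t * (l \<bullet> x) > t * (l \<bullet> p)" using \<open>t > 0\<close> by simp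
    moreover have "u = 1 - t" using x by simp
    then have "l \<bullet> z = (1 - t) * (l \<bullet> p) + t * (l \<bullet> x)" using x(5) by (simp add: inner_right_distrib)
    ultimately show ?thesis by (simp add: algebra_simps)
  qed
  then show ?thesis by blast
qed


text \<open>Edges between the two given ones are inserted one at a time, until neighbouring edges are
  consecutive.\<close>

lemma diamond_ccw:
  assumes unique: "\<forall>y\<in>verts T. c \<bullet> v < c \<bullet> y \<longrightarrow> (\<forall>n m. cnt c u y n \<longrightarrow> cnt c u y m \<longrightarrow> n = m)"
    and "up c v y1" "up c v y2" "wedge (y1 - v) (y2 - v) > 0" "cnt c u y1 n1" "cnt c u y2 n2"
  shows "of_bool (y1 - v = u) + n1 = of_bool (y2 - v = u) + n2"
  using assms(2-)
proof (induction "card {y \<in> verts T. {v, y} \<in> edges T \<and> wedge (y1 - v) (y - v) > 0 \<and> wedge (y - v) (y2 - v) > 0}"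
    arbitrary: y1 y2 n1 n2 rule: less_induct)
  case less
  define S where "S a b = {y \<in> verts T. {v, y} \<in> edges T \<and> wedge (a - v) (y - v) > 0 \<and> wedge (y - v) (b - v) > 0}"
    for a b
  have fin: "finite (S a b)" for a b using finite_verts by (simp add: S_def)
  show ?case
  proof (cases "\<exists>y. {v, y} \<in> edges T \<and> wedge (y1 - v) (y - v) > 0 \<and> wedge (y - v) (y2 - v) > 0")
    case False
    then show ?thesis using tile_diamond[OF less(2-4) False unique less(5,6)] by blast
  next
    case True
    then obtain y where y: "{v, y} \<in> edges T" "wedge (y1 - v) (y - v) > 0" "wedge (y - v) (y2 - v) > 0"
      by blast
    have yS: "y \<in> S y1 y2" using y edge_verts by (auto simp: S_def)
    have ny: "y \<notin> S y1 y" "y \<notin> S y y2" by (simp_all add: S_def)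
    have "wedge (y1 - v) (y2 - v) * (c \<bullet> (y - v))
      = wedge (y - v) (y2 - v) * (c \<bullet> (y1 - v)) + wedge (y1 - v) (y - v) * (c \<bullet> (y2 - v))"
      by (rule wedge_cramer_inner)
    moreover have "c \<bullet> (y1 - v) > 0" "c \<bullet> (y2 - v) > 0"
      using less(2,3) by (auto simp: up_def inner_diff_right)
    ultimately have "wedge (y1 - v) (y2 - v) * (c \<bullet> (y - v)) > 0"
      using y by (metis add_pos_pos mult_pos_pos)
    then have up: "up c v y" using less(4) y by (simp add: up_def inner_diff_right zero_less_mult_iff)
    obtain k where k: "cnt c u y k" using cnt_ex by blast
    have "S y1 y \<subseteq> S y1 y2"
      unfolding S_def
    proof safe
      fix z assume z: "wedge (y1 - v) (z - v) > 0" "wedge (z - v) (y - v) > 0"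
      have "wedge (y1 - v) (y - v) * wedge (z - v) (y2 - v)
        = wedge (z - v) (y - v) * wedge (y1 - v) (y2 - v) + wedge (y1 - v) (z - v) * wedge (y - v) (y2 - v)"
        by (rule wedge_exchange)
      then have "wedge (y1 - v) (y - v) * wedge (z - v) (y2 - v) > 0"
        using z y less(4) by (metis add_pos_pos mult_pos_pos)
      then show "wedge (z - v) (y2 - v) > 0" using y by (simp add: zero_less_mult_iff)
    qed
    then have "S y1 y \<subset> S y1 y2" using yS ny by blast
    then have c1: "card (S y1 y) < card (S y1 y2)" using fin by (rule psubset_card_mono[rotated])
    have "S y y2 \<subseteq> S y1 y2"
      unfolding S_def
    proof safe
      fix z assume z: "wedge (y - v) (z - v) > 0" "wedge (z - v) (y2 - v) > 0"
      have "wedge (y - v) (y2 - v) * wedge (z - v) (y1 - v)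
        = wedge (z - v) (y2 - v) * wedge (y - v) (y1 - v) + wedge (y - v) (z - v) * wedge (y2 - v) (y1 - v)"
        by (rule wedge_exchange)
      then have "wedge (y - v) (y2 - v) * wedge (y1 - v) (z - v)
        = wedge (z - v) (y2 - v) * wedge (y1 - v) (y - v) + wedge (y - v) (z - v) * wedge (y1 - v) (y2 - v)"
        unfolding wedge_commute[of _ "y1 - v"] by simp
      then have "wedge (y - v) (y2 - v) * wedge (y1 - v) (z - v) > 0"
        using z y less(4) by (metis add_pos_pos mult_pos_pos)
      then show "wedge (y1 - v) (z - v) > 0" using y by (simp add: zero_less_mult_iff)
    qed
    then have "S y y2 \<subset> S y1 y2" using yS ny by blast
    then have c2: "card (S y y2) < card (S y1 y2)" using fin by (rule psubset_card_mono[rotated])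
    show ?thesis
      using less(1)[OF c1[unfolded S_def] less(2) up y(2) less(5) k] less(1)[OF c2[unfolded S_def] up less(3) y(3) k less(6)] by simp
  qed
qed

lemma cnt_unique: "v \<in> verts T \<Longrightarrow> cnt c u v n \<Longrightarrow> cnt c u v m \<Longrightarrow> n = m"
proof (induction "height c v" arbitrary: v n m rule: less_induct)
  case less
  have IH: "\<forall>y\<in>verts T. c \<bullet> v < c \<bullet> y \<longrightarrow> (\<forall>n m. cnt c u y n \<longrightarrow> cnt c u y m \<longrightarrow> n = m)"
    using less(1) height_less by blast
  from less(3) show ?case
  proof cases
    case top
    then show ?thesis using less(4) by (auto elim: cnt.cases)
  next
    case (step y1 n1)
    note s1 = step
    from less(4) show ?thesis
    proof cases
      case top
      then show ?thesis using s1 by blast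
    next
      case (step y2 n2)
      have e: "{v, y1} \<in> edges T" "{v, y2} \<in> edges T" "c \<bullet> v < c \<bullet> y1" "c \<bullet> v < c \<bullet> y2"
        using s1 step by (auto simp: up_def)
      consider "wedge (y1 - v) (y2 - v) > 0" | "wedge (y2 - v) (y1 - v) > 0" | "wedge (y1 - v) (y2 - v) = 0"
        using wedge_commute[of "y1 - v" "y2 - v"] by linarith
      then show ?thesis
      proof cases
        case 1
        show ?thesis using diamond_ccw[OF IH s1(2) step(2) 1 s1(3) step(3)] s1(1) step(1) by blast
      next
        case 2
        show ?thesis using diamond_ccw[OF IH step(2) s1(2) 2 step(3) s1(3)] s1(1) step(1) by simp
      next
        case 3
        then have "y2 - v = y1 - v \<or> y2 - v = - (y1 - v)" using wedge_eq_0_unit edge_verts e by blast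
        moreover have "y2 - v \<noteq> - (y1 - v)"
        proof
          assume "y2 - v = - (y1 - v)"
          then have "c \<bullet> (y2 - v) = - (c \<bullet> (y1 - v))" by (metis inner_minus_right)
          then show False using e by (simp add: inner_diff_right)
        qed
        ultimately have "y1 = y2" by auto
        then have "n1 = n2" using IH e s1(3) step(3) edge_verts by blast
        then show ?thesis using s1 step \<open>y1 = y2\<close> by simp
      qed
    qed
  qed
qed

lemma generic_functional:
  assumes "e > 0"
  shows "\<exists>c. dist c k < e \<and> (\<forall>x y. {x, y} \<in> edges T \<longrightarrow> c \<bullet> x \<noteq> c \<bullet> y)"
proof -
  define D where "D = (\<lambda>(x, y). y - x) ` {(x, y) \<in> verts T \<times> verts T. {x, y} \<in> edges T}"
  have "finite D" unfolding D_def
    by (intro finite_imageI finite_subset[OF _ finite_cartesian_product[OF finite_verts finite_verts]]) auto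
  moreover have "0 \<notin> D"
  proof
    assume "0 \<in> D"
    then obtain x where "{x, x} \<in> edges T" by (auto simp: D_def)
    then show False using edge_verts(3) by blast
  qed
  ultimately obtain c where c: "dist c k < e" "\<forall>d\<in>D. c \<bullet> d \<noteq> 0" using generic_near assms by metis
  have "c \<bullet> x \<noteq> c \<bullet> y" if "{x, y} \<in> edges T" for x y
  proof -
    have "y - x \<in> D" using that edge_verts(1,2)[OF that] by (auto simp: D_def image_iff intro!: bexI[of _ "(x, y)"])
    then have "c \<bullet> (y - x) \<noteq> 0" using c by blast
    then show ?thesis by (simp add: inner_diff_right)
  qed
  then show ?thesis using c by blast
qed

theorem potential_exists: "\<exists>U N. potential T U N"
proof -
  obtain c where c: "\<And>x y. {x, y} \<in> edges T \<Longrightarrow> c \<bullet> x \<noteq> c \<bullet> y"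
    using generic_functional[of 1 0] by auto
  define M where "M u x = int (THE n. cnt c u x n)" for u x
  have M_up: "M u x - M u y = of_bool (y - x = u)" if "up c x y" for u x y
  proof -
    have xy: "x \<in> verts T" "y \<in> verts T" using that edge_verts by (auto simp: up_def)
    obtain n where n: "cnt c u y n" using cnt_ex by blast
    then have n': "cnt c u x (of_bool (y - x = u) + n)" using cnt.step that by blast
    have "(THE n. cnt c u y n) = n" "(THE n. cnt c u x n) = of_bool (y - x = u) + n"
      using n n' cnt_unique xy by (blast intro: the_equality)+
    then show ?thesis by (simp add: M_def)
  qed
  define N where "N d x = (if c \<bullet> d > 0 then - M d x else if c \<bullet> d < 0 then M (- d) x else 0)" for d x
  define U where "U = (\<lambda>(x, y). y - x) ` {(x, y) \<in> verts T \<times> verts T. up c x y}"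
  have "finite U" unfolding U_def
    by (intro finite_imageI finite_subset[OF _ finite_cartesian_product[OF finite_verts finite_verts]]) auto
  moreover have Upos: "c \<bullet> d > 0" if "d \<in> U" for d
    using that by (auto simp: U_def up_def inner_diff_right)
  have "0 \<notin> U" "\<forall>d\<in>U. - d \<notin> U" using Upos by (force, fastforce dest: Upos)
  moreover have UI: "y - x \<in> U" if "up c x y" for x y
  proof -
    have "x \<in> verts T" "y \<in> verts T" using that edge_verts by (auto simp: up_def)
    then show ?thesis using that by (auto simp: U_def image_iff intro!: bexI[of _ "(x, y)"])
  qed
  moreover have "y - x \<in> U \<or> x - y \<in> U" if "{x, y} \<in> edges T" for x y
    using c[OF that] that UI by (auto simp: up_def insert_commute neq_iff)
  moreover have Nup: "N d y - N d x = (if y - x = d then 1 else if x - y = d then - 1 else 0)"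
    if "up c x y" for x y d
  proof -
    have pos: "c \<bullet> (y - x) > 0" using that by (simp add: up_def inner_diff_right)
    consider "c \<bullet> d > 0" | "c \<bullet> d < 0" | "c \<bullet> d = 0" by linarith
    then show ?thesis
    proof cases
      case 1
      then have "x - y \<noteq> d" using pos by (auto simp: inner_diff_right)
      moreover have "N d y - N d x = M d x - M d y" using 1 by (simp add: N_def)
      ultimately show ?thesis unfolding M_up[OF that, of d] by simp
    next
      case 2
      then have "y - x \<noteq> d" using pos by (auto simp: inner_diff_right)
      moreover have eqv: "x - y = d \<longleftrightarrow> y - x = - d"
        using neg_equal_iff_equal[of "x - y" d] unfolding minus_diff_eq by blast
      moreover have "N d y - N d x = - (M (- d) x - M (- d) y)" using 2 by (simp add: N_def)
      ultimately show ?thesis unfolding M_up[OF that, of "- d"] eqv[symmetric] by simp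
    next
      case 3
      then have "x - y \<noteq> d" "y - x \<noteq> d" using pos by (auto simp: inner_diff_right)
      then show ?thesis using 3 by (simp add: N_def)
    qed
  qed
  moreover have "N d y - N d x = (if y - x = d then 1 else if x - y = d then - 1 else 0)"
    if "{x, y} \<in> edges T" "d \<noteq> 0" for x y d
  proof (cases "up c x y")
    case False
    then have "up c y x" using c[OF that(1)] that(1) by (auto simp: up_def insert_commute neq_iff)
    then have "N d x - N d y = (if x - y = d then 1 else if y - x = d then - 1 else 0)" by (rule Nup)
    moreover have "\<not> (x - y = d \<and> y - x = d)"
    proof
      assume "x - y = d \<and> y - x = d"
      then have "d + d = (x - y) + (y - x)" by simp
      then show False using that(2) by (simp add: complex_eq_iff)
    qed
    ultimately show ?thesis by (simp split: if_splits)
  qed (use Nup in blast)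
  moreover have "N (- d) x = - N d x" for d x by (auto simp: N_def)
  ultimately have "potential T U N" unfolding potential_def by blast
  then show ?thesis by blast
qed

end

section \<open>Zones and geodesics\<close>

locale tiling_pot = tiling +
  fixes U :: "complex set" and N :: "complex \<Rightarrow> complex \<Rightarrow> int"
  assumes pot: "potential T U N"
begin

lemma pot_edge:
  "{x, y} \<in> edges T \<Longrightarrow> d \<noteq> 0 \<Longrightarrow>
    N d y - N d x = (if y - x = d then 1 else if x - y = d then - 1 else 0)"
  using pot unfolding potential_def by blast

lemma pot_uminus: "N (- d) x = - N d x"
  using pot unfolding potential_def by blast

lemma U_props: "finite U" "0 \<notin> U" "d \<in> U \<Longrightarrow> - d \<notin> U"
  "{x, y} \<in> edges T \<Longrightarrow> y - x \<in> U \<or> x - y \<in> U"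
  using pot unfolding potential_def by blast+

lemma pot_step: "{x, x + d} \<in> edges T \<Longrightarrow> N d (x + d) = N d x + 1"
  using pot_edge[of x "x + d" d] edge_verts(3)[of x "x + d"] by fastforce

lemma asc_mono:
  assumes "(up k)\<^sup>*\<^sup>* v w" "d \<noteq> 0" "k \<bullet> d \<ge> 0"
  shows "N d v \<le> N d w"
  using assms(1)
proof (induction rule: rtranclp_induct)
  case (step y z)
  have "{y, z} \<in> edges T" "k \<bullet> y < k \<bullet> z" using step by (auto simp: up_def)
  then have "N d z - N d y = (if z - y = d then 1 else if y - z = d then - 1 else 0)"
    using pot_edge assms by blast
  moreover have "y - z \<noteq> d" using \<open>k \<bullet> y < k \<bullet> z\<close> assms by (auto simp: inner_diff_right)
  ultimately show ?case using step by (auto split: if_splits)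
qed simp

lemma asc_antimono:
  assumes "(up k)\<^sup>*\<^sup>* v w" "d \<noteq> 0" "k \<bullet> d \<le> 0"
  shows "N d w \<le> N d v"
  using asc_mono[OF assms(1), of "- d"] assms by (simp add: pot_uminus)

text \<open>The sum of all height differences. It is a lower bound for the length of a path, since each edge changes
  exactly one height by one.\<close>

definition D :: "complex \<Rightarrow> complex \<Rightarrow> nat" where
  "D v w = (\<Sum>d\<in>U. nat \<bar>N d w - N d v\<bar>)"

definition E :: "(complex \<times> complex) set" where
  "E = {(x, y). {x, y} \<in> edges T}"

lemma edge_change:
  assumes "{x, y} \<in> edges T"
  shows "\<exists>d\<in>U. ((y = x + d \<and> N d y = N d x + 1) \<or> (x = y + d \<and> N d x = N d y + 1)) \<and>
    (\<forall>e\<in>U - {d}. N e y = N e x)"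
proof -
  have main: "(\<forall>e\<in>U - {y - x}. N e y = N e x)" if "{x, y} \<in> edges T" "y - x \<in> U" for x y
  proof
    fix e assume e: "e \<in> U - {y - x}"
    have "x - y \<noteq> e" using e U_props(3)[OF that(2)] by auto
    moreover have "e \<noteq> 0" using e U_props(2) by auto
    ultimately show "N e y = N e x" using pot_edge[OF that(1), of e] e by auto
  qed
  from U_props(4)[OF assms] show ?thesis
  proof
    assume a: "y - x \<in> U"
    then show ?thesis using main[OF assms a] pot_step[of x "y - x"] assms
      by (intro bexI[of _ "y - x"]) auto
  next
    assume a: "x - y \<in> U"
    have e: "{y, x} \<in> edges T" using assms by (simp add: insert_commute)
    show ?thesis using main[OF e a] pot_step[of y "x - y"] e a
      by (intro bexI[of _ "x - y"]) auto
  qed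
qed

lemma D_split: "d \<in> U \<Longrightarrow> D v w = nat \<bar>N d w - N d v\<bar> + (\<Sum>e\<in>U - {d}. nat \<bar>N e w - N e v\<bar>)"
  unfolding D_def using U_props(1) by (rule sum.remove)

lemma D_sym: "D v w = D w v"
  by (simp add: D_def abs_minus_commute)

lemma D_self: "D v v = 0"
  by (simp add: D_def)

lemma D_edge:
  assumes "{x, y} \<in> edges T" shows "D x w \<le> D y w + 1"
proof -
  obtain d where d: "d \<in> U" "\<bar>N d y - N d x\<bar> = 1" "\<forall>e\<in>U - {d}. N e y = N e x"
    using edge_change[OF assms] by auto
  have "(\<Sum>e\<in>U - {d}. nat \<bar>N e w - N e x\<bar>) = (\<Sum>e\<in>U - {d}. nat \<bar>N e w - N e y\<bar>)"
    using d by (intro sum.cong) auto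
  then show ?thesis using d D_split[OF d(1), of x w] D_split[OF d(1), of y w] by linarith
qed

lemma D_le: "(v, w) \<in> E ^^ n \<Longrightarrow> D v w \<le> n"
proof (induction n arbitrary: v)
  case 0 then show ?case by (simp add: D_self)
next
  case (Suc n)
  then obtain y where "(v, y) \<in> E" "(y, w) \<in> E ^^ n" by (meson relpow_Suc_D2)
  then show ?case using D_edge[of v y w] Suc.IH by (fastforce simp: E_def)
qed

text \<open>Along an ascending path each height is monotone, so no step is wasted.\<close>

lemma asc_geodesic:
  assumes "(up k)\<^sup>*\<^sup>* v w" shows "(v, w) \<in> E ^^ D v w"
  using assms
proof (induction rule: rtranclp_induct)
  case base then show ?case by (simp add: D_self)
next
  case (step y z)
  have e: "{y, z} \<in> edges T" "k \<bullet> y < k \<bullet> z" using step by (auto simp: up_def)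
  obtain d where d: "d \<in> U" "(z = y + d \<and> N d z = N d y + 1) \<or> (y = z + d \<and> N d y = N d z + 1)"
    "\<forall>e\<in>U - {d}. N e z = N e y"
    using edge_change[OF e(1)] by blast
  have d0: "d \<noteq> 0" using d U_props(2) by auto
  have "(\<Sum>e\<in>U - {d}. nat \<bar>N e z - N e v\<bar>) = (\<Sum>e\<in>U - {d}. nat \<bar>N e y - N e v\<bar>)"
    using d by (intro sum.cong) auto
  moreover have "\<bar>N d z - N d v\<bar> = \<bar>N d y - N d v\<bar> + 1"
    using d(2)
  proof
    assume a: "z = y + d \<and> N d z = N d y + 1"
    then have "k \<bullet> d \<ge> 0" using e by (simp add: inner_right_distrib)
    then have "N d v \<le> N d y" using asc_mono[OF step(1) d0] by blast
    then show ?thesis using conjunct2[OF a] by linarith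
  next
    assume a: "y = z + d \<and> N d y = N d z + 1"
    then have "k \<bullet> d \<le> 0" using e by (simp add: inner_right_distrib)
    then have "N d y \<le> N d v" using asc_antimono[OF step(1) d0] by blast
    then show ?thesis using conjunct2[OF a] by linarith
  qed
  ultimately have "D v z = Suc (D v y)"
    using D_split[OF d(1), of v z] D_split[OF d(1), of v y] by linarith
  then show ?case using step.IH e(1) by (auto simp: E_def intro: relpow_Suc_I)
qed

definition is_top :: "complex \<Rightarrow> complex \<Rightarrow> bool" where
  "is_top k t \<longleftrightarrow> t \<in> verts T \<and> (\<forall>z\<in>P. k \<bullet> z \<le> k \<bullet> t)"

lemma asc_top:
  assumes "v \<in> verts T" shows "\<exists>t. (up k)\<^sup>*\<^sup>* v t \<and> is_top k t"
  using assms
proof (induction "height k v" arbitrary: v rule: less_induct)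
  case less
  show ?case
  proof (cases "is_top k v")
    case False
    then obtain z where "z \<in> P" "k \<bullet> v < k \<bullet> z" using less by (auto simp: is_top_def not_le)
    then obtain y where y: "{v, y} \<in> edges T" "k \<bullet> v < k \<bullet> y" using ascend less(2) by blast
    then have yv: "y \<in> verts T" using edge_verts by blast
    then obtain t where t: "(up k)\<^sup>*\<^sup>* y t" "is_top k t" using less(1) height_less y by blast
    have "up k v y" using y by (simp add: up_def)
    then show ?thesis using t by (meson converse_rtranclp_into_rtranclp)
  qed blast
qed

text \<open>Between two vertices of maximal height nothing can start in the interior of a tile, since interior
  points of the polygon are not maximal. So the segment between them follows an edge.\<close>

lemma top_direction:
  assumes y: "is_top k y" "is_top k z" "y \<noteq> z" and k: "k \<noteq> 0"
  shows "\<exists>y' r. {y, y'} \<in> edges T \<and> r > 0 \<and> z - y = r *\<^sub>R (y' - y)"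
proof (rule ccontr)
  assume n: "\<not> ?thesis"
  have v: "y \<in> verts T" "z \<in> P" using y verts_P by (auto simp: is_top_def)
  have zy: "k \<bullet> z = k \<bullet> y" using y v verts_P unfolding is_top_def by (metis order_antisym)
  have "\<not> (\<exists>r>0. z - y = r *\<^sub>R (x - y))" if "{y, x} \<in> edges T" for x
    using n that by blast
  then obtain Q \<delta> where Q: "tile T Q" "0 < \<delta>" "y + \<delta> *\<^sub>R (z - y) \<in> interior Q"
    using direction_tile[OF v(1), of "z - y"] y v by auto
  have "y + \<delta> *\<^sub>R (z - y) \<in> interior P" using Q tile_props(6) interior_mono by blast
  then obtain e where e: "e > 0" "ball (y + \<delta> *\<^sub>R (z - y)) e \<subseteq> P" by (meson mem_interior)
  obtain s where s: "0 < s" "s * norm k < e" using small_step[OF e(1)] by metis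
  have "y + \<delta> *\<^sub>R (z - y) + s *\<^sub>R k \<in> P" using e s by (auto simp: dist_norm)
  then have "k \<bullet> (y + \<delta> *\<^sub>R (z - y) + s *\<^sub>R k) \<le> k \<bullet> y" using y by (simp add: is_top_def)
  then have "s * (k \<bullet> k) \<le> 0" using zy by (simp add: inner_right_distrib inner_diff_right)
  then show False using s k by (metis inner_gt_zero_iff mult_pos_pos not_le)
qed

lemma top_unique:
  assumes gen: "\<forall>x y. {x, y} \<in> edges T \<longrightarrow> k \<bullet> x \<noteq> k \<bullet> y" and k: "k \<noteq> 0" and t: "is_top k t" "is_top k t'"
  shows "t = t'"
proof (rule ccontr)
  assume "t \<noteq> t'"
  then obtain y r where y: "{t, y} \<in> edges T" "r > 0" "t' - t = r *\<^sub>R (y - t)"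
    using top_direction[OF t] k by blast
  have "k \<bullet> t' = k \<bullet> t" using t verts_P unfolding is_top_def by (metis order_antisym)
  then have "r * (k \<bullet> (y - t)) = 0" using y(3) by (metis inner_diff_right inner_scaleR_right right_minus_eq)
  then show False using gen[rule_format, OF y(1)] y(2) by (simp add: inner_diff_right)
qed

lemma generic_top:
  assumes "e > 0" "k \<noteq> 0"
  shows "\<exists>c t. dist c k < e \<and> c \<noteq> 0 \<and> (\<forall>x y. {x, y} \<in> edges T \<longrightarrow> c \<bullet> x \<noteq> c \<bullet> y) \<and>
    (\<forall>v\<in>verts T. (up c)\<^sup>*\<^sup>* v t) \<and> is_top c t"
proof -
  obtain c where c: "dist c k < min e (norm k)" "\<forall>x y. {x, y} \<in> edges T \<longrightarrow> c \<bullet> x \<noteq> c \<bullet> y"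
    using generic_functional[of "min e (norm k)" k] assms by auto
  then have c0: "c \<noteq> 0" using assms by auto
  obtain p where "p \<in> corners P"
    using Krein_Milman_Minkowski[OF P_compact P_convex] P_interior
    by (metis (no_types, lifting) Collect_empty_eq convex_hull_empty corners_def equals0I interior_empty)
  then have "p \<in> verts T" using corners_P_verts by blast
  then obtain t where t: "is_top c t" using asc_top by blast
  have "(up c)\<^sup>*\<^sup>* v t" if "v \<in> verts T" for v
    using asc_top[OF that] top_unique[OF c(2) c0 t] by blast
  then show ?thesis using c c0 t by auto
qed

lemma E_sym: "(x, y) \<in> E \<Longrightarrow> (y, x) \<in> E"
  by (simp add: E_def insert_commute)

lemma E_pow_sym: "(x, y) \<in> E ^^ n \<Longrightarrow> (y, x) \<in> E ^^ n"
proof (induction n arbitrary: y)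
  case (Suc n)
  then obtain z where "(x, z) \<in> E ^^ n" "(z, y) \<in> E" by auto
  then show ?case using Suc.IH E_sym by (meson relpow_Suc_I2)
qed auto

lemma connected: "v \<in> verts T \<Longrightarrow> w \<in> verts T \<Longrightarrow> \<exists>n. (v, w) \<in> E ^^ n"
proof -
  assume vw: "v \<in> verts T" "w \<in> verts T"
  obtain c t where c: "\<forall>v\<in>verts T. (up c)\<^sup>*\<^sup>* v t" using generic_top[of 1 1] by (metis zero_less_one zero_neq_one)
  have "(v, t) \<in> E ^^ D v t" "(w, t) \<in> E ^^ D w t" using asc_geodesic c vw by blast+
  then have "(v, w) \<in> E ^^ (D v t + D w t)" using E_pow_sym
    by (subst relpow_add) blast
  then show ?thesis by blast
qed

lemma tile_asc_top:
  assumes Q: "tile T Q" and y: "y \<in> corners Q"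
  shows "\<exists>e. (up k)\<^sup>*\<^sup>* y e \<and> e \<in> corners Q \<and> (\<forall>z\<in>Q. k \<bullet> z \<le> k \<bullet> e)"
  using y
proof (induction "height k y" arbitrary: y rule: less_induct)
  case less
  show ?case
  proof (cases "\<forall>z\<in>Q. k \<bullet> z \<le> k \<bullet> y")
    case False
    then obtain z where z: "{y, z} \<in> edges T" "z \<in> corners Q" "k \<bullet> y < k \<bullet> z"
      using tile_ascend[OF Q less(2)] by (meson not_le)
    then have "height k z < height k y" using height_less edge_verts by blast
    then obtain e where "(up k)\<^sup>*\<^sup>* z e" "e \<in> corners Q" "\<forall>z\<in>Q. k \<bullet> z \<le> k \<bullet> e"
      using less(1) z by blast
    moreover have "up k y z" using z by (simp add: up_def)
    ultimately show ?thesis by (meson converse_rtranclp_into_rtranclp)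
  qed (use less in blast)
qed

lemma extreme_collinear:
  fixes a u :: complex
  assumes "a \<in> corners Q" "a + u \<in> corners Q" "a + r *\<^sub>R u \<in> corners Q" "u \<noteq> 0"
  shows "r = 0 \<or> r = 1"
proof (rule ccontr)
  assume n: "\<not> ?thesis"
  have Q: "a \<in> Q" "a + u \<in> Q" "a + r *\<^sub>R u \<in> Q" using assms by (auto simp: corners_def extreme_point_of_def)
  have seg: "x + s *\<^sub>R w \<in> open_segment x (x + w)" if "0 < s" "s < 1" "w \<noteq> 0" for x w :: complex and s
    using that by (auto simp: in_segment algebra_simps intro!: exI[of _ s])
  have no: "\<not> x + s *\<^sub>R w \<in> corners Q" if "0 < s" "s < 1" "w \<noteq> 0" "x \<in> Q" "x + w \<in> Q" for x w s
    using seg[OF that(1-3)] extreme_point_of_open_segment that by (metis corners_def mem_Collect_eq)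
  consider "0 < r" "r < 1" | "r > 1" | "r < 0" using n by linarith
  then show False
  proof cases
    case 1 then show False using no[of r u a] assms Q by blast
  next
    case 2
    then have "a + (1/r) *\<^sub>R (r *\<^sub>R u) \<notin> corners Q"
      using assms Q by (intro no) auto
    then show False using 2 assms by simp
  next
    case 3
    have eq: "(a + u) + (r - 1) *\<^sub>R u = a + r *\<^sub>R u" by (simp add: algebra_simps)
    have "(a + u) + (r - 1) *\<^sub>R u \<in> Q" unfolding eq by (rule Q)
    moreover have "(r - 1) *\<^sub>R u \<noteq> 0" using 3 assms by simp
    moreover have "0 < 1 / (1 - r)" "1 / (1 - r) < 1" using 3 by auto
    ultimately have "(a + u) + (1 / (1 - r)) *\<^sub>R ((r - 1) *\<^sub>R u) \<notin> corners Q"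
      using Q(2) no by blast
    moreover have "(1 / (1 - r)) *\<^sub>R ((r - 1) *\<^sub>R u) = - u"
    proof -
      have "(1 / (1 - r)) * (r - 1) = -1" using 3 by (simp add: field_simps)
      then show ?thesis by simp
    qed
    ultimately show False using assms by simp
  qed
qed

text \<open>From an edge with direction \<open>u\<close> to the opposite edge of the tile next to it, on the side
  where the functional \<open>\<i> * u\<close> is greater.\<close>

definition zone_step :: "complex \<Rightarrow> complex \<Rightarrow> complex \<Rightarrow> bool" where
  "zone_step u a b \<longleftrightarrow> {a, a + u} \<in> edges T \<and> {b, b + u} \<in> edges T \<and> N u a = N u b \<and>
    (up (\<i> * u))\<^sup>*\<^sup>* a b \<and> (\<i> * u) \<bullet> a < (\<i> * u) \<bullet> b \<and>
    (\<exists>Q. tile T Q \<and> b \<in> Q \<and> b + u \<in> Q \<and> a = rfl Q (b + u))"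

text \<open>Both ends of the edge have ascending paths through the tile to its opposite side. They are parallel to no
  \<open>u\<close>-edge, so the heights are preserved, and the lower end has to arrive at the lower end.\<close>

lemma zone_step_ex:
  assumes au: "{a, a + u} \<in> edges T" and t: "t \<in> P" "(\<i> * u) \<bullet> a < (\<i> * u) \<bullet> t"
  shows "\<exists>b. zone_step u a b"
proof -
  have u: "u \<noteq> 0" "norm u = 1" using edge_verts[OF au] by auto
  have tw: "wedge (a + u - a) (t - a) > 0" using t by (simp add: inner_i_times wedge_lin)
  obtain Q where Q: "tile T Q" "a \<in> Q" "a + u \<in> Q" "\<forall>y\<in>Q. wedge u (y - a) \<ge> 0"
    using side_tile[OF au t(1) tw] by auto
  define b where "b = rfl Q (a + u)"
  have bu: "b + u = rfl Q a" using rfl(3)[OF Q(1), of a "a + u"] by (simp add: b_def algebra_simps)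
  have bQ: "b \<in> Q" "b + u \<in> Q" using rfl(4)[OF Q(1)] Q bu by (auto simp: b_def)
  have a_eq: "a = rfl Q (b + u)" using bu rfl(2)[OF Q(1)] by simp
  have be: "{b, b + u} \<in> edges T" using opposite_edge[OF Q(1) au Q(2,3)] bu by (simp add: b_def insert_commute)
  have refl: "wedge u (z - b) = - wedge u (rfl Q z - a)" for z
  proof -
    have "rfl Q z - a = (b + u) - z" using rfl(3)[OF Q(1), of z "b + u"] a_eq by simp
    then show ?thesis by (simp add: wedge_lin)
  qed
  have bmax: "wedge u (z - b) \<le> 0" if "z \<in> Q" for z
    using refl[of z] Q(4) rfl(4)[OF Q(1) that] by fastforce
  have ab: "wedge u a < wedge u b"
  proof -
    obtain x where x: "x \<in> interior Q" using tile_props(3)[OF Q(1)] by blast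
    have "wedge u (x - a) > 0" using interior_wedge_pos[OF _ u(1) x] Q(4) by blast
    moreover have "wedge u (x - b) \<le> 0" using bmax x interior_subset by blast
    ultimately show ?thesis by (simp add: wedge_lin)
  qed
  have corn: "a \<in> corners Q" "a + u \<in> corners Q" "b \<in> corners Q" "b + u \<in> corners Q"
    using edge_in_tile_corners[OF Q(1) au Q(2,3)] edge_in_tile_corners[OF Q(1) be bQ] by auto
  have reach: "(up (\<i> * u))\<^sup>*\<^sup>* x b \<or> (up (\<i> * u))\<^sup>*\<^sup>* x (b + u)" if xc: "x \<in> corners Q" for x
  proof -
    obtain e where e: "(up (\<i> * u))\<^sup>*\<^sup>* x e" "e \<in> corners Q" "\<forall>z\<in>Q. (\<i> * u) \<bullet> z \<le> (\<i> * u) \<bullet> e"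
      using tile_asc_top[OF Q(1) xc] by blast
    have "e \<in> Q" using e tile_props(9)[OF Q(1)] by blast
    then have "wedge u (e - b) \<le> 0" using bmax by blast
    moreover have "wedge u b \<le> wedge u e" using e(3) bQ by (simp add: inner_i_times)
    ultimately have "wedge u (e - b) = 0" by (simp add: wedge_lin)
    then obtain r where r: "e - b = r *\<^sub>R u" using wedge_eq_0_scale u by metis
    then have e_eq: "e = b + r *\<^sub>R u" by (simp add: algebra_simps)
    then have "r = 0 \<or> r = 1" using extreme_collinear corn e u by metis
    then show ?thesis using e e_eq by auto
  qed
  have zero: "N u x = N u y" if "(up (\<i> * u))\<^sup>*\<^sup>* x y" for x y
    using asc_mono[OF that u(1)] asc_antimono[OF that u(1)] by (simp add: inner_i_times)
  have "(up (\<i> * u))\<^sup>*\<^sup>* a b \<and> N u a = N u b"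
    using reach[OF corn(1)] reach[OF corn(2)] zero pot_step[OF au] pot_step[OF be] by fastforce
  then show ?thesis unfolding zone_step_def
    using au be ab Q(1) bQ a_eq by (intro exI[of _ b]) (auto simp: inner_i_times)
qed

text \<open>There is only one tile on the lower side of the second edge, and the first edge is the reflection of the
  second one in it.\<close>

lemma zone_step_left_unique:
  assumes "zone_step u a1 b" "zone_step u a2 b"
  shows "a1 = a2"
proof -
  have main: "\<exists>Q. tile T Q \<and> b + u \<in> Q \<and> b \<in> Q \<and> (\<forall>y\<in>Q. wedge (b - (b + u)) (y - (b + u)) \<ge> 0) \<and> a = rfl Q (b + u)"
    if z: "zone_step u a b" for a
  proof -
    obtain Q where Q: "tile T Q" "b \<in> Q" "b + u \<in> Q" "a = rfl Q (b + u)" using z by (auto simp: zone_step_def)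
    have b: "{b, b + u} \<in> edges T" using z by (simp add: zone_step_def)
    have "a \<in> Q" using Q rfl(4) by blast
    moreover have "wedge (b + u - b) (a - b) < 0" using z by (simp add: zone_step_def inner_i_times wedge_lin)
    ultimately have "\<forall>y\<in>Q. wedge (b + u - b) (y - b) \<le> 0"
      using edge_side[OF Q(1) b Q(2,3)] by force
    then have "\<forall>y\<in>Q. wedge (b - (b + u)) (y - (b + u)) \<ge> 0" by (simp add: wedge_lin)
    then show ?thesis using Q by blast
  qed
  have "b + u \<noteq> b" using edge_verts[of b "b + u"] assms by (auto simp: zone_step_def)
  then show ?thesis using main[OF assms(1)] main[OF assms(2)] side_tile_unique by metis
qed

lemma zone_chain:
  assumes "{a, a + u} \<in> edges T"
  shows "\<exists>e. (zone_step u)\<^sup>*\<^sup>* a e \<and> {e, e + u} \<in> edges T \<and> is_top (\<i> * u) e"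
  using assms
proof (induction "height (\<i> * u) a" arbitrary: a rule: less_induct)
  case less
  show ?case
  proof (cases "is_top (\<i> * u) a")
    case False
    have "a \<in> verts T" using edge_verts less by blast
    then obtain t where "t \<in> P" "(\<i> * u) \<bullet> a < (\<i> * u) \<bullet> t" using False by (auto simp: is_top_def not_le)
    then obtain b where b: "zone_step u a b" using zone_step_ex less by blast
    then have bu: "{b, b + u} \<in> edges T" "(\<i> * u) \<bullet> a < (\<i> * u) \<bullet> b" by (auto simp: zone_step_def)
    then have "height (\<i> * u) b < height (\<i> * u) a" using height_less edge_verts by blast
    then obtain e where "(zone_step u)\<^sup>*\<^sup>* b e" "{e, e + u} \<in> edges T" "is_top (\<i> * u) e"
      using less(1) bu by blast
    then show ?thesis using b by (meson converse_rtranclp_into_rtranclp)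
  qed (use less in blast)
qed

text \<open>A side of the polygon parallel to \<open>u\<close> is a chain of unit edges, each of which raises the height.\<close>

lemma top_side_levels:
  assumes "is_top (\<i> * u) y" "is_top (\<i> * u) z" "z = y + s *\<^sub>R u" "s > 0" "norm u = 1"
  shows "N u y < N u z"
  using assms
proof (induction "height u y" arbitrary: y s rule: less_induct)
  case less
  have u0: "u \<noteq> 0" using less by auto
  then have yz: "y \<noteq> z" using less by auto
  obtain y' r where y': "{y, y'} \<in> edges T" "r > 0" "z - y = r *\<^sub>R (y' - y)"
    using top_direction[OF less(2,3) yz] u0 by auto
  have "norm (y' - y) = 1" using edge_verts y' by blast
  have ru: "r *\<^sub>R (y' - y) = s *\<^sub>R u" using y'(3) less(4) by simp
  then have "norm (r *\<^sub>R (y' - y)) = norm (s *\<^sub>R u)" by simp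
  then have "r = s" using \<open>norm (y' - y) = 1\<close> less y'(2) by simp
  then have "y' - y = u" using ru y'(2) by simp
  then have y'u: "y' = y + u" by (simp add: algebra_simps)
  have e: "{y, y + u} \<in> edges T" using y' y'u by simp
  have st: "N u (y + u) = N u y + 1" using pot_step[OF e] .
  have top': "is_top (\<i> * u) (y + u)"
    using less(2) edge_verts[OF e] by (simp add: is_top_def inner_i_times wedge_lin)
  have zv: "z \<in> verts T" using less by (simp add: is_top_def)
  consider "s < 1" | "s = 1" | "s > 1" by linarith
  then show ?case
  proof cases
    case 1
    have "z \<in> closed_segment y (y + u)"
      unfolding in_segment using 1 less by (intro exI[of _ s]) (auto simp: algebra_simps)
    then have "z \<in> {y, y + u}" using edge_inter_verts[OF e] zv by blast
    then show ?thesis using yz st by auto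
  next
    case 2
    then show ?thesis using less st by simp
  next
    case 3
    have "u \<bullet> y < u \<bullet> (y + u)" using u0 by (simp add: inner_right_distrib)
    then have "height u (y + u) < height u y" using height_less edge_verts[OF e] by blast
    moreover have "z = (y + u) + (s - 1) *\<^sub>R u" using less(4) by (simp add: algebra_simps)
    moreover have "s - 1 > 0" using 3 by simp
    ultimately have "N u (y + u) < N u z" using less(1) top' less(3,6) by blast
    then show ?thesis using st by simp
  qed
qed

text \<open>Both edges are connected by zone steps to an edge on the side of the polygon where \<open>\<i> * u\<close> is maximal. The height is constant
  along the steps and distinguishes the edges on that side, so the two chains end in the same edge. Steps
  are injective, so one chain is a part of the other.\<close>

lemma zone_comparable:
  assumes a: "{a, a + u} \<in> edges T" and b: "{b, b + u} \<in> edges T" and ab: "N u a = N u b"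
  shows "(up (\<i> * u))\<^sup>*\<^sup>* a b \<or> (up (\<i> * u))\<^sup>*\<^sup>* b a"
proof -
  have u: "u \<noteq> 0" "norm u = 1" using edge_verts[OF a] by auto
  have asc: "(up (\<i> * u))\<^sup>*\<^sup>* x y \<and> N u x = N u y" if "(zone_step u)\<^sup>*\<^sup>* x y" for x y
    using that by (induction rule: rtranclp_induct) (auto simp: zone_step_def)
  obtain e where e: "(zone_step u)\<^sup>*\<^sup>* a e" "{e, e + u} \<in> edges T" "is_top (\<i> * u) e"
    using zone_chain[OF a] by blast
  obtain f where f: "(zone_step u)\<^sup>*\<^sup>* b f" "{f, f + u} \<in> edges T" "is_top (\<i> * u) f"
    using zone_chain[OF b] by blast
  have N_eq: "N u e = N u f" using asc e f ab by metis
  have "wedge u e = wedge u f"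
    using e(3) f(3) verts_P unfolding is_top_def inner_i_times by (metis order_antisym)
  then have "wedge u (f - e) = 0" by (simp add: wedge_lin)
  then obtain s where s: "f - e = s *\<^sub>R u" using wedge_eq_0_scale u by metis
  have "s = 0"
  proof (rule linorder_cases[of s 0])
    assume "s < 0"
    moreover have "e = f + (- s) *\<^sub>R u" using s by (simp add: algebra_simps)
    ultimately show ?thesis using top_side_levels[OF f(3) e(3)] u N_eq by fastforce
  next
    assume "s > 0"
    moreover have "f = e + s *\<^sub>R u" using s by (simp add: algebra_simps)
    ultimately show ?thesis using top_side_levels[OF e(3) f(3)] u N_eq by fastforce
  qed
  then have fe: "f = e" using s by simp
  have "(zone_step u)\<^sup>*\<^sup>* a b \<or> (zone_step u)\<^sup>*\<^sup>* b a"
    using e(1) f(1) unfolding fe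
  proof (induction rule: rtranclp_induct)
    case (step y z)
    show ?case using step(4)
    proof (cases rule: rtranclp.cases)
      case rtrancl_refl
      then show ?thesis using step by (meson rtranclp.rtrancl_into_rtrancl)
    next
      case (rtrancl_into_rtrancl x)
      then have "x = y" using zone_step_left_unique step by blast
      then show ?thesis using rtrancl_into_rtrancl step by blast
    qed
  qed blast
  then show ?thesis using asc by blast
qed

end

text \<open>Two centres of symmetry would make the polygon invariant under a translation, which is impossible
  for a bounded set.\<close>

lemma center_reflection:
  assumes "symmetric_polygon P"
  shows "point_reflection (center P) ` P = P"
proof -
  obtain c where c: "point_reflection c ` P = P" using assms by (auto simp: symmetric_polygon_def)
  have P: "compact P" "P \<noteq> {}" using assms by (auto simp: symmetric_polygon_def polytope_imp_compact)
  have uniq: "c' = c" if c': "point_reflection c' ` P = P" for c'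
  proof (rule ccontr)
    assume "c' \<noteq> c"
    have "continuous_on P (\<lambda>x. (c' - c) \<bullet> x)" by (intro continuous_intros)
    then obtain x where x: "x \<in> P" "\<forall>y\<in>P. (c' - c) \<bullet> y \<le> (c' - c) \<bullet> x"
      using continuous_attains_sup[OF P] by blast
    have "point_reflection c' (point_reflection c x) \<in> P" using x c c' by blast
    moreover have "point_reflection c' (point_reflection c x) = x + 2 *\<^sub>R (c' - c)"
      by (simp add: point_reflection_def scaleR_conv_of_real algebra_simps)
    ultimately have "(c' - c) \<bullet> (x + 2 *\<^sub>R (c' - c)) \<le> (c' - c) \<bullet> x" using x by metis
    then have "(c' - c) \<bullet> (c' - c) \<le> 0" by (simp add: inner_right_distrib)
    then show False using \<open>c' \<noteq> c\<close> by (metis inner_gt_zero_iff not_le right_minus_eq)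
  qed
  have "center P = c" unfolding center_def using c uniq by (rule the_equality)
  then show ?thesis using c by simp
qed

lemma reflection_corners:
  assumes im: "point_reflection c ` P = P" and p: "p \<in> corners P"
  shows "point_reflection c p \<in> corners P"
proof -
  have pP: "p extreme_point_of P" using p by (simp add: corners_def)
  have P: "x \<in> P \<Longrightarrow> point_reflection c x \<in> P" for x using im by blast
  have "point_reflection c p \<notin> open_segment a b" if ab: "a \<in> P" "b \<in> P" for a b
  proof
    assume "point_reflection c p \<in> open_segment a b"
    then obtain u where u: "0 < u" "u < 1" "a \<noteq> b" "point_reflection c p = (1 - u) *\<^sub>R a + u *\<^sub>R b"
      by (auto simp: in_segment)
    have "p = point_reflection c ((1 - u) *\<^sub>R a + u *\<^sub>R b)" using u by (metis point_reflection_simps(1))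
    also have "\<dots> = (1 - u) *\<^sub>R point_reflection c a + u *\<^sub>R point_reflection c b"
      by (simp add: point_reflection_def algebra_simps)
    finally have "p \<in> open_segment (point_reflection c a) (point_reflection c b)"
      using u by (metis in_segment(2) point_reflection_simps(1))
    then show False using extreme_point_of_open_segment[OF pP] P ab by blast
  qed
  then show ?thesis using P pP by (simp add: corners_def extreme_point_of_def)
qed

lemma strict_positive_near:
  fixes k :: "'a::real_inner"
  assumes "finite S" "\<forall>d\<in>S. k \<bullet> d > 0"
  shows "\<exists>e>0. \<forall>c. dist c k < e \<longrightarrow> (\<forall>d\<in>S. c \<bullet> d > 0)"
  using assms
proof (induction S rule: finite_induct)
  case empty
  then show ?case by (intro exI[of _ 1]) auto
next
  case (insert d S)
  then obtain e where e: "e > 0" "\<forall>c. dist c k < e \<longrightarrow> (\<forall>d\<in>S. c \<bullet> d > 0)" by auto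
  have d0: "k \<bullet> d > 0" "norm d > 0" using insert by auto
  have "c \<bullet> d > 0" if "dist c k < k \<bullet> d / norm d" for c
  proof -
    have "\<bar>(c - k) \<bullet> d\<bar> \<le> norm (c - k) * norm d" by (rule Cauchy_Schwarz_ineq2)
    also have "\<dots> < k \<bullet> d" using that d0 by (simp add: dist_norm field_simps)
    finally show ?thesis by (simp add: inner_diff_left)
  qed
  then show ?case using e d0 by (intro exI[of _ "min e (k \<bullet> d / norm d)"]) auto
qed

context tiling_pot
begin

lemma crossing:
  assumes "(x, w) \<in> E ^^ n" "d \<noteq> 0" "N d x > s" "N d w \<le> s"
  shows "\<exists>b i j. (x, b + d) \<in> E ^^ i \<and> {b, b + d} \<in> edges T \<and> N d b = s \<and> (b, w) \<in> E ^^ j \<and> n = i + 1 + j"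
  using assms(1,3)
proof (induction n arbitrary: x)
  case 0
  then show ?case using assms by simp
next
  case (Suc n)
  obtain y where y: "(x, y) \<in> E" "(y, w) \<in> E ^^ n" using Suc.prems(1) by (meson relpow_Suc_D2)
  show ?case
  proof (cases "N d y > s")
    case True
    then obtain b i j where b: "(y, b + d) \<in> E ^^ i" "{b, b + d} \<in> edges T" "N d b = s" "(b, w) \<in> E ^^ j" "n = i + 1 + j"
      using Suc.IH y by blast
    then have "(x, b + d) \<in> E ^^ Suc i" using y by (meson relpow_Suc_I2)
    then show ?thesis using b by (metis add_Suc)
  next
    case False
    have e: "{x, y} \<in> edges T" using y by (simp add: E_def)
    then have "x - y = d \<and> N d y - N d x = - 1"
      using pot_edge[OF e assms(2)] False Suc.prems(2) by (simp split: if_splits)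
    then have "x = y + d" "N d y = s" using False Suc.prems(2) by (auto simp: algebra_simps)
    then show ?thesis using y e by (intro exI[of _ y] exI[of _ 0] exI[of _ n]) (auto simp: insert_commute)
  qed
qed

lemma D_edge_sign:
  assumes "{v, v + \<delta>} \<in> edges T"
  shows "N \<delta> w > N \<delta> v \<Longrightarrow> D v w = D (v + \<delta>) w + 1" "N \<delta> w \<le> N \<delta> v \<Longrightarrow> D (v + \<delta>) w = D v w + 1"
proof -
  obtain d where d: "d \<in> U" "(v + \<delta> = v + d \<and> N d (v + \<delta>) = N d v + 1) \<or> (v = v + \<delta> + d \<and> N d v = N d (v + \<delta>) + 1)"
    "\<forall>e\<in>U - {d}. N e (v + \<delta>) = N e v"
    using edge_change[OF assms] by blast
  have rest: "(\<Sum>e\<in>U - {d}. nat \<bar>N e w - N e (v + \<delta>)\<bar>) = (\<Sum>e\<in>U - {d}. nat \<bar>N e w - N e v\<bar>)"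
    using d by (intro sum.cong) auto
  have dd: "d = \<delta> \<or> d = - \<delta>"
    using d(2) by (metis add.assoc add_cancel_left_right add_left_cancel eq_neg_iff_add_eq_0 add.commute)
  have st: "N \<delta> (v + \<delta>) = N \<delta> v + 1" using pot_step[OF assms] .
  have abs: "\<bar>N d w - N d x\<bar> = \<bar>N \<delta> w - N \<delta> x\<bar>" for x
    using dd by (auto simp: pot_uminus)
  show "N \<delta> w > N \<delta> v \<Longrightarrow> D v w = D (v + \<delta>) w + 1" "N \<delta> w \<le> N \<delta> v \<Longrightarrow> D (v + \<delta>) w = D v w + 1"
    unfolding D_split[OF d(1)] rest abs st by linarith+
qed

lemma D_shift:
  assumes "{v, v + \<delta>} \<in> edges T" "{b, b + \<delta>} \<in> edges T"
  shows "D (v + \<delta>) (b + \<delta>) = D v b"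
  unfolding D_def
proof (rule sum.cong)
  fix e assume "e \<in> U"
  then have "e \<noteq> 0" using U_props(2) by auto
  then have "N e (v + \<delta>) - N e v = N e (b + \<delta>) - N e b"
    using pot_edge[OF assms(1), of e] pot_edge[OF assms(2), of e] by simp
  then show "nat \<bar>N e (b + \<delta>) - N e (v + \<delta>)\<bar> = nat \<bar>N e b - N e v\<bar>" by linarith
qed simp

text \<open>If the first step of a path leads away from the target in direction \<open>\<delta>\<close>, a geodesic from there has
  to cross the same zone back. The part between the two crossings is replaced by a path along the border of the
  zone, which has no more steps and saves the two crossings.\<close>

lemma geodesic_aux: "(v, w) \<in> E ^^ n \<Longrightarrow> (v, w) \<in> E ^^ D v w"
proof (induction n arbitrary: v)
  case 0
  then show ?case by (simp add: D_self)
next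
  case (Suc n)
  obtain v1 where v1: "(v, v1) \<in> E" "(v1, w) \<in> E ^^ n" using Suc.prems by (meson relpow_Suc_D2)
  define \<delta> where "\<delta> = v1 - v"
  have v1\<delta>: "v1 = v + \<delta>" by (simp add: \<delta>_def)
  have e: "{v, v + \<delta>} \<in> edges T" using v1 v1\<delta> by (simp add: E_def)
  have \<delta>0: "\<delta> \<noteq> 0" using edge_verts[OF e] by auto
  have path: "(v1, w) \<in> E ^^ D v1 w" using Suc.IH v1 by blast
  show ?case
  proof (cases "N \<delta> w > N \<delta> v")
    case True
    then show ?thesis using D_edge_sign(1)[OF e True] path v1 v1\<delta>
      by (metis Suc_eq_plus1 relpow_Suc_I2)
  next
    case False
    then have le: "N \<delta> w \<le> N \<delta> v" by simp
    have Dv: "D v1 w = D v w + 1" using D_edge_sign(2)[OF e le] v1\<delta> by simp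
    have "N \<delta> v1 > N \<delta> v" using pot_step[OF e] v1\<delta> by simp
    then obtain b i j where b: "(v1, b + \<delta>) \<in> E ^^ i" "{b, b + \<delta>} \<in> edges T" "N \<delta> b = N \<delta> v"
      "(b, w) \<in> E ^^ j" "D v1 w = i + 1 + j"
      using crossing[OF path \<delta>0 _ le] by blast
    have "(v, b) \<in> E ^^ D v b"
      using zone_comparable[OF e b(2)] b(3) asc_geodesic D_sym E_pow_sym by metis
    then have vw: "(v, w) \<in> E ^^ (D v b + j)" using b(4) by (subst relpow_add) blast
    have "D v b \<le> i" using D_le[OF b(1)] D_shift[OF e b(2)] v1\<delta> by simp
    then have "D v b + j \<le> D v w" using b(5) Dv by simp
    moreover have "D v w \<le> D v b + j" using D_le[OF vw] .
    ultimately show ?thesis using vw by simp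
  qed
qed

theorem geodesic: "v \<in> verts T \<Longrightarrow> w \<in> verts T \<Longrightarrow> (v, w) \<in> E ^^ D v w"
  using connected geodesic_aux by blast

text \<open>An edge of the first zone that lies on the lower side of the two other zones. A zone is given by a
  direction and the height at which it is crossed.\<close>

definition below :: "complex \<Rightarrow> complex \<Rightarrow> complex \<Rightarrow> int \<Rightarrow> int \<Rightarrow> int \<Rightarrow> bool" where
  "below d1 d2 d3 t1 t2 t3 \<longleftrightarrow> (\<exists>a. {a, a + d1} \<in> edges T \<and> N d1 a = t1 - 1 \<and> N d2 a < t2 \<and> N d3 a < t3)"

definition above :: "complex \<Rightarrow> complex \<Rightarrow> complex \<Rightarrow> int \<Rightarrow> int \<Rightarrow> int \<Rightarrow> bool" where
  "above d1 d2 d3 t1 t2 t3 \<longleftrightarrow> (\<exists>a. {a, a + d1} \<in> edges T \<and> N d1 a = t1 - 1 \<and> N d2 a \<ge> t2 \<and> N d3 a \<ge> t3)"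

text \<open>Along the first zone the second height does not decrease and the third does not increase.\<close>

lemma below_above:
  assumes "wedge d1 d2 > 0" "wedge d3 d1 > 0" "below d1 d2 d3 t1 t2 t3" "above d1 d2 d3 t1 t2 t3"
  shows False
proof -
  obtain a b where a: "{a, a + d1} \<in> edges T" "N d1 a = t1 - 1" "N d2 a < t2" "N d3 a < t3"
    and b: "{b, b + d1} \<in> edges T" "N d1 b = t1 - 1" "N d2 b \<ge> t2" "N d3 b \<ge> t3"
    using assms by (auto simp: below_def above_def)
  have d0: "d2 \<noteq> 0" "d3 \<noteq> 0" using assms by auto
  have k: "(\<i> * d1) \<bullet> d2 \<ge> 0" "(\<i> * d1) \<bullet> d3 \<le> 0"
    using assms wedge_commute[of d1 d3] by (auto simp: inner_i_times)
  show False
    using zone_comparable[OF a(1) b(1)]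
  proof
    assume "(up (\<i> * d1))\<^sup>*\<^sup>* a b"
    then show False using asc_antimono[OF _ d0(2) k(2)] a b by fastforce
  next
    assume "(up (\<i> * d1))\<^sup>*\<^sup>* b a"
    then show False using asc_mono[OF _ d0(1) k(1)] a b by fastforce
  qed (use a b in simp)
qed

lemma asc_cross:
  assumes "(up k)\<^sup>*\<^sup>* a t" "d \<noteq> 0" "N d a < s" "s \<le> N d t"
  shows "\<exists>y. (up k)\<^sup>*\<^sup>* a y \<and> {y, y + d} \<in> edges T \<and> N d y = s - 1"
  using assms(1,4)
proof (induction rule: rtranclp_induct)
  case base
  then show ?case using assms by simp
next
  case (step y z)
  show ?case
  proof (cases "s \<le> N d y")
    case False
    have e: "{y, z} \<in> edges T" using step by (simp add: up_def)
    then have "z - y = d \<and> N d z - N d y = 1"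
      using pot_edge[OF e assms(2)] False step by (simp split: if_splits)
    then have "z = y + d" "N d y = s - 1" using False step by (auto simp: algebra_simps)
    then show ?thesis using step e by blast
  qed (use step in blast)
qed

lemma generic_top_positive:
  assumes "finite S" "\<forall>d\<in>S. k \<bullet> d > 0" "k \<noteq> 0"
  shows "\<exists>c t. (\<forall>d\<in>S. c \<bullet> d > 0) \<and> c \<noteq> 0 \<and> (\<forall>x y. {x, y} \<in> edges T \<longrightarrow> c \<bullet> x \<noteq> c \<bullet> y) \<and>
    (\<forall>v\<in>verts T. (up c)\<^sup>*\<^sup>* v t) \<and> is_top c t"
proof -
  obtain e where "e > 0" "\<forall>c. dist c k < e \<longrightarrow> (\<forall>d\<in>S. c \<bullet> d > 0)"
    using strict_positive_near[OF assms(1,2)] by blast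
  then show ?thesis using generic_top[of e k] assms(3) by metis
qed

text \<open>An ascending path from the edge to the top, for a functional that is positive on the second direction and negative
  on the other two, has to cross the second zone and stays on the lower side of the others.\<close>

lemma below_rotate:
  assumes w: "wedge d1 d2 > 0" "wedge d2 d3 > 0" "wedge d3 d1 > 0"
    and b: "below d1 d2 d3 t1 t2 t3" and x: "x \<in> verts T" "N d2 x \<ge> t2"
  shows "below d2 d3 d1 t2 t3 t1"
proof -
  obtain a where a: "{a, a + d1} \<in> edges T" "N d1 a = t1 - 1" "N d2 a < t2" "N d3 a < t3"
    using b by (auto simp: below_def)
  \<comment> \<open>The determinant with \<open>d1 - d3\<close> has the signs \<open>-\<close>, \<open>+\<close>, \<open>-\<close> on the three directions.\<close>
  define k where "k = \<i> * (d1 - d3)"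
  have k: "k \<bullet> z = wedge d1 z - wedge d3 z" for z
    unfolding k_def inner_i_times by (simp add: wedge_lin)
  have kd: "\<forall>d\<in>{- d1, d2, - d3}. k \<bullet> d > 0"
    using w unfolding k by (auto simp: wedge_lin wedge_commute[of d1 d3] wedge_commute[of d3 d2])
  then have "k \<noteq> 0" by auto
  then obtain c t where c: "\<forall>d\<in>{- d1, d2, - d3}. c \<bullet> d > 0" "\<forall>v\<in>verts T. (up c)\<^sup>*\<^sup>* v t"
    using generic_top_positive[OF _ kd] by auto
  have d0: "d1 \<noteq> 0" "d2 \<noteq> 0" "d3 \<noteq> 0" using w by auto
  have cd: "c \<bullet> d1 \<le> 0" "c \<bullet> d2 \<ge> 0" "c \<bullet> d3 \<le> 0" using c by auto
  have at: "(up c)\<^sup>*\<^sup>* a t" using c edge_verts[OF a(1)] by blast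
  have "N d2 t \<ge> t2" using asc_mono[of c x t d2] c x d0 cd by fastforce
  then obtain y where y: "(up c)\<^sup>*\<^sup>* a y" "{y, y + d2} \<in> edges T" "N d2 y = t2 - 1"
    using asc_cross[OF at d0(2) a(3)] by blast
  have "N d1 y \<le> N d1 a" "N d3 y \<le> N d3 a" using asc_antimono[OF y(1)] d0 cd by blast+
  then show ?thesis unfolding below_def using y a by (intro exI[of _ y]) auto
qed

lemma exit_edge:
  assumes "(v, w) \<in> E ^^ n" "R v" "\<not> R w"
  shows "\<exists>x y. {x, y} \<in> edges T \<and> R x \<and> \<not> R y"
  using assms
proof (induction n arbitrary: v)
  case (Suc n)
  then obtain y where y: "(v, y) \<in> E" "(y, w) \<in> E ^^ n" by (meson relpow_Suc_D2)
  show ?case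
  proof (cases "R y")
    case False
    then show ?thesis using y Suc.prems by (auto simp: E_def)
  qed (use Suc y in blast)
qed auto

lemma edge_increase:
  assumes "{x, y} \<in> edges T" "d \<noteq> 0" "N d x < t" "t \<le> N d y"
  shows "y = x + d" "N d x = t - 1"
proof -
  have "y - x = d \<and> N d y - N d x = 1"
    using pot_edge[OF assms(1,2)] assms by (simp split: if_splits)
  then show "y = x + d" "N d x = t - 1" using assms by (auto simp: algebra_simps)
qed

text \<open>A path from the region below all three zones to the region above them leaves the former through
  some zone and enters the latter through some zone. By \<open>below_rotate\<close> every zone then has an edge below the two others,
  which contradicts \<open>below_above\<close>.\<close>

theorem no_positively_spanning_triple:
  assumes w: "wedge d1 d2 > 0" "wedge d2 d3 > 0" "wedge d3 d1 > 0"
    and vx: "v \<in> verts T" "x \<in> verts T" "N d1 v < N d1 x" "N d2 v < N d2 x" "N d3 v < N d3 x"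
  shows False
proof -
  define t1 t2 t3 where t: "t1 = N d1 x" "t2 = N d2 x" "t3 = N d3 x"
  have d0: "d1 \<noteq> 0" "d2 \<noteq> 0" "d3 \<noteq> 0" "d1 \<noteq> d2" "d2 \<noteq> d3" "d3 \<noteq> d1" using w by auto
  obtain n where n: "(v, x) \<in> E ^^ n" using connected vx by blast
  have "below d1 d2 d3 t1 t2 t3 \<or> below d2 d3 d1 t2 t3 t1 \<or> below d3 d1 d2 t3 t1 t2"
  proof -
    obtain a y where ay: "{a, y} \<in> edges T" "N d1 a < t1 \<and> N d2 a < t2 \<and> N d3 a < t3"
      "\<not> (N d1 y < t1 \<and> N d2 y < t2 \<and> N d3 y < t3)"
      using exit_edge[OF n, of "\<lambda>a. N d1 a < t1 \<and> N d2 a < t2 \<and> N d3 a < t3"] vx t by auto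
    then consider "t1 \<le> N d1 y" | "t2 \<le> N d2 y" | "t3 \<le> N d3 y" by linarith
    then show ?thesis
    proof cases
      case 1 then show ?thesis using edge_increase[OF ay(1) d0(1) _ 1] ay unfolding below_def by blast
    next
      case 2 then show ?thesis using edge_increase[OF ay(1) d0(2) _ 2] ay unfolding below_def by blast
    next
      case 3 then show ?thesis using edge_increase[OF ay(1) d0(3) _ 3] ay unfolding below_def by blast
    qed
  qed
  then have all: "below d1 d2 d3 t1 t2 t3 \<and> below d2 d3 d1 t2 t3 t1 \<and> below d3 d1 d2 t3 t1 t2"
    using below_rotate[OF w, of t1 t2 t3 x] below_rotate[OF w(2,3,1), of t2 t3 t1 x]
      below_rotate[OF w(3,1,2), of t3 t1 t2 x] vx t by auto
  obtain y a where ay: "{y, a} \<in> edges T" "\<not> (N d1 y \<ge> t1 \<and> N d2 y \<ge> t2 \<and> N d3 y \<ge> t3)"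
    "N d1 a \<ge> t1 \<and> N d2 a \<ge> t2 \<and> N d3 a \<ge> t3"
    using exit_edge[OF n, of "\<lambda>a. \<not> (N d1 a \<ge> t1 \<and> N d2 a \<ge> t2 \<and> N d3 a \<ge> t3)"] vx t by auto
  have only: "N d' y \<ge> t'" if "N d y < t" "t \<le> N d a" "d \<noteq> 0" "d' \<noteq> 0" "d \<noteq> d'" "t' \<le> N d' a" for d d' t t'
    using edge_increase(1)[OF ay(1) that(3,1,2)] edge_increase(1)[OF ay(1) that(4) _ that(6)] that(5)
    by (metis add_left_cancel not_le)
  consider "N d1 y < t1" | "N d2 y < t2" | "N d3 y < t3" using ay by linarith
  then show False
  proof cases
    case 1
    have "above d1 d2 d3 t1 t2 t3" unfolding above_def
      using edge_increase[OF ay(1) d0(1) 1] only[OF 1] ay d0 by metis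
    then show False using below_above[OF w(1,3)] all by blast
  next
    case 2
    have "above d2 d3 d1 t2 t3 t1" unfolding above_def
      using edge_increase[OF ay(1) d0(2) 2] only[OF 2] ay d0 by metis
    then show False using below_above[OF w(2,1)] all by blast
  next
    case 3
    have "above d3 d1 d2 t3 t1 t2" unfolding above_def
      using edge_increase[OF ay(1) d0(3) 3] only[OF 3] ay d0 by metis
    then show False using below_above[OF w(3,2)] all by blast
  qed
qed

lemma level_change_edge:
  assumes "v \<in> verts T" "w \<in> verts T" "d \<noteq> 0" "N d v < N d w"
  shows "norm d = 1"
proof -
  obtain n where "(v, w) \<in> E ^^ n" using connected assms by blast
  then obtain x y where xy: "{x, y} \<in> edges T" "N d x < N d w" "\<not> N d y < N d w"
    using exit_edge[of v w n "\<lambda>x. N d x < N d w"] assms by blast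
  then have "y = x + d" using edge_increase(1)[OF xy(1) assms(3) xy(2)] by simp
  then show ?thesis using edge_verts(4)[OF xy(1)] by simp
qed

text \<open>Otherwise zero is a convex combination of at most three of the directions. Two opposite directions
  cannot both lead to greater heights, and three are excluded by \<open>no_positively_spanning_triple\<close>.\<close>

theorem separating_halfplane:
  assumes vw: "v \<in> verts T" "w \<in> verts T"
  defines "S \<equiv> {d \<in> U \<union> uminus ` U. N d w < N d v}"
  shows "\<exists>c. c \<noteq> 0 \<and> (\<forall>d\<in>S. c \<bullet> d > 0)"
proof -
  have fin: "finite S" using U_props(1) by (simp add: S_def)
  have S0: "d \<noteq> 0" if "d \<in> S" for d using that U_props(2) by (auto simp: S_def)
  have S1: "norm d = 1" if "d \<in> S" for d
    using level_change_edge[OF vw(2,1) S0[OF that]] that by (simp add: S_def)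
  have Sneg: "- d \<notin> S" if "d \<in> S" for d using that by (auto simp: S_def pot_uminus)
  have lt: "N d w < N d v" if "d \<in> S" for d using that by (simp add: S_def)
  have two: False if "a \<in> S" "b \<in> S" "\<alpha> \<ge> 0" "\<beta> \<ge> 0" "\<alpha> + \<beta> = 1" "\<alpha> *\<^sub>R a + \<beta> *\<^sub>R b = 0" for a b \<alpha> \<beta>
  proof -
    have "\<alpha> *\<^sub>R a = - (\<beta> *\<^sub>R b)" using that(6) by (simp add: eq_neg_iff_add_eq_0)
    then have "norm (\<alpha> *\<^sub>R a) = norm (\<beta> *\<^sub>R b)" by (metis norm_minus_cancel)
    then have "\<alpha> = \<beta>" using S1 that by simp
    then have "\<alpha> *\<^sub>R a = \<alpha> *\<^sub>R (- b)" using \<open>\<alpha> *\<^sub>R a = _\<close> by simp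
    moreover have "\<alpha> \<noteq> 0" using \<open>\<alpha> = \<beta>\<close> that(5) by auto
    ultimately have "a = - b" by (simp only: scaleR_cancel_left simp_thms)
    then show False using Sneg that by simp
  qed
  have three: False if abc: "a \<in> S" "b \<in> S" "c \<in> S" and pos: "\<alpha> \<ge> 0" "\<beta> \<ge> 0" "\<gamma> \<ge> 0" "\<alpha> + \<beta> + \<gamma> = 1"
    and z: "\<alpha> *\<^sub>R a + \<beta> *\<^sub>R b + \<gamma> *\<^sub>R c = 0" for a b c \<alpha> \<beta> \<gamma>
  proof (cases "\<alpha> = 0 \<or> \<beta> = 0 \<or> \<gamma> = 0")
    case True
    then show ?thesis using two[of b c \<beta> \<gamma>] two[of a c \<alpha> \<gamma>] two[of a b \<alpha> \<beta>] that by auto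
  next
    case False
    then have p: "\<alpha> > 0" "\<beta> > 0" "\<gamma> > 0" using pos by auto
    have "wedge a (\<alpha> *\<^sub>R a + \<beta> *\<^sub>R b + \<gamma> *\<^sub>R c) = 0" "wedge b (\<alpha> *\<^sub>R a + \<beta> *\<^sub>R b + \<gamma> *\<^sub>R c) = 0"
      unfolding z by simp_all
    then have eqs: "\<beta> * wedge a b = \<gamma> * wedge c a" "\<gamma> * wedge b c = \<alpha> * wedge a b"
      unfolding wedge_lin by (simp_all add: wedge_commute[of b a] wedge_commute[of a c])
    consider "wedge a b > 0" | "wedge a b < 0" | "wedge a b = 0" by linarith
    then show False
    proof cases
      case 1
      then have "wedge c a > 0" "wedge b c > 0" using eqs p by (metis mult_pos_pos zero_less_mult_pos)+
      then show False using no_positively_spanning_triple[OF 1 _ _ vw(2,1)] lt abc by blast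
    next
      case 2
      then have m: "wedge b a > 0" by (simp add: wedge_commute[of b])
      have "\<beta> * wedge b a = \<gamma> * wedge a c" "\<gamma> * wedge c b = \<alpha> * wedge b a"
        using eqs by (simp_all add: wedge_commute[of b a] wedge_commute[of a c] wedge_commute[of c b])
      then have "wedge a c > 0" "wedge c b > 0" using m p by (metis mult_pos_pos zero_less_mult_pos)+
      then show False using no_positively_spanning_triple[OF m _ _ vw(2,1)] lt abc by blast
    next
      case 3
      then have "wedge c a = 0" using eqs p by simp
      then have "b = a \<or> b = - a" "a = c \<or> a = - c" using 3 wedge_eq_0_unit S1 abc by blast+
      then have "b = a" "c = a" using Sneg abc by auto
      then have "(\<alpha> + \<beta> + \<gamma>) *\<^sub>R a = 0" using z by (simp add: scaleR_add_left)
      then show False using pos S0 abc by simp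
    qed
  qed
  have "0 \<notin> convex hull S"
  proof
    assume "0 \<in> convex hull S"
    then obtain S' where S': "finite S'" "S' \<subseteq> S" "card S' \<le> 3" "0 \<in> convex hull S'"
      unfolding caratheodory[of S] by auto
    have "S' \<noteq> {}" using S' by auto
    then obtain a where a: "a \<in> S'" by blast
    have "card (S' - {a}) \<le> 2" using S' a by simp
    then obtain b c where "S' \<subseteq> {a, b, c}" "b \<in> S'" "c \<in> S'"
    proof (cases "S' - {a} = {}")
      case True then show ?thesis using that[of a a] a by auto
    next
      case False
      then obtain b where b: "b \<in> S' - {a}" by blast
      have "card (S' - {a} - {b}) \<le> 1" using \<open>card (S' - {a}) \<le> 2\<close> b S' by simp
      then show ?thesis
      proof (cases "S' - {a} - {b} = {}")
        case True then show ?thesis using that[of b b] b by auto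
      next
        case False
        then obtain c where c: "c \<in> S' - {a} - {b}" by blast
        have "S' - {a} - {b} = {c}"
          using \<open>card (S' - {a} - {b}) \<le> 1\<close> c S' by (metis card_le_Suc0_iff_eq finite_Diff One_nat_def is_singletonI' is_singleton_def singletonD empty_iff)
        then show ?thesis using that[of b c] b c by auto
      qed
    qed
    then have "0 \<in> convex hull {a, b, c}" "a \<in> S" "b \<in> S" "c \<in> S"
      using S' a hull_mono by (metis subsetD, auto)
    then show False using three unfolding convex_hull_3 by (smt (verit) mem_Collect_eq)
  qed
  moreover have "closed (convex hull S)" using fin by (simp add: finite_imp_compact_convex_hull compact_imp_closed)
  ultimately obtain c b where cb: "c \<bullet> 0 < b" "\<forall>x\<in>convex hull S. b < c \<bullet> x"
    using separating_hyperplane_closed_point[OF convex_convex_hull] by metis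
  have pos: "c \<bullet> d > 0" if "d \<in> S" for d using cb hull_inc[OF that, of convex] by fastforce
  show ?thesis
  proof (cases "S = {}")
    case True then show ?thesis by (intro exI[of _ 1]) auto
  next
    case False
    then have "c \<noteq> 0" using pos by fastforce
    then show ?thesis using pos by blast
  qed
qed

end

section \<open>Corners of the outer polygon\<close>

context tiling_pot
begin

abbreviation antipode :: "complex \<Rightarrow> complex" where
  "antipode \<equiv> point_reflection (center P)"

lemma antipode_P: "x \<in> P \<Longrightarrow> antipode x \<in> P"
  using center_reflection[OF P_polygon] by blast

lemma antipode_corner: "p \<in> corners P \<Longrightarrow> antipode p \<in> corners P"
  using reflection_corners center_reflection[OF P_polygon] by blast

definition hi :: "complex \<Rightarrow> int" where "hi d = Max (N d ` verts T)"
definition lo :: "complex \<Rightarrow> int" where "lo d = Min (N d ` verts T)"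

lemma lo_hi: "v \<in> verts T \<Longrightarrow> lo d \<le> N d v" "v \<in> verts T \<Longrightarrow> N d v \<le> hi d"
  using finite_verts by (simp_all add: lo_def hi_def)

lemma hi_eqI: "p \<in> verts T \<Longrightarrow> (\<And>v. v \<in> verts T \<Longrightarrow> N d v \<le> N d p) \<Longrightarrow> N d p = hi d"
  unfolding hi_def using finite_verts by (intro Max_eqI[symmetric]) auto

lemma lo_eqI: "p \<in> verts T \<Longrightarrow> (\<And>v. v \<in> verts T \<Longrightarrow> N d p \<le> N d v) \<Longrightarrow> N d p = lo d"
  unfolding lo_def using finite_verts by (intro Min_eqI[symmetric]) auto

text \<open>From every vertex there is an ascending path to the corner, for a functional that exposes it, and a
  descending one to the opposite corner.\<close>

lemma corner_extremal:
  assumes p: "p \<in> corners P" and d: "d \<noteq> 0"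
  shows "(N d p = hi d \<and> N d (antipode p) = lo d) \<or> (N d p = lo d \<and> N d (antipode p) = hi d)"
proof -
  obtain c where c: "\<forall>z\<in>P. z \<noteq> p \<longrightarrow> c \<bullet> z < c \<bullet> p" using corner_exposed[OF p] by blast
  have pv: "p \<in> verts T" "antipode p \<in> verts T" using p antipode_corner corners_P_verts by blast+
  have asc: "(up c)\<^sup>*\<^sup>* v p" if v: "v \<in> verts T" for v
  proof -
    obtain t where t: "(up c)\<^sup>*\<^sup>* v t" "is_top c t" using asc_top[OF v] by blast
    then have "t = p" using c pv verts_P unfolding is_top_def by (metis not_le)
    then show ?thesis using t by simp
  qed
  have c': "(- c) \<bullet> z < (- c) \<bullet> antipode p" if z: "z \<in> P" "z \<noteq> antipode p" for z
  proof -
    have "antipode z \<noteq> p" using z by (metis point_reflection_simps(1))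
    then have "c \<bullet> antipode z < c \<bullet> p" using c antipode_P z by blast
    moreover have "c \<bullet> (antipode z - antipode (antipode p)) = c \<bullet> (antipode p - z)"
      by (simp only: point_reflection_simps(2))
    ultimately show ?thesis by (simp add: inner_diff_right)
  qed
  have desc: "(up (- c))\<^sup>*\<^sup>* v (antipode p)" if v: "v \<in> verts T" for v
  proof -
    obtain t where t: "(up (- c))\<^sup>*\<^sup>* v t" "is_top (- c) t" using asc_top[OF v] by blast
    then have "t = antipode p" using c' pv verts_P unfolding is_top_def by (metis not_le)
    then show ?thesis using t by simp
  qed
  show ?thesis
  proof (cases "c \<bullet> d \<ge> 0")
    case True
    then have "N d p = hi d" using asc asc_mono[OF _ d True] pv by (intro hi_eqI) auto
    moreover have "N d (antipode p) = lo d"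
      using desc asc_antimono[OF _ d, of "- c"] True pv by (intro lo_eqI) auto
    ultimately show ?thesis by blast
  next
    case False
    then have F: "c \<bullet> d \<le> 0" by simp
    then have "N d p = lo d" using asc asc_antimono[OF _ d F] pv by (intro lo_eqI) auto
    moreover have "N d (antipode p) = hi d"
      using desc asc_mono[OF _ d, of "- c"] F pv by (intro hi_eqI) auto
    ultimately show ?thesis by blast
  qed
qed

text \<open>The corner is the top of a generic functional that is positive on all directions in which \<open>v\<close> is higher
  than \<open>w\<close>.\<close>

theorem corner_between:
  assumes vw: "v \<in> verts T" "w \<in> verts T"
  shows "\<exists>p\<in>corners P. \<forall>d\<in>U. \<bar>N d p - N d v\<bar> + \<bar>N d (antipode p) - N d w\<bar> = hi d - lo d - \<bar>N d v - N d w\<bar>"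
proof -
  define S where "S = {d \<in> U \<union> uminus ` U. N d w < N d v}"
  have fin: "finite S" using U_props(1) by (simp add: S_def)
  obtain k where k: "k \<noteq> 0" "\<forall>d\<in>S. k \<bullet> d > 0" using separating_halfplane[OF vw] S_def by blast
  obtain c p where c: "\<forall>d\<in>S. c \<bullet> d > 0" "c \<noteq> 0" "\<forall>x y. {x, y} \<in> edges T \<longrightarrow> c \<bullet> x \<noteq> c \<bullet> y"
    "\<forall>v\<in>verts T. (up c)\<^sup>*\<^sup>* v p" "is_top c p"
    using generic_top_positive[OF fin k(2,1)] by blast
  have "p \<in> corners P"
  proof -
    have hull: "P = convex hull (corners P)" using Krein_Milman_Minkowski[OF P_compact P_convex] by (simp add: corners_def)
    have "p \<in> P" using c verts_P by (auto simp: is_top_def)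
    have "\<exists>q\<in>corners P. c \<bullet> q \<ge> c \<bullet> p"
    proof (rule ccontr)
      assume "\<not> ?thesis"
      then have "corners P \<subseteq> {z. c \<bullet> z < c \<bullet> p}" by auto
      then have "convex hull (corners P) \<subseteq> {z. c \<bullet> z < c \<bullet> p}" by (intro hull_minimal convex_halfspace_lt)
      then show False using hull \<open>p \<in> P\<close> by blast
    qed
    then obtain q where q: "q \<in> corners P" "c \<bullet> q \<ge> c \<bullet> p" by blast
    then have "q \<in> verts T" using corners_P_verts by blast
    then have "is_top c q" using c(5) q(2) unfolding is_top_def by force
    then show ?thesis using top_unique[OF c(3,2,5)] q by blast
  qed
  moreover have "\<bar>N d p - N d v\<bar> + \<bar>N d (antipode p) - N d w\<bar> = hi d - lo d - \<bar>N d v - N d w\<bar>"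
    if d: "d \<in> U" for d
  proof -
    have d0: "d \<noteq> 0" using d U_props by auto
    have bnd: "lo d \<le> N d v" "N d v \<le> hi d" "lo d \<le> N d w" "N d w \<le> hi d" using lo_hi vw by auto
    have ext: "(N d p = hi d \<and> N d (antipode p) = lo d) \<or> (N d p = lo d \<and> N d (antipode p) = hi d)"
      by (rule corner_extremal[OF \<open>p \<in> corners P\<close> d0])
    consider "N d v > N d w" | "N d v < N d w" | "N d v = N d w" by linarith
    then show ?thesis
    proof cases
      case 1
      then have "c \<bullet> d \<ge> 0" using c(1) d by (auto simp: S_def intro: less_imp_le)
      then have "N d v \<le> N d p" using asc_mono[OF _ d0] c vw by blast
      then show ?thesis using ext bnd 1 by linarith
    next
      case 2
      then have "- d \<in> S" using d by (auto simp: S_def pot_uminus)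
      then have "c \<bullet> d \<le> 0" using c(1) by fastforce
      then have "N d p \<le> N d v" using asc_antimono[OF _ d0] c vw by blast
      then show ?thesis using ext bnd 2 by linarith
    next
      case 3
      then show ?thesis using ext bnd by linarith
    qed
  qed
  ultimately show ?thesis by blast
qed

end

section \<open>Partial cubes from binary labels\<close>

definition adj :: "'v ugraph \<Rightarrow> ('v \<times> 'v) set" where
  "adj G = {(x, y). {x, y} \<in> edges G}"

lemma adj_pow_sym: "(x, y) \<in> adj G ^^ n \<Longrightarrow> (y, x) \<in> adj G ^^ n"
proof (induction n arbitrary: y)
  case (Suc n)
  then obtain z where "(x, z) \<in> adj G ^^ n" "(z, y) \<in> adj G" by auto
  moreover have "(y, z) \<in> adj G" using \<open>(z, y) \<in> adj G\<close> by (simp add: adj_def insert_commute)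
  ultimately show ?case using Suc.IH by (meson relpow_Suc_I2)
qed auto

lemma relpow_map:
  assumes "\<And>x y. (x, y) \<in> A \<Longrightarrow> (f x, f y) \<in> B" and "(x, y) \<in> A ^^ n"
  shows "(f x, f y) \<in> B ^^ n"
  using assms(2)
proof (induction n arbitrary: y)
  case (Suc n)
  then obtain z where "(x, z) \<in> A ^^ n" "(z, y) \<in> A" by auto
  then show ?case using Suc.IH assms(1) by (meson relpow_Suc_I)
qed auto

lemma walk_adj_pow:
  assumes "walk_betw G u xs v" shows "(u, v) \<in> adj G ^^ (length xs - 1)"
proof -
  have "xs \<noteq> [] \<Longrightarrow> successively (\<lambda>x y. {x, y} \<in> edges G) xs \<Longrightarrow> (hd xs, last xs) \<in> adj G ^^ (length xs - 1)"
    for xs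
  proof (induction xs rule: induct_list012)
    case (3 x y zs)
    then have "(x, y) \<in> adj G" "(y, last (y # zs)) \<in> adj G ^^ length zs" by (auto simp: adj_def)
    then have "(x, last (y # zs)) \<in> adj G ^^ Suc (length zs)" by (rule relpow_Suc_I2)
    then show ?case by simp
  qed auto
  then show ?thesis using assms by (auto simp: walk_betw_def)
qed

lemma adj_pow_walk:
  assumes G: "simple_graph G" and u: "u \<in> verts G" and uv: "(u, v) \<in> adj G ^^ n"
  shows "\<exists>xs. walk_betw G u xs v \<and> length xs = Suc n"
  using uv u
proof (induction n arbitrary: u)
  case 0
  then show ?case by (intro exI[of _ "[u]"]) (auto simp: walk_betw_def)
next
  case (Suc n)
  then obtain y where y: "(u, y) \<in> adj G" "(y, v) \<in> adj G ^^ n" by (meson relpow_Suc_D2)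
  then have e: "{u, y} \<in> edges G" by (simp add: adj_def)
  then have "y \<in> verts G" using G unfolding simple_graph_def by (metis doubleton_eq_iff)
  then obtain xs where xs: "walk_betw G y xs v" "length xs = Suc n" using Suc.IH y by blast
  then show ?case using Suc.prems e
    by (intro exI[of _ "u # xs"]) (auto simp: walk_betw_def successively_Cons)
qed

lemma graph_dist_eqI:
  assumes G: "simple_graph G" "u \<in> verts G" and uv: "(u, v) \<in> adj G ^^ n"
    and le: "\<And>m. (u, v) \<in> adj G ^^ m \<Longrightarrow> n \<le> m"
  shows "graph_dist G u v = enat n"
proof (rule antisym)
  obtain xs where "walk_betw G u xs v" "length xs = Suc n" using adj_pow_walk[OF G uv] by blast
  then have "graph_dist G u v \<le> enat (length xs - 1)" unfolding graph_dist_def by (intro INF_lower) simp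
  then show "graph_dist G u v \<le> enat n" using \<open>length xs = Suc n\<close> by simp
  show "enat n \<le> graph_dist G u v" unfolding graph_dist_def
    using walk_adj_pow le by (intro INF_greatest) fastforce
qed

definition differing :: "'i set \<Rightarrow> ('v \<Rightarrow> 'i \<Rightarrow> bool) \<Rightarrow> 'v \<Rightarrow> 'v \<Rightarrow> 'i set" where
  "differing I \<phi> u v = {i \<in> I. \<phi> u i \<noteq> \<phi> v i}"

lemma hamming_dist_map:
  assumes "distinct is" "set is = I"
  shows "hamming_dist (map (\<phi> u) is) (map (\<phi> v) is) = card (differing I \<phi> u v)"
proof -
  have "differing I \<phi> u v = (\<lambda>k. is ! k) ` {k. k < length is \<and> \<phi> u (is ! k) \<noteq> \<phi> v (is ! k)}"
    using assms(2) by (auto simp: differing_def in_set_conv_nth)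
  moreover have "inj_on (\<lambda>k. is ! k) {k. k < length is \<and> \<phi> u (is ! k) \<noteq> \<phi> v (is ! k)}"
    using assms(1) by (auto simp: inj_on_def nth_eq_iff_index_eq)
  ultimately have "card (differing I \<phi> u v) = card {k. k < length is \<and> \<phi> u (is ! k) \<noteq> \<phi> v (is ! k)}"
    by (simp add: card_image)
  moreover have "{k. k < length is \<and> \<phi> u (is ! k) \<noteq> \<phi> v (is ! k)}
    = {k. k < length (map (\<phi> u) is) \<and> map (\<phi> u) is ! k \<noteq> map (\<phi> v) is ! k}"
    by auto
  ultimately show ?thesis unfolding hamming_dist_def by simp
qed

text \<open>The label distance is a lower bound for the path length if an edge changes at most one bit.\<close>

theorem partial_cube_criterion:
  assumes G: "simple_graph G" and I: "finite I"
    and edge: "\<And>x y. {x, y} \<in> edges G \<Longrightarrow> card (differing I \<phi> x y) \<le> 1"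
    and path: "\<And>u v. u \<in> verts G \<Longrightarrow> v \<in> verts G \<Longrightarrow> (u, v) \<in> adj G ^^ card (differing I \<phi> u v)"
  shows "partial_cube G"
proof -
  obtain "is" where is': "set is = I" "distinct is" using finite_distinct_list[OF I] by blast
  have fin: "finite (differing I \<phi> u v)" for u v using I by (simp add: differing_def)
  have le: "card (differing I \<phi> u v) \<le> m" if "(u, v) \<in> adj G ^^ m" for u v m
    using that
  proof (induction m arbitrary: u)
    case 0
    then show ?case by (simp add: differing_def)
  next
    case (Suc m)
    then obtain y where y: "(u, y) \<in> adj G" "(y, v) \<in> adj G ^^ m" by (meson relpow_Suc_D2)
    have "differing I \<phi> u v \<subseteq> differing I \<phi> u y \<union> differing I \<phi> y v" by (auto simp: differing_def)
    then have "card (differing I \<phi> u v) \<le> card (differing I \<phi> u y \<union> differing I \<phi> y v)"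
      using fin by (intro card_mono) auto
    also have "\<dots> \<le> card (differing I \<phi> u y) + card (differing I \<phi> y v)" by (rule card_Un_le)
    also have "\<dots> \<le> 1 + m" using edge[of u y] Suc.IH[OF y(2)] y(1) by (intro add_mono) (auto simp: adj_def)
    finally show ?case by simp
  qed
  have "graph_dist G u v = enat (hamming_dist (map (\<phi> u) is) (map (\<phi> v) is))"
    if "u \<in> verts G" "v \<in> verts G" for u v
    unfolding hamming_dist_map[OF is'(2,1)] using graph_dist_eqI[OF G that(1) path[OF that] le] .
  then show ?thesis unfolding partial_cube_def using G
    by (intro conjI exI[of _ "length is"] exI[of _ "\<lambda>v. map (\<phi> v) is"]) auto
qed

section \<open>Labels for the glued graph\<close>

lemma card_threshold_differ:
  fixes a b l h :: int
  assumes "l \<le> a" "a \<le> h" "l \<le> b" "b \<le> h"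
  shows "card {t. l < t \<and> t \<le> h \<and> (t \<le> a) \<noteq> (t \<le> b)} = nat \<bar>a - b\<bar>"
proof -
  have "{t. l < t \<and> t \<le> h \<and> (t \<le> a) \<noteq> (t \<le> b)} = {min a b<..max a b}" using assms by auto
  then show ?thesis by (simp add: max_def min_def)
qed

lemma card_threshold_agree:
  fixes a b l h :: int
  assumes "l \<le> a" "a \<le> h" "l \<le> b" "b \<le> h"
  shows "card {t. l < t \<and> t \<le> h \<and> (t \<le> a) = (t \<le> b)} = nat (h - l - \<bar>a - b\<bar>)"
proof -
  have "{t. l < t \<and> t \<le> h \<and> (t \<le> a) = (t \<le> b)} = {l<..h} - {min a b<..max a b}" using assms by auto
  moreover have "card ({l<..h} - {min a b<..max a b}) = nat (h - l) - nat (max a b - min a b)"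
    using assms by (subst card_Diff_subset) auto
  ultimately show ?thesis using assms by (simp add: max_def min_def nat_diff_distrib)
qed

lemma potential_subgraph: "potential T U N \<Longrightarrow> edges S \<subseteq> edges T \<Longrightarrow> potential S U N"
  unfolding potential_def by blast

text \<open>One height function serves the two tilings and their overlay. The overlay is where vertices of
  the two tilings are compared.\<close>

locale glued =
  A: tiling_pot P T U N + B: tiling_pot P T' U N + C: tiling_pot P "overlay T T'" U N
  for P :: "complex set" and T T' :: "complex ugraph" and U N
begin

definition G :: "(complex + complex) ugraph" where
  "G = join_at_corners P T (central_reflection P T')"

lemma verts_G: "verts G = Inl ` verts T \<union> Inr ` C.antipode ` verts T'"
  by (auto simp: G_def join_at_corners_def central_reflection_def)

lemma edges_G: "edges G = (\<lambda>e. Inl ` e) ` edges T \<union> (\<lambda>e. Inr ` C.antipode ` e) ` edges T' \<union>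
    {{Inl p, Inr p} | p. p \<in> corners P}"
  by (auto simp: G_def join_at_corners_def central_reflection_def image_image)

lemma edge_cases:
  assumes "e \<in> edges G"
  obtains a b where "e = {Inl a, Inl b}" "{a, b} \<in> edges T"
  | a b where "e = {Inr (C.antipode a), Inr (C.antipode b)}" "{a, b} \<in> edges T'"
  | p where "e = {Inl p, Inr p}" "p \<in> corners P"
  using assms unfolding edges_G
proof (elim UnE)
  assume "e \<in> (\<lambda>e. Inl ` e) ` edges T"
  then obtain e' where e': "e' \<in> edges T" "e = Inl ` e'" by blast
  obtain a b where "e' = {a, b}" "{a, b} \<in> edges T" by (rule A.edgeE[OF e'(1)])
  then show ?thesis using that(1)[of a b] e' by simp
next
  assume "e \<in> (\<lambda>e. Inr ` C.antipode ` e) ` edges T'"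
  then obtain e' where e': "e' \<in> edges T'" "e = Inr ` C.antipode ` e'" by blast
  obtain a b where "e' = {a, b}" "{a, b} \<in> edges T'" by (rule B.edgeE[OF e'(1)])
  then show ?thesis using that(2)[of a b] e' by simp
next
  assume "e \<in> {{Inl p, Inr p} | p. p \<in> corners P}"
  then show ?thesis using that(3) by blast
qed

lemma simple_G: "simple_graph G"
  unfolding simple_graph_def
proof
  fix e assume "e \<in> edges G"
  then show "\<exists>u\<in>verts G. \<exists>v\<in>verts G. u \<noteq> v \<and> e = {u, v}"
  proof (cases rule: edge_cases)
    case (1 a b)
    then show ?thesis using A.edge_verts[OF 1(2)]
      by (intro bexI[of _ "Inl a"] bexI[of _ "Inl b"]) (auto simp: verts_G)
  next
    case (2 a b)
    have "C.antipode a \<noteq> C.antipode b"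
      using B.edge_verts(3)[OF 2(2)] inj_point_reflection[THEN injD] by blast
    then show ?thesis using 2(1) B.edge_verts(1,2)[OF 2(2)]
      by (intro bexI[of _ "Inr (C.antipode a)"] bexI[of _ "Inr (C.antipode b)"]) (auto simp: verts_G)
  next
    case (3 p)
    have "p \<in> verts T" using 3 A.corners_P_verts by blast
    moreover have "C.antipode p \<in> verts T'" using 3 C.antipode_corner B.corners_P_verts by blast
    then have "p \<in> C.antipode ` verts T'" by (metis imageI point_reflection_simps(1))
    ultimately show ?thesis using 3(1)
      by (intro bexI[of _ "Inl p"] bexI[of _ "Inr p"]) (auto simp: verts_G)
  qed
qed

text \<open>One index for each threshold of each height function; the bit \<open>None\<close> tells the two tilings apart.\<close>

definition I :: "(complex \<times> int) option set" where
  "I = insert None (Some ` (SIGMA d:U. {C.lo d<..C.hi d}))"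

text \<open>The bits on the reflected side are complemented: a zone of \<open>T\<close> continues through a side of the outer polygon into the
  reflection of the same zone of \<open>T'\<close>, which reverses its orientation.\<close>

definition \<phi> :: "complex + complex \<Rightarrow> (complex \<times> int) option \<Rightarrow> bool" where
  "\<phi> x i = (case x of
     Inl v \<Rightarrow> (case i of None \<Rightarrow> True | Some (d, t) \<Rightarrow> t \<le> N d v)
   | Inr v \<Rightarrow> (case i of None \<Rightarrow> False | Some (d, t) \<Rightarrow> \<not> t \<le> N d (C.antipode v)))"

lemma finite_I: "finite I"
  using C.U_props(1) by (simp add: I_def)

lemma bounds:
  "v \<in> verts T \<union> verts T' \<Longrightarrow> C.lo d \<le> N d v" "v \<in> verts T \<union> verts T' \<Longrightarrow> N d v \<le> C.hi d"
  using C.lo_hi by (auto simp: overlay_def)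

lemma card_slices:
  assumes "\<And>d. d \<in> U \<Longrightarrow> finite (S d)"
  shows "card (Some ` (SIGMA d:U. S d)) = (\<Sum>d\<in>U. card (S d))"
  using C.U_props(1) assms by (simp add: card_image)

lemma fin_slice: "finite {t::int. l < t \<and> t \<le> h \<and> R t}"
  by (rule finite_subset[of _ "{l<..h}"]) auto

lemma differing_same:
  assumes v: "v \<in> verts T \<union> verts T'" "w \<in> verts T \<union> verts T'"
  shows "card (Some ` (SIGMA d:U. {t. C.lo d < t \<and> t \<le> C.hi d \<and> (t \<le> N d v) \<noteq> (t \<le> N d w)})) = C.D v w"
proof -
  have "card {t. C.lo d < t \<and> t \<le> C.hi d \<and> (t \<le> N d v) \<noteq> (t \<le> N d w)} = nat \<bar>N d w - N d v\<bar>" for d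
    using card_threshold_differ[of "C.lo d" "N d v" "C.hi d" "N d w"] bounds v by (simp add: abs_minus_commute)
  then show ?thesis by (subst card_slices) (simp_all add: fin_slice C.D_def)
qed

lemma differing_Inl:
  assumes v: "v \<in> verts T" "w \<in> verts T"
  shows "card (differing I \<phi> (Inl v) (Inl w)) = C.D v w"
proof -
  have "differing I \<phi> (Inl v) (Inl w)
    = Some ` (SIGMA d:U. {t. C.lo d < t \<and> t \<le> C.hi d \<and> (t \<le> N d v) \<noteq> (t \<le> N d w)})"
    by (auto simp: differing_def I_def \<phi>_def)
  then show ?thesis using differing_same v by simp
qed

lemma differing_Inr:
  assumes v: "v \<in> verts T'" "w \<in> verts T'"
  shows "card (differing I \<phi> (Inr (C.antipode v)) (Inr (C.antipode w))) = C.D v w"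
proof -
  have "differing I \<phi> (Inr (C.antipode v)) (Inr (C.antipode w))
    = Some ` (SIGMA d:U. {t. C.lo d < t \<and> t \<le> C.hi d \<and> (t \<le> N d v) \<noteq> (t \<le> N d w)})"
    by (auto simp: differing_def I_def \<phi>_def)
  then show ?thesis using differing_same v by simp
qed

lemma differing_mixed:
  assumes v: "v \<in> verts T" "w \<in> verts T'"
  shows "card (differing I \<phi> (Inl v) (Inr (C.antipode w))) =
    1 + (\<Sum>d\<in>U. nat (C.hi d - C.lo d - \<bar>N d v - N d w\<bar>))"
proof -
  let ?S = "Some ` (SIGMA d:U. {t. C.lo d < t \<and> t \<le> C.hi d \<and> (t \<le> N d v) = (t \<le> N d w)})"
  have "differing I \<phi> (Inl v) (Inr (C.antipode w)) = insert None ?S"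
    by (auto simp: differing_def I_def \<phi>_def)
  moreover have "finite ?S" using C.U_props(1) by (simp add: fin_slice)
  moreover have "card {t. C.lo d < t \<and> t \<le> C.hi d \<and> (t \<le> N d v) = (t \<le> N d w)} =
    nat (C.hi d - C.lo d - \<bar>N d v - N d w\<bar>)" for d
    using card_threshold_agree[of "C.lo d" "N d v" "C.hi d" "N d w"] bounds v by simp
  then have "card ?S = (\<Sum>d\<in>U. nat (C.hi d - C.lo d - \<bar>N d v - N d w\<bar>))"
    by (subst card_slices) (simp_all add: fin_slice)
  ultimately show ?thesis by auto
qed

lemma differing_commute: "differing I \<phi> x y = differing I \<phi> y x"
  by (auto simp: differing_def)

lemma edge_differing:
  assumes "{x, y} \<in> edges G"
  shows "card (differing I \<phi> x y) \<le> 1"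
proof -
  have main: "card (differing I \<phi> a b) \<le> 1 \<Longrightarrow> {x, y} = {a, b} \<Longrightarrow> ?thesis" for a b
    using differing_commute by (metis doubleton_eq_iff)
  from assms show ?thesis
  proof (cases rule: edge_cases)
    case (1 a b)
    have "C.D a b \<le> 1" using A.D_le[of a b 1] 1 by (simp add: A.E_def)
    then show ?thesis using main[OF _ 1(1)] differing_Inl A.edge_verts[OF 1(2)] by simp
  next
    case (2 a b)
    have "C.D a b \<le> 1" using B.D_le[of a b 1] 2 by (simp add: B.E_def)
    then show ?thesis using main[OF _ 2(1)] differing_Inr B.edge_verts[OF 2(2)] by simp
  next
    case (3 p)
    have p: "p \<in> verts T" "C.antipode p \<in> verts T'" using 3 C.antipode_corner A.corners_P_verts B.corners_P_verts by auto
    have "nat (C.hi d - C.lo d - \<bar>N d p - N d (C.antipode p)\<bar>) = 0" if "d \<in> U" for d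
    proof -
      have "d \<noteq> 0" using that C.U_props(2) by auto
      moreover have "C.lo d \<le> N d p" "N d p \<le> C.hi d" using bounds p by auto
      ultimately show ?thesis using C.corner_extremal[OF 3(2), of d] by linarith
    qed
    then have "card (differing I \<phi> (Inl p) (Inr (C.antipode (C.antipode p)))) = 1"
      using differing_mixed[OF p] by simp
    then show ?thesis using main[OF _ 3(1)] by simp
  qed
qed

lemma adj_Inl: "(x, y) \<in> A.E \<Longrightarrow> (Inl x, Inl y) \<in> adj G"
proof -
  assume "(x, y) \<in> A.E"
  then have "Inl ` {x, y} \<in> edges G" unfolding edges_G A.E_def by blast
  then show ?thesis by (simp add: adj_def)
qed

lemma adj_Inr: "(x, y) \<in> B.E \<Longrightarrow> (Inr (C.antipode x), Inr (C.antipode y)) \<in> adj G"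
proof -
  assume "(x, y) \<in> B.E"
  then have "Inr ` C.antipode ` {x, y} \<in> edges G" unfolding edges_G B.E_def by blast
  then show ?thesis by (simp add: adj_def)
qed

lemma path_Inl: "v \<in> verts T \<Longrightarrow> w \<in> verts T \<Longrightarrow> (Inl v, Inl w) \<in> adj G ^^ C.D v w"
  by (rule relpow_map[OF adj_Inl A.geodesic])

lemma path_Inr: "v \<in> verts T' \<Longrightarrow> w \<in> verts T' \<Longrightarrow>
    (Inr (C.antipode v), Inr (C.antipode w)) \<in> adj G ^^ C.D v w"
  by (rule relpow_map[where f = "\<lambda>v. Inr (C.antipode v)", OF adj_Inr B.geodesic])

text \<open>The path goes through the corner between the two vertices. Its two parts have the right total length because,
  in each direction, the corner and its antipode have the extreme heights.\<close>

lemma path_mixed: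
  assumes v: "v \<in> verts T" "w \<in> verts T'"
  shows "(Inl v, Inr (C.antipode w)) \<in> adj G ^^ card (differing I \<phi> (Inl v) (Inr (C.antipode w)))"
proof -
  have "v \<in> verts (overlay T T')" "w \<in> verts (overlay T T')" using v by (auto simp: overlay_def)
  then obtain p where p: "p \<in> corners P"
    "\<forall>d\<in>U. \<bar>N d p - N d v\<bar> + \<bar>N d (C.antipode p) - N d w\<bar> = C.hi d - C.lo d - \<bar>N d v - N d w\<bar>"
    using C.corner_between by blast
  have pv: "p \<in> verts T" "C.antipode p \<in> verts T'"
    using p C.antipode_corner A.corners_P_verts B.corners_P_verts by auto
  have "C.D v p + C.D (C.antipode p) w = (\<Sum>d\<in>U. nat \<bar>N d p - N d v\<bar> + nat \<bar>N d w - N d (C.antipode p)\<bar>)"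
    by (simp add: C.D_def sum.distrib)
  also have "\<dots> = (\<Sum>d\<in>U. nat (C.hi d - C.lo d - \<bar>N d v - N d w\<bar>))"
  proof (rule sum.cong)
    fix d assume "d \<in> U"
    from bspec[OF p(2) this]
    show "nat \<bar>N d p - N d v\<bar> + nat \<bar>N d w - N d (C.antipode p)\<bar> = nat (C.hi d - C.lo d - \<bar>N d v - N d w\<bar>)"
      by linarith
  qed simp
  finally have len: "card (differing I \<phi> (Inl v) (Inr (C.antipode w))) = C.D v p + (1 + C.D (C.antipode p) w)"
    using differing_mixed[OF v] by simp
  have "(Inl p, Inr p) \<in> adj G" using p by (auto simp: adj_def edges_G)
  then have "(Inl p, Inr p) \<in> adj G ^^ 1" by simp
  moreover have "(Inr p, Inr (C.antipode w)) \<in> adj G ^^ C.D (C.antipode p) w"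
    using path_Inr[OF pv(2) v(2)] by simp
  ultimately have "(Inl p, Inr (C.antipode w)) \<in> adj G ^^ (1 + C.D (C.antipode p) w)"
    by (subst relpow_add) blast
  then show ?thesis unfolding len using path_Inl[OF v(1) pv(1)] by (subst relpow_add) blast
qed

theorem partial_cube_G: "partial_cube G"
proof (rule partial_cube_criterion[OF simple_G finite_I edge_differing])
  fix x y assume "x \<in> verts G" "y \<in> verts G"
  then consider v w where "x = Inl v" "y = Inl w" "v \<in> verts T" "w \<in> verts T"
    | v w where "x = Inl v" "y = Inr (C.antipode w)" "v \<in> verts T" "w \<in> verts T'"
    | v w where "y = Inl v" "x = Inr (C.antipode w)" "v \<in> verts T" "w \<in> verts T'"
    | v w where "x = Inr (C.antipode v)" "y = Inr (C.antipode w)" "v \<in> verts T'" "w \<in> verts T'"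
    unfolding verts_G by blast
  then show "(x, y) \<in> adj G ^^ card (differing I \<phi> x y)"
  proof cases
    case 1 then show ?thesis using path_Inl differing_Inl by simp
  next
    case 2 then show ?thesis using path_mixed by simp
  next
    case 3
    then show ?thesis using adj_pow_sym[OF path_mixed[OF 3(3,4)]] differing_commute by metis
  next
    case 4 then show ?thesis using path_Inr differing_Inr by simp
  qed
qed

end

section \<open>Cells of a simplicial arrangement\<close>

text \<open>The extension of the projection from the sphere to all nonzero vectors, which form an open set.\<close>

definition proj :: "real^3 \<Rightarrow> real^3^3" where
  "proj y = proj_point (y /\<^sub>R norm y)"

lemma continuous_proj_point: "continuous_on S proj_point"
  unfolding proj_point_def by (intro continuous_on_vec_lambda continuous_intros)

lemma continuous_proj: "continuous_on (- {0}) proj"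
proof -
  have "continuous_on (- {0}) (\<lambda>y::real^3. y /\<^sub>R norm y)" by (intro continuous_intros) auto
  then have "continuous_on (- {0}) (proj_point \<circ> (\<lambda>y. y /\<^sub>R norm y))"
    by (rule continuous_on_compose[OF _ continuous_proj_point])
  then show ?thesis by (simp add: proj_def[abs_def] o_def)
qed

lemma compact_proj_plane: "compact proj_plane"
  unfolding proj_plane_def by (intro compact_continuous_image continuous_proj_point compact_sphere)

lemma closed_proj_plane: "closed proj_plane"
  by (rule compact_imp_closed[OF compact_proj_plane])

lemma compact_proj_line: "compact (proj_line a)"
proof -
  have "compact (sphere 0 1 \<inter> {x::real^3. a \<bullet> x = 0})"
    by (intro compact_Int_closed compact_sphere closed_hyperplane)
  moreover have "{x \<in> sphere 0 1. a \<bullet> x = 0} = sphere 0 1 \<inter> {x. a \<bullet> x = 0}" by auto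
  ultimately show ?thesis unfolding proj_line_def
    by (intro compact_continuous_image continuous_proj_point) simp
qed

lemma proj_line_subset: "proj_line a \<subseteq> proj_plane"
  by (auto simp: proj_line_def proj_plane_def)

lemma proj_in_line: "y \<noteq> 0 \<Longrightarrow> proj y \<in> proj_line a \<longleftrightarrow> a \<bullet> y = 0"
proof
  assume y: "y \<noteq> 0" and "proj y \<in> proj_line a"
  then obtain z where z: "z \<in> sphere 0 1" "a \<bullet> z = 0" "proj_point (y /\<^sub>R norm y) = proj_point z"
    by (auto simp: proj_def proj_line_def)
  have "y /\<^sub>R norm y \<in> sphere 0 1" using y by simp
  then have "y /\<^sub>R norm y = z \<or> y /\<^sub>R norm y = - z" using proj_point_eq_iff z by blast
  then have "a \<bullet> (y /\<^sub>R norm y) = a \<bullet> z \<or> a \<bullet> (y /\<^sub>R norm y) = a \<bullet> (- z)" by metis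
  then have "a \<bullet> (y /\<^sub>R norm y) = 0" using z(2) by auto
  then show "a \<bullet> y = 0" using y by simp
next
  assume y: "y \<noteq> 0" "a \<bullet> y = 0"
  then have "y /\<^sub>R norm y \<in> {x \<in> sphere 0 1. a \<bullet> x = 0}" by simp
  then show "proj y \<in> proj_line a" unfolding proj_def proj_line_def by blast
qed

text \<open>The complement is the continuous image of a compact part of the sphere, because the set of
  lines meeting the ball is open and symmetric.\<close>

lemma openin_proj_ball:
  assumes "0 \<notin> ball x \<epsilon>"
  shows "openin (top_of_set proj_plane) (proj ` ball x \<epsilon>)"
proof -
  define W where "W = (\<Union>t\<in>- {0}. (\<lambda>y. t *\<^sub>R y) ` ball x \<epsilon>)"
  have openW: "open W" unfolding W_def by (intro open_UN ballI open_scaling) auto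
  have symW: "- z \<in> W" if "z \<in> W" for z
  proof -
    obtain t y where "t \<noteq> 0" "y \<in> ball x \<epsilon>" "z = t *\<^sub>R y" using \<open>z \<in> W\<close> unfolding W_def by blast
    then have "- z = (- t) *\<^sub>R y" "- t \<in> - {0}" by auto
    then show ?thesis using \<open>y \<in> ball x \<epsilon>\<close> unfolding W_def by blast
  qed
  have img: "proj ` ball x \<epsilon> = proj_point ` (sphere 0 1 \<inter> W)"
  proof (intro equalityI subsetI)
    fix q assume "q \<in> proj ` ball x \<epsilon>"
    then obtain y where y: "y \<in> ball x \<epsilon>" "q = proj y" by blast
    then have "y \<noteq> 0" using assms by auto
    then have "y /\<^sub>R norm y \<in> sphere 0 1 \<inter> W"
      using y(1) unfolding W_def by (auto intro!: bexI[of _ "inverse (norm y)"])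
    then show "q \<in> proj_point ` (sphere 0 1 \<inter> W)" using y(2) unfolding proj_def by blast
  next
    fix q assume "q \<in> proj_point ` (sphere 0 1 \<inter> W)"
    then obtain z where z: "z \<in> sphere 0 1" "z \<in> W" "q = proj_point z" by blast
    then obtain t y where t: "t \<noteq> 0" "y \<in> ball x \<epsilon>" "z = t *\<^sub>R y" unfolding W_def by blast
    have "\<bar>t\<bar> * norm y = 1" using z t by simp
    moreover from this have "y \<noteq> 0" by auto
    ultimately have "inverse (norm y) = \<bar>t\<bar>" by (metis inverse_unique mult.commute)
    then have "y /\<^sub>R norm y = \<bar>t\<bar> *\<^sub>R y" by simp
    then have "y /\<^sub>R norm y = z \<or> y /\<^sub>R norm y = - z" using t by (cases "t > 0") auto
    moreover have "y /\<^sub>R norm y \<in> sphere 0 1" using \<open>y \<noteq> 0\<close> by simp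
    ultimately have "proj y = q" using proj_point_eq_iff z unfolding proj_def by blast
    then show "q \<in> proj ` ball x \<epsilon>" using t by blast
  qed
  have "proj_plane - proj_point ` (sphere 0 1 \<inter> W) = proj_point ` (sphere 0 1 - W)"
  proof (intro equalityI subsetI)
    fix q assume "q \<in> proj_point ` (sphere 0 1 - W)"
    then obtain z where z: "z \<in> sphere 0 1" "z \<notin> W" "q = proj_point z" by blast
    have "q \<notin> proj_point ` (sphere 0 1 \<inter> W)"
    proof
      assume "q \<in> proj_point ` (sphere 0 1 \<inter> W)"
      then obtain z' where z': "z' \<in> sphere 0 1" "z' \<in> W" "q = proj_point z'" by blast
      then have "z = z' \<or> z = - z'" using z proj_point_eq_iff by metis
      then show False using symW z z' by auto
    qed
    then show "q \<in> proj_plane - proj_point ` (sphere 0 1 \<inter> W)" using z by (auto simp: proj_plane_def)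
  qed (auto simp: proj_plane_def)
  moreover have "compact (proj_point ` (sphere 0 1 - W))"
    by (intro compact_continuous_image continuous_proj_point compact_diff compact_sphere openW)
  ultimately have "closed (proj_plane - proj ` ball x \<epsilon>)" using img compact_imp_closed by metis
  moreover have "proj ` ball x \<epsilon> \<subseteq> proj_plane" using img by (auto simp: proj_plane_def)
  then have "proj ` ball x \<epsilon> = proj_plane \<inter> - (proj_plane - proj ` ball x \<epsilon>)" by blast
  ultimately show ?thesis by (metis open_Compl openin_open)
qed

text \<open>Local two-sidedness: a neighbourhood is cut into two connected parts, both of which reach every point
  of the line in it.\<close>

definition two_sided_at :: "(real^3^3) set \<Rightarrow> real^3^3 \<Rightarrow> (real^3^3) set \<Rightarrow> bool" where
  "two_sided_at L p W \<longleftrightarrow> (\<exists>V V1 V2. openin (top_of_set proj_plane) V \<and> p \<in> V \<and> V \<subseteq> W \<and>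
    connected V1 \<and> connected V2 \<and> V - L = V1 \<union> V2 \<and>
    (\<forall>q\<in>V \<inter> L. q \<in> closure V1 \<and> q \<in> closure V2))"

text \<open>A line through the origin that is close to the given one is represented by a vector in a small
  ball, and a plane through the centre cuts the ball into two convex halves.\<close>

lemma proj_line_two_sided:
  assumes a: "a \<noteq> 0" and p: "p \<in> proj_line a" and W: "openin (top_of_set proj_plane) W" "p \<in> W"
  shows "two_sided_at (proj_line a) p W"
proof -
  obtain x where x: "norm x = 1" "a \<bullet> x = 0" "p = proj_point x" using p by (auto simp: proj_line_def)
  have px: "p = proj x" using x by (simp add: proj_def)
  obtain W' where W': "open W'" "W = proj_plane \<inter> W'" using W openin_open by metis
  have "open (- {0} \<inter> proj -` W')" by (rule continuous_open_preimage[OF continuous_proj _ W'(1)]) auto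
  moreover have "x \<in> - {0} \<inter> proj -` W'" using x W W' px by auto
  ultimately obtain \<epsilon> where e: "\<epsilon> > 0" "ball x \<epsilon> \<subseteq> - {0} \<inter> proj -` W'"
    by (meson open_contains_ball)
  have n0: "0 \<notin> ball x \<epsilon>" using e by auto
  have proj_plane: "proj y \<in> proj_plane" if "y \<noteq> 0" for y
    using that by (auto simp: proj_def proj_plane_def)
  define B where "B s = proj ` (ball x \<epsilon> \<inter> {y. (s *\<^sub>R a) \<bullet> y > 0})" for s :: real
  have conn: "connected (B s)" for s unfolding B_def
  proof (rule connected_continuous_image)
    show "continuous_on (ball x \<epsilon> \<inter> {y. s *\<^sub>R a \<bullet> y > 0}) proj"
      by (rule continuous_on_subset[OF continuous_proj]) (use n0 in auto)
    show "connected (ball x \<epsilon> \<inter> {y. s *\<^sub>R a \<bullet> y > 0})"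
      by (intro convex_connected convex_Int convex_ball convex_halfspace_gt)
  qed
  have clos: "q \<in> closure (B s)" if q: "q \<in> proj ` ball x \<epsilon> \<inter> proj_line a" and s: "s \<noteq> 0" for q s
  proof -
    obtain y where y: "y \<in> ball x \<epsilon>" "q = proj y" using q by blast
    have y0: "y \<noteq> 0" using y n0 by auto
    have "proj y \<in> proj_line a" using q y(2) by simp
    then have ay: "a \<bullet> y = 0" using proj_in_line[OF y0] by simp
    have "((\<lambda>r. y + r *\<^sub>R (s *\<^sub>R a)) \<longlongrightarrow> y + 0 *\<^sub>R (s *\<^sub>R a)) (at_right 0)" by (intro tendsto_intros)
    then have lim: "((\<lambda>r. y + r *\<^sub>R (s *\<^sub>R a)) \<longlongrightarrow> y) (at_right 0)"
      unfolding scaleR_zero_left add_0_right .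
    have "isCont proj y" using continuous_proj y0 by (simp add: continuous_on_eq_continuous_at open_Compl)
    then have lim2: "((\<lambda>r. proj (y + r *\<^sub>R (s *\<^sub>R a))) \<longlongrightarrow> q) (at_right 0)"
      unfolding y(2) using lim by (rule isCont_tendsto_compose)
    have "\<forall>\<^sub>F r in at_right 0. y + r *\<^sub>R (s *\<^sub>R a) \<in> ball x \<epsilon>"
      by (rule topological_tendstoD[OF lim open_ball y(1)])
    moreover have "\<forall>\<^sub>F r in at_right (0::real). r > 0" by (rule eventually_at_right_less)
    ultimately have "\<forall>\<^sub>F r in at_right 0. proj (y + r *\<^sub>R (s *\<^sub>R a)) \<in> B s"
    proof eventually_elim
      case (elim r)
      have "(s *\<^sub>R a) \<bullet> (y + r *\<^sub>R (s *\<^sub>R a)) = r * (s * s) * (a \<bullet> a)"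
        using ay by (simp add: inner_right_distrib algebra_simps)
      also have "\<dots> > 0" using elim s a by (simp add: zero_less_mult_iff) (metis less_irrefl linorder_neqE)
      finally show ?case unfolding B_def using elim by blast
    qed
    then have "\<forall>\<^sub>F r in at_right 0. proj (y + r *\<^sub>R (s *\<^sub>R a)) \<in> closure (B s)"
      by eventually_elim (use closure_subset in blast)
    then show ?thesis by (rule Lim_in_closed_set[OF closed_closure _ trivial_limit_at_right_real lim2])
  qed
  have split: "proj ` ball x \<epsilon> - proj_line a = B 1 \<union> B (- 1)"
  proof -
    have "proj y \<notin> proj_line a \<longleftrightarrow> a \<bullet> y > 0 \<or> (- a) \<bullet> y > 0" if "y \<in> ball x \<epsilon>" for y
    proof -
      have "y \<noteq> 0" using that n0 by auto
      then show ?thesis using proj_in_line[of y a] by auto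
    qed
    then have "{y \<in> ball x \<epsilon>. proj y \<notin> proj_line a} = {y \<in> ball x \<epsilon>. a \<bullet> y > 0 \<or> (- a) \<bullet> y > 0}" by blast
    moreover have "proj ` ball x \<epsilon> - proj_line a = proj ` {y \<in> ball x \<epsilon>. proj y \<notin> proj_line a}" by blast
    moreover have "B 1 \<union> B (- 1) = proj ` {y \<in> ball x \<epsilon>. a \<bullet> y > 0 \<or> (- a) \<bullet> y > 0}"
      unfolding B_def by auto
    ultimately show ?thesis by simp
  qed
  have sub: "proj ` ball x \<epsilon> \<subseteq> W" 
  proof
    fix q assume "q \<in> proj ` ball x \<epsilon>"
    then obtain y where y: "y \<in> ball x \<epsilon>" "q = proj y" by blast
    then have "y \<in> - {0} \<inter> proj -` W'" using e by blast
    then show "q \<in> W" using y(2) proj_plane[of y] W'(2) by simp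
  qed
  show ?thesis unfolding two_sided_at_def
    using openin_proj_ball[OF n0] sub conn[of 1] conn[of "- 1"] split clos e px
    by (intro exI[of _ "proj ` ball x \<epsilon>"] exI[of _ "B 1"] exI[of _ "B (- 1)"]) auto
qed

lemma pseudoline_subset: "pseudoline L \<Longrightarrow> L \<subseteq> proj_plane"
proof -
  assume "pseudoline L"
  then obtain h k a where h: "homeomorphism proj_plane proj_plane h k" "L = h ` proj_line a"
    by (auto simp: pseudoline_def)
  have "h ` proj_plane = proj_plane" using h(1) by (simp add: homeomorphism_def)
  then show ?thesis using image_mono[OF proj_line_subset, of h a] h(2) by simp
qed

lemma pseudoline_compact: "pseudoline L \<Longrightarrow> compact L"
proof -
  assume "pseudoline L"
  then obtain h k a where h: "homeomorphism proj_plane proj_plane h k" "L = h ` proj_line a"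
    by (auto simp: pseudoline_def)
  have "continuous_on proj_plane h" using h(1) by (simp add: homeomorphism_def)
  then have "continuous_on (proj_line a) h" by (rule continuous_on_subset[OF _ proj_line_subset])
  then show ?thesis unfolding h(2) by (rule compact_continuous_image[OF _ compact_proj_line])
qed

lemma pseudoline_two_sided:
  assumes L: "pseudoline L" and p: "p \<in> L" and W: "openin (top_of_set proj_plane) W" "p \<in> W"
  shows "two_sided_at L p W"
proof -
  obtain h k a where h: "a \<noteq> 0" "homeomorphism proj_plane proj_plane h k" "L = h ` proj_line a"
    using L by (auto simp: pseudoline_def)
  have cont: "continuous_on proj_plane h" "h ` proj_plane = proj_plane" and inj: "inj_on h proj_plane"
    using h(2) by (auto simp: homeomorphism_def inj_on_def) metis
  obtain p' where p': "p' \<in> proj_line a" "p = h p'" using p h by blast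
  have "openin (top_of_set proj_plane) (proj_plane \<inter> h -` W)"
    by (rule continuous_openin_preimage[OF cont(1) _ W(1)]) (use cont(2) in auto)
  moreover have "p' \<in> proj_plane \<inter> h -` W" using p' W proj_line_subset by auto
  ultimately have "two_sided_at (proj_line a) p' (proj_plane \<inter> h -` W)"
    using proj_line_two_sided[OF h(1) p'(1)] by blast
  then obtain V V1 V2 where V: "openin (top_of_set proj_plane) V" "p' \<in> V" "V \<subseteq> proj_plane \<inter> h -` W"
    "connected V1" "connected V2" "V - proj_line a = V1 \<union> V2"
    "\<forall>q\<in>V \<inter> proj_line a. q \<in> closure V1 \<and> q \<in> closure V2"
    unfolding two_sided_at_def by auto
  have VP: "V \<subseteq> proj_plane" "V1 \<subseteq> proj_plane" "V2 \<subseteq> proj_plane" using V by auto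
  have "openin (top_of_set proj_plane) (h ` V)" using homeomorphism_imp_open_map[OF h(2) V(1)] .
  moreover have "h ` V \<subseteq> W" "p \<in> h ` V" using V p' by auto
  moreover have "connected (h ` V1)" "connected (h ` V2)"
    using V VP cont by (meson connected_continuous_image continuous_on_subset)+
  moreover have "h ` V - L = h ` V1 \<union> h ` V2"
  proof -
    have "h ` V - h ` proj_line a = h ` (V - proj_line a)"
      using inj_on_image_set_diff[OF inj, of V "proj_line a"] VP(1) proj_line_subset by blast
    then show ?thesis using V(6) h(3) by (simp add: image_Un)
  qed
  moreover have "q \<in> closure (h ` V1) \<and> q \<in> closure (h ` V2)" if q: "q \<in> h ` V \<inter> L" for q
  proof -
    obtain q' where q': "q' \<in> V" "q' \<in> proj_line a" "q = h q'"
      using q inj VP(1) proj_line_subset unfolding h(3) by (auto simp: inj_on_def) blast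
    have "h ` closure X \<subseteq> closure (h ` X)" if "X \<subseteq> proj_plane" for X
    proof (rule image_closure_subset)
      show "continuous_on (closure X) h"
        using cont(1) closure_minimal[OF that closed_proj_plane] continuous_on_subset by blast
      show "h ` X \<subseteq> closure (h ` X)" by (rule closure_subset)
    qed simp
    then show ?thesis using V(7) q' VP by blast
  qed
  ultimately show ?thesis unfolding two_sided_at_def
    by (intro exI[of _ "h ` V"] exI[of _ "h ` V1"] exI[of _ "h ` V2"]) simp
qed

text \<open>In the chart of the crossing the line \<open>L\<close> is the real axis. A half disc of the triangle at \<open>x\<close>
  is connected and avoids \<open>M\<close>, so its image has real part of constant sign. Then the side of the triangle through
  \<open>x\<close> is mapped injectively to a half line with \<open>x\<close> going to its end, which contradicts the intermediate value
  theorem.\<close>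

lemma crosses_at_nonneg_side:
  fixes a b :: complex
  assumes cr: "crosses_at L M q" and x: "x \<in> open_segment a b"
    and hx: "h x = q" and K: "convex K" "closed_segment a b \<subseteq> K" "interior K \<noteq> {}" "closed K"
    and h: "continuous_on K h" "inj_on h K" "h ` K \<subseteq> proj_plane"
    and L: "h ` closed_segment a b \<subseteq> L" and M: "h ` interior K \<inter> M = {}"
  shows False
proof -
  obtain V \<psi> \<psi>' where V: "openin (top_of_set proj_plane) V" "q \<in> V"
    "homeomorphism V (UNIV :: complex set) \<psi> \<psi>'" "\<psi> q = 0"
    "\<psi> ` (L \<inter> V) = {z. Im z = 0}" "\<psi> ` (M \<inter> V) = {z. Re z = 0}"
    using cr by (auto simp: crosses_at_def)
  have \<psi>: "continuous_on V \<psi>" "inj_on \<psi> V"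
    using V(3) unfolding homeomorphism_def by (blast, metis inj_onI)
  have xK: "x \<in> K" using x K(2) by (auto simp: open_segment_def)
  obtain V' where V': "open V'" "V = proj_plane \<inter> V'" using V(1) openin_open by metis
  obtain O' where O': "open O'" "O' \<inter> K = h -` V' \<inter> K"
    using h(1) V'(1) unfolding continuous_on_open_invariant by metis
  have "x \<in> O'" using O' xK hx V V' by blast
  then obtain \<epsilon> where e: "\<epsilon> > 0" "cball x \<epsilon> \<subseteq> O'" using O'(1) open_contains_cball by metis
  define B where "B = cball x \<epsilon> \<inter> K"
  have BV: "h ` B \<subseteq> V"
  proof
    fix y assume "y \<in> h ` B"
    then obtain z where z: "z \<in> K" "z \<in> cball x \<epsilon>" "y = h z" by (auto simp: B_def)
    then have "z \<in> O' \<inter> K" using e by blast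
    then show "y \<in> V" using O' z h(3) V' by blast
  qed
  have cB: "closed B" using K(4) by (simp add: B_def closed_Int)
  define W where "W = ball x \<epsilon> \<inter> interior K"
  define f where "f y = Re (\<psi> (h y))" for y
  have contB: "continuous_on B (\<lambda>y. \<psi> (h y))"
  proof -
    have "continuous_on B h" using h(1) by (rule continuous_on_subset) (auto simp: B_def)
    then show ?thesis using continuous_on_compose2[OF \<psi>(1) _ BV] by simp
  qed
  then have contf: "continuous_on B f" unfolding f_def by (intro continuous_intros)
  have WB: "W \<subseteq> B" using interior_subset[of K] by (auto simp: W_def B_def)
  have clWB: "closure W \<subseteq> B" using closure_minimal[OF WB cB] .
  have f0: "f y \<noteq> 0" if y: "y \<in> W" for y
  proof
    assume "f y = 0"
    then have "\<psi> (h y) \<in> \<psi> ` (M \<inter> V)" using V(6) by (simp add: f_def)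
    then obtain m where m: "m \<in> M" "m \<in> V" "\<psi> (h y) = \<psi> m" by blast
    have "h y \<in> V" using y WB BV by blast
    then have "h y = m" using m inj_onD[OF \<psi>(2) m(3)] by blast
    then show False using m y M by (auto simp: W_def)
  qed
  have "connected W" unfolding W_def using K(1) by (intro convex_connected convex_Int convex_ball convex_interior)
  then have "connected (f ` W)" using contf WB by (meson connected_continuous_image continuous_on_subset)
  have "(\<forall>y\<in>W. f y \<ge> 0) \<or> (\<forall>y\<in>W. f y \<le> 0)"
  proof (rule ccontr)
    assume "\<not> ?thesis"
    then obtain y z where "y \<in> W" "z \<in> W" "f y \<le> 0" "0 \<le> f z" by (metis linear)
    then have "0 \<in> f ` W" using connectedD_interval[OF \<open>connected (f ` W)\<close>, of "f y" "f z" 0] by blast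
    then show False using f0 by auto
  qed
  then obtain s :: real where s: "s \<in> {1, -1}" "\<forall>y\<in>W. s * f y \<ge> 0" by force
  have contW: "continuous_on (closure W) (\<lambda>y. s * f y)"
    using contf clWB by (intro continuous_intros) (rule continuous_on_subset)
  have ge: "s * f y \<ge> 0" if "y \<in> closure W" for y
    by (rule continuous_ge_on_closure[OF contW that]) (use s in auto)
  have clW: "y \<in> closure W" if "y \<in> ball x \<epsilon>" "y \<in> K" for y
  proof -
    have "y \<in> closure (interior K)" using that K convex_closure_interior closure_subset by blast
    then show ?thesis using open_Int_closure_subset[OF open_ball, of x \<epsilon> "interior K"] that(1)
      unfolding W_def by blast
  qed
  obtain u where u: "0 < u" "u < 1" "x = (1 - u) *\<^sub>R a + u *\<^sub>R b" and ab: "a \<noteq> b"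
    using x by (auto simp: in_segment)
  define \<eta> where "\<eta> = min (min u (1 - u)) (\<epsilon> / (2 * norm (b - a)))"
  have \<eta>: "\<eta> > 0" "\<eta> \<le> u" "\<eta> \<le> 1 - u" "\<eta> * norm (b - a) < \<epsilon>"
  proof -
    have n: "norm (b - a) > 0" using ab by simp
    then show "\<eta> > 0" "\<eta> \<le> u" "\<eta> \<le> 1 - u" using u e by (auto simp: \<eta>_def)
    have "\<eta> * norm (b - a) \<le> \<epsilon> / (2 * norm (b - a)) * norm (b - a)"
      using n by (intro mult_right_mono) (auto simp: \<eta>_def)
    also have "\<dots> < \<epsilon>" using n e by simp
    finally show "\<eta> * norm (b - a) < \<epsilon>" .
  qed
  \<comment> \<open>A short piece of the side around \<open>x\<close>, on which the chart is real and has constant sign.\<close>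
  define y where "y r = x + r *\<^sub>R (b - a)" for r
  have yseg: "y r \<in> closed_segment a b" if "r \<in> {-\<eta>..\<eta>}" for r
  proof -
    have "y r = (1 - (u + r)) *\<^sub>R a + (u + r) *\<^sub>R b" by (simp add: y_def u(3) algebra_simps)
    moreover have "0 \<le> u + r" "u + r \<le> 1" using that \<eta> by auto
    ultimately show ?thesis unfolding in_segment by blast
  qed
  have yball: "y r \<in> ball x \<epsilon>" if "r \<in> {-\<eta>..\<eta>}" for r
  proof -
    have "dist x (y r) = \<bar>r\<bar> * norm (b - a)" by (simp add: y_def dist_norm)
    also have "\<dots> \<le> \<eta> * norm (b - a)" using that by (intro mult_right_mono) auto
    finally show ?thesis using \<eta> by simp
  qed
  have yW: "y r \<in> closure W" if "r \<in> {-\<eta>..\<eta>}" for r using clW yball yseg that K(2) by blast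
  have real: "Im (\<psi> (h (y r))) = 0" if "r \<in> {-\<eta>..\<eta>}" for r
  proof -
    have "h (y r) \<in> L \<inter> V" using yseg[OF that] L yW[OF that] clWB BV by blast
    then show ?thesis using V(5) by blast
  qed
  define g where "g r = s * f (y r)" for r
  have contg: "continuous_on {-\<eta>..\<eta>} g"
    unfolding g_def using yW
    by (intro continuous_on_compose2[OF contW]) (auto simp: y_def intro!: continuous_intros)
  have injg: "r = t" if rt: "r \<in> {-\<eta>..\<eta>}" "t \<in> {-\<eta>..\<eta>}" "g r = g t" for r t
  proof -
    have "f (y r) = f (y t)" using rt s by (auto simp: g_def)
    then have "\<psi> (h (y r)) = \<psi> (h (y t))" using real rt by (simp add: complex_eq_iff f_def)
    moreover have "h (y r) \<in> V" "h (y t) \<in> V" using yW rt clWB BV by blast+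
    ultimately have "h (y r) = h (y t)" using inj_onD[OF \<psi>(2)] by blast
    moreover have "y r \<in> K" "y t \<in> K" using yseg rt K(2) by blast+
    ultimately have "y r = y t" using inj_onD[OF h(2)] by blast
    then show ?thesis using ab by (simp add: y_def)
  qed
  have g0: "g 0 = 0" using hx V(4) by (simp add: g_def f_def y_def)
  have gge: "g r \<ge> 0" if "r \<in> {-\<eta>..\<eta>}" for r using ge yW that by (simp add: g_def)
  have gpos: "g \<eta> > 0" "g (-\<eta>) > 0"
    using gge[of \<eta>] gge[of "-\<eta>"] injg[of \<eta> 0] injg[of "-\<eta>" 0] g0 \<eta> by force+
  define m where "m = min (g \<eta>) (g (-\<eta>))"
  have m: "0 < m" "m \<le> g \<eta>" "m \<le> g (-\<eta>)" using gpos by (auto simp: m_def)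
  obtain r where r: "0 \<le> r" "r \<le> \<eta>" "g r = m"
    using IVT'[of g 0 m \<eta>] m g0 \<eta> continuous_on_subset[OF contg, of "{0..\<eta>}"] by auto
  obtain t where t: "-\<eta> \<le> t" "t \<le> 0" "g t = m"
    using IVT2'[of g 0 m "-\<eta>"] m g0 \<eta> continuous_on_subset[OF contg, of "{-\<eta>..0}"] by auto
  have "r = t" using injg[of r t] r t \<eta> by auto
  then have "r = 0" using r t by simp
  then show False using r m g0 by simp
qed

locale triangle_cell =
  fixes A :: "(real^3^3) set set" and C :: "(real^3^3) set" and a b c :: complex and h k L M N
  assumes A: "pseudoline_arrangement A" and C: "C \<in> cells A"
    and LMN: "L \<in> A" "M \<in> A" "N \<in> A" "L \<noteq> M" "M \<noteq> N" "L \<noteq> N"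
    and ncol: "\<not> collinear {a, b, c}"
    and hom: "homeomorphism (convex hull {a, b, c}) (closure C) h k"
    and int: "h ` interior (convex hull {a, b, c}) = C"
    and sides: "h ` closed_segment a b \<subseteq> L" "h ` closed_segment b c \<subseteq> M" "h ` closed_segment c a \<subseteq> N"
begin

lemma rotate: "triangle_cell A C b c a h k M N L"
proof
  have eq: "{b, c, a} = {a, b, c}" by auto
  show "\<not> collinear {b, c, a}" "homeomorphism (convex hull {b, c, a}) (closure C) h k"
    "h ` interior (convex hull {b, c, a}) = C"
    unfolding eq by (fact ncol hom int)+
qed (use A C LMN sides in auto)

lemma cell_disjoint: "D \<in> cells A \<Longrightarrow> L' \<in> A \<Longrightarrow> D \<inter> L' = {}"
  unfolding cells_def using in_components_subset by blast

lemma cell_subset: "D \<in> cells A \<Longrightarrow> D \<subseteq> proj_plane"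
  unfolding cells_def using in_components_subset by blast

lemma hull_props: "convex (convex hull {a, b, c})" "interior (convex hull {a, b, c}) \<noteq> {}"
  "closed (convex hull {a, b, c})" "closed_segment a b \<subseteq> convex hull {a, b, c}"
proof -
  show "interior (convex hull {a, b, c}) \<noteq> {}"
    using int C in_components_nonempty unfolding cells_def by blast
  show "closed (convex hull {a, b, c})" by (simp add: finite_imp_compact_convex_hull compact_imp_closed)
  show "closed_segment a b \<subseteq> convex hull {a, b, c}"
    unfolding segment_convex_hull by (rule hull_mono) auto
qed simp

lemma h_props: "continuous_on (convex hull {a, b, c}) h" "inj_on h (convex hull {a, b, c})"
  "h ` (convex hull {a, b, c}) = closure C"
  using hom unfolding homeomorphism_def by (blast, metis inj_onI, blast)

lemma closure_plane: "D \<in> cells A \<Longrightarrow> closure D \<subseteq> proj_plane"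
  using closure_minimal[OF cell_subset closed_proj_plane] .

text \<open>Another curve through an inner point of a side would cross the side there and enter the cell.\<close>

lemma open_side_only:
  assumes x: "x \<in> open_segment a b" and L': "L' \<in> A" "h x \<in> L'"
  shows "L' = L"
proof (rule ccontr)
  assume ne: "L' \<noteq> L"
  have "x \<in> closed_segment a b" using x by (simp add: open_segment_def)
  then have "h x \<in> L" using sides by blast
  obtain p where p: "L \<inter> L' = {p}" "crosses_at L L' p"
    using A LMN(1) L'(1) ne unfolding pseudoline_arrangement_def by metis
  then have "h x = p" using L' \<open>h x \<in> L\<close> by blast
  then show False
    using crosses_at_nonneg_side[OF p(2) x _ hull_props(1,4,2,3) h_props(1,2) _ sides(1)]
      h_props(3) closure_plane[OF C] int cell_disjoint[OF C L'(1)] by simp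
qed

lemma boundary_cases:
  assumes "p \<in> closure C" "p \<in> L'" "L' \<in> A"
  obtains x where "p = h x" "x \<in> closed_segment a b \<union> closed_segment b c \<union> closed_segment c a"
proof -
  obtain x where x: "x \<in> convex hull {a, b, c}" "p = h x" using assms h_props(3) by blast
  have "p \<notin> C" using cell_disjoint[OF C assms(3)] assms by blast
  then have "x \<notin> interior (convex hull {a, b, c})" using int x by blast
  then have "x \<in> frontier (convex hull {a, b, c})"
    using x hull_props(3) by (simp add: frontier_def closure_closed)
  then show ?thesis using that x frontier_of_triangle[of a b c] by auto
qed

lemma corners_neq: "a \<noteq> b" "b \<noteq> c" "c \<noteq> a"
  using ncol by (auto simp: insert_commute)

lemma corner_images: "h a \<in> L" "h a \<in> N" "h b \<in> L" "h b \<in> M" "h c \<in> M" "h c \<in> N"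
  "h a \<noteq> h b" "h b \<noteq> h c" "h c \<noteq> h a" "h a \<in> closure C" "h b \<in> closure C" "h c \<in> closure C"
proof -
  show "h a \<in> L" "h a \<in> N" "h b \<in> L" "h b \<in> M" "h c \<in> M" "h c \<in> N" using sides by auto
  have "{a, b, c} \<subseteq> convex hull {a, b, c}" by (rule hull_subset)
  then show "h a \<noteq> h b" "h b \<noteq> h c" "h c \<noteq> h a" "h a \<in> closure C" "h b \<in> closure C" "h c \<in> closure C"
    using corners_neq h_props(2,3) by (auto simp: inj_on_def)
qed

lemma open_side:
  assumes p: "p \<in> closure C" "p \<in> L" "p \<noteq> h a" "p \<noteq> h b"
  shows "p \<in> h ` open_segment a b"
proof -
  obtain x where x: "p = h x" "x \<in> closed_segment a b \<union> closed_segment b c \<union> closed_segment c a"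
    using boundary_cases[OF p(1,2) LMN(1)] by blast
  interpret r1: triangle_cell A C b c a h k M N L by (rule rotate)
  interpret r2: triangle_cell A C c a b h k N L M by (rule r1.rotate)
  have "x \<noteq> a" "x \<noteq> b" using x p by auto
  have "x \<noteq> c"
  proof
    assume "x = c"
    then have "h c \<in> L \<inter> M" "h b \<in> L \<inter> M" using x p corner_images by auto
    moreover obtain q where "L \<inter> M = {q}" using A LMN unfolding pseudoline_arrangement_def by metis
    ultimately show False using corner_images(8) by (metis singletonD)
  qed
  have "x \<notin> open_segment b c" using r1.open_side_only[OF _ LMN(1)] LMN x p by blast
  moreover have "x \<notin> open_segment c a" using r2.open_side_only[OF _ LMN(1)] LMN x p by blast
  ultimately have "x \<in> open_segment a b"
    using x(2) \<open>x \<noteq> a\<close> \<open>x \<noteq> b\<close> \<open>x \<noteq> c\<close> by (auto simp: open_segment_def)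
  then show ?thesis using x by blast
qed

text \<open>At a point on a single curve of the arrangement only two cells meet, one on each side.\<close>

lemma local_cells:
  assumes q: "q \<in> L" and only: "\<forall>L'\<in>A. q \<in> L' \<longrightarrow> L' = L"
  shows "\<exists>V C1 C2. openin (top_of_set proj_plane) V \<and> q \<in> V \<and> C1 \<in> cells A \<and> C2 \<in> cells A \<and>
    (\<forall>D\<in>cells A. closure D \<inter> V \<noteq> {} \<longrightarrow> D = C1 \<or> D = C2) \<and>
    (\<forall>q'\<in>V \<inter> L. q' \<in> closure C1 \<and> q' \<in> closure C2)"
proof -
  have ps: "pseudoline L'" if "L' \<in> A" for L' using A that by (simp add: pseudoline_arrangement_def)
  have finA: "finite A" using A by (simp add: pseudoline_arrangement_def)
  define W where "W = proj_plane \<inter> - \<Union>(A - {L})"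
  have "closed (\<Union>(A - {L}))" using finA ps pseudoline_compact compact_imp_closed by (intro closed_Union) auto
  then have openW: "openin (top_of_set proj_plane) W"
    unfolding W_def by (metis open_Compl openin_open)
  have "q \<in> W" using q only ps[OF LMN(1)] pseudoline_subset by (auto simp: W_def)
  then have "two_sided_at L q W" using pseudoline_two_sided ps LMN q openW by blast
  then obtain V V1 V2 where V: "openin (top_of_set proj_plane) V" "q \<in> V" "V \<subseteq> W"
    "connected V1" "connected V2" "V - L = V1 \<union> V2"
    "\<forall>q\<in>V \<inter> L. q \<in> closure V1 \<and> q \<in> closure V2"
    unfolding two_sided_at_def by auto
  have sub: "V1 \<union> V2 \<subseteq> proj_plane - \<Union>A" using V(3,6) unfolding W_def by blast
  have ne: "V1 \<noteq> {}" "V2 \<noteq> {}" using V(2,7) q by auto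
  have ex: "\<exists>D\<in>cells A. V' \<subseteq> D" if "connected V'" "V' \<noteq> {}" "V' \<subseteq> proj_plane - \<Union>A" for V'
    unfolding cells_def using exists_component_superset[OF that(3) _ that(1)] that by blast
  obtain C1 C2 where C12: "C1 \<in> cells A" "V1 \<subseteq> C1" "C2 \<in> cells A" "V2 \<subseteq> C2"
    using ex[OF V(4) ne(1)] ex[OF V(5) ne(2)] sub by blast
  have "D = C1 \<or> D = C2" if D: "D \<in> cells A" "closure D \<inter> V \<noteq> {}" for D
  proof -
    obtain V' where V': "open V'" "V = proj_plane \<inter> V'" using V(1) openin_open by metis
    have "closure D \<inter> V' \<noteq> {}" using D V' by blast
    then have "D \<inter> V' \<noteq> {}" using V'(1) open_Int_closure_eq_empty by blast
    then obtain y where y: "y \<in> D" "y \<in> V" using V' cell_subset[OF D(1)] by blast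
    then have "y \<in> V1 \<union> V2" using V(6) cell_disjoint[OF D(1) LMN(1)] by blast
    then have "y \<in> C1 \<or> y \<in> C2" using C12 by blast
    then show ?thesis using y C12 D(1) unfolding cells_def by (metis components_eq disjoint_iff)
  qed
  moreover have "\<forall>q'\<in>V \<inter> L. q' \<in> closure C1 \<and> q' \<in> closure C2"
    using V(7) C12 closure_mono by blast
  ultimately show ?thesis using V C12 by blast
qed

text \<open>The points of the open side whose neighbour is a given cell form an open and closed set, so a
  neighbour at one point is a neighbour along the whole side. At one point there is only one.\<close>

lemma side_neighbour_unique:
  assumes D: "D \<in> cells A" "D \<noteq> C" "p \<in> closure D" "p \<in> h ` open_segment a b"
    and D': "D' \<in> cells A" "D' \<noteq> C" "p' \<in> closure D'" "p' \<in> h ` open_segment a b"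
  shows "D = D'"
proof -
  define S where "S = h ` open_segment a b"
  have seg: "open_segment a b \<subseteq> convex hull {a, b, c}" using hull_props(4) by (auto simp: open_segment_def)
  have conS: "connected S" unfolding S_def
    by (intro connected_continuous_image continuous_on_subset[OF h_props(1) seg] convex_connected convex_open_segment)
  have SC: "S \<subseteq> closure C" using seg h_props(3) unfolding S_def by blast
  have SL: "S \<subseteq> L" using sides(1) segment_open_subset_closed unfolding S_def by blast
  have only: "\<forall>L'\<in>A. q \<in> L' \<longrightarrow> L' = L" if "q \<in> S" for q
    using that open_side_only by (auto simp: S_def)
  have SP: "S \<subseteq> proj_plane" using SC closure_plane[OF C] by blast
  have full: "S \<subseteq> closure E" if E: "E \<in> cells A" "E \<noteq> C" "S \<inter> closure E \<noteq> {}" for E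
  proof -
    have "closedin (top_of_set S) (S \<inter> closure E)" by (rule closedin_closed_Int) simp
    moreover have "openin (top_of_set S) (S \<inter> closure E)"
    proof (subst openin_subopen, rule ballI)
      fix q assume q: "q \<in> S \<inter> closure E"
      then have qS: "q \<in> S" by blast
      obtain V C1 C2 where V: "openin (top_of_set proj_plane) V" "q \<in> V"
        "\<forall>D\<in>cells A. closure D \<inter> V \<noteq> {} \<longrightarrow> D = C1 \<or> D = C2"
        "\<forall>q'\<in>V \<inter> L. q' \<in> closure C1 \<and> q' \<in> closure C2"
        using local_cells[OF subsetD[OF SL qS] only[OF qS]] by blast
      have "C = C1 \<or> C = C2" "E = C1 \<or> E = C2" using V(2,3) q SC C E by blast+
      then have "S \<inter> V \<subseteq> S \<inter> closure E" using V(4) SL by blast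
      moreover obtain V' where V': "open V'" "V = proj_plane \<inter> V'" using V(1) openin_open by metis
      then have "S \<inter> V = S \<inter> V'" using SP by blast
      then have "openin (top_of_set S) (S \<inter> V)" using V'(1) by (simp add: openin_open_Int)
      ultimately show "\<exists>T. openin (top_of_set S) T \<and> q \<in> T \<and> T \<subseteq> S \<inter> closure E" using q V(2) by blast
    qed
    ultimately have "S \<inter> closure E = S" using conS E(3) unfolding connected_clopen by blast
    then show ?thesis by blast
  qed
  have "S \<subseteq> closure D" "S \<subseteq> closure D'" using full D D' unfolding S_def by blast+
  then have p: "p \<in> closure D" "p \<in> closure D'" "p \<in> closure C" "p \<in> S" using D(4) SC by (auto simp: S_def)
  obtain V C1 C2 where V: "openin (top_of_set proj_plane) V" "p \<in> V"
    "\<forall>D\<in>cells A. closure D \<inter> V \<noteq> {} \<longrightarrow> D = C1 \<or> D = C2"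
    using local_cells[OF subsetD[OF SL p(4)] only[OF p(4)]] by blast
  have "C = C1 \<or> C = C2" "D = C1 \<or> D = C2" "D' = C1 \<or> D' = C2" using V(2,3) p C D D' by blast+
  then show ?thesis using D(2) D'(2) by blast
qed

lemma adjacent_side:
  assumes "L' \<in> A" "adjacent_along A L' C D"
  shows "L' = L \<or> L' = M \<or> L' = N"
proof -
  obtain p where p: "p \<in> closure C" "p \<in> L'" "\<forall>M\<in>A. p \<in> M \<longrightarrow> M = L'"
    using assms by (auto simp: adjacent_along_def)
  obtain x where "p = h x" "x \<in> closed_segment a b \<union> closed_segment b c \<union> closed_segment c a"
    using boundary_cases[OF p(1,2) assms(1)] by blast
  then have "p \<in> L \<or> p \<in> M \<or> p \<in> N" using sides by blast
  then show ?thesis using p LMN by blast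
qed

lemma adjacent_unique_L:
  assumes "adjacent_along A L C D" "adjacent_along A L C D'"
  shows "D = D'"
proof -
  have ex: "\<exists>p. p \<in> closure D \<and> p \<in> h ` open_segment a b" if adj: "adjacent_along A L C D" for D
  proof -
    obtain p where p: "p \<in> closure C" "p \<in> L" "p \<in> closure D" "\<forall>M\<in>A. p \<in> M \<longrightarrow> M = L"
      using adj unfolding adjacent_along_def by blast
    then have "p \<noteq> h a" "p \<noteq> h b" using corner_images LMN by metis+
    then show ?thesis using open_side p by blast
  qed
  obtain p p' where p: "p \<in> closure D" "p \<in> h ` open_segment a b" "p' \<in> closure D'" "p' \<in> h ` open_segment a b"
    using ex[OF assms(1)] ex[OF assms(2)] by blast
  have "D \<in> cells A" "D \<noteq> C" "D' \<in> cells A" "D' \<noteq> C" using assms unfolding adjacent_along_def by blast+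
  then show ?thesis using side_neighbour_unique[OF _ _ p(1,2) _ _ p(3,4)] by blast
qed

lemma adjacent_unique:
  assumes "L' \<in> A" "adjacent_along A L' C D" "adjacent_along A L' C D'"
  shows "D = D'"
proof -
  interpret r1: triangle_cell A C b c a h k M N L by (rule rotate)
  interpret r2: triangle_cell A C c a b h k N L M by (rule r1.rotate)
  consider "L' = L" | "L' = M" | "L' = N" using adjacent_side[OF assms(1,2)] by blast
  then show ?thesis
  proof cases
    case 1 show ?thesis by (rule adjacent_unique_L[OF assms(2,3)[unfolded 1]])
  next
    case 2 show ?thesis by (rule r1.adjacent_unique_L[OF assms(2,3)[unfolded 2]])
  next
    case 3 show ?thesis by (rule r2.adjacent_unique_L[OF assms(2,3)[unfolded 3]])
  qed
qed

text \<open>Apart from its end points, a side of the cell lies on one pseudoline only, so pseudolines can cross on the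
  boundary of the cell only where two sides meet.\<close>

lemma crossing_corner:
  assumes p: "p \<in> closure C" "L1 \<in> A" "L2 \<in> A" "L1 \<noteq> L2" "p \<in> L1" "p \<in> L2"
  shows "p \<in> {h a, h b, h c}"
proof (rule ccontr)
  assume n: "p \<notin> {h a, h b, h c}"
  interpret r1: triangle_cell A C b c a h k M N L by (rule rotate)
  interpret r2: triangle_cell A C c a b h k N L M by (rule r1.rotate)
  obtain x where x: "p = h x" "x \<in> closed_segment a b \<union> closed_segment b c \<union> closed_segment c a"
    using boundary_cases[OF p(1,5,2)] by blast
  then have "x \<in> open_segment a b \<or> x \<in> open_segment b c \<or> x \<in> open_segment c a"
    using n by (auto simp: open_segment_def)
  then have "L1 = L \<and> L2 = L \<or> L1 = M \<and> L2 = M \<or> L1 = N \<and> L2 = N"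
    using open_side_only[of x] r1.open_side_only[of x] r2.open_side_only[of x] p x(1) by auto
  then show False using p(4) by blast
qed

end

section \<open>Vertex degrees of a dual tiling\<close>

context tiling
begin

text \<open>Both tiles contain a neighbourhood of the vertex in the sector.\<close>

lemma tile_from_cone:
  assumes Q1: "tile T Q1" "v \<in> Q1" "y1 \<in> Q1" "y2 \<in> Q1" and Q2: "tile T Q2" "v \<in> Q2" "y1 \<in> Q2" "y2 \<in> Q2"
    and w: "wedge (y1 - v) (y2 - v) > 0"
  shows "Q1 = Q2"
proof -
  define x where "x = (y1 - v) + (y2 - v)"
  have x: "wedge (y1 - v) x > 0" "wedge x (y2 - v) > 0" using w unfolding x_def wedge_lin(1,2) by auto
  obtain d1 where d1: "d1 > 0" "\<And>\<delta>. 0 < \<delta> \<Longrightarrow> \<delta> < d1 \<Longrightarrow> v + \<delta> *\<^sub>R x \<in> interior Q1"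
    by (rule convex_corner_interior[OF tile_props(2)[OF Q1(1)] Q1(2-4) w x]) blast
  obtain d2 where d2: "d2 > 0" "\<And>\<delta>. 0 < \<delta> \<Longrightarrow> \<delta> < d2 \<Longrightarrow> v + \<delta> *\<^sub>R x \<in> interior Q2"
    by (rule convex_corner_interior[OF tile_props(2)[OF Q2(1)] Q2(2-4) w x]) blast
  define \<delta> where "\<delta> = min d1 d2 / 2"
  have "0 < \<delta>" "\<delta> < d1" "\<delta> < d2" using d1 d2 by (auto simp: \<delta>_def)
  then show ?thesis using tile_unique[OF Q1(1) Q2(1)] d1 d2 by blast
qed

definition nbrs :: "complex \<Rightarrow> complex set" where
  "nbrs v = {y. {v, y} \<in> edges T}"

lemma finite_nbrs: "finite (nbrs v)"
  by (rule finite_subset[OF _ finite_verts]) (use edge_verts in \<open>auto simp: nbrs_def\<close>)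

lemma vertex_degree_nbrs: "vertex_degree T v = card (nbrs v)"
proof -
  have "{e \<in> edges T. v \<in> e} = (\<lambda>y. {v, y}) ` nbrs v"
  proof (intro equalityI subsetI)
    fix e assume e: "e \<in> {e \<in> edges T. v \<in> e}"
    then obtain a b where ab: "e = {a, b}" "{a, b} \<in> edges T" by (auto elim: edgeE)
    then show "e \<in> (\<lambda>y. {v, y}) ` nbrs v" using e by (auto simp: nbrs_def insert_commute)
  qed (auto simp: nbrs_def)
  moreover have "inj_on (\<lambda>y. {v, y}) (nbrs v)"
    using edge_verts(3) by (auto simp: inj_on_def nbrs_def doubleton_eq_iff)
  ultimately show ?thesis by (simp add: vertex_degree_def card_image)
qed

definition tiles_at :: "complex \<Rightarrow> complex set set" where
  "tiles_at v = {Q. tile T Q \<and> v \<in> corners Q}"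

lemma tile_pair:
  assumes "Q \<in> tiles_at v"
  obtains y1 y2 where "y1 \<in> nbrs v" "y2 \<in> nbrs v" "y1 \<in> Q" "y2 \<in> Q" "wedge (y1 - v) (y2 - v) > 0"
proof -
  have Q: "tile T Q" "v \<in> corners Q" using assms by (auto simp: tiles_at_def)
  obtain y1 y2 where "{v, y1} \<in> edges T" "{v, y2} \<in> edges T" "y1 \<in> corners Q" "y2 \<in> corners Q"
    "wedge (y1 - v) (y2 - v) > 0"
    using corner_cone[OF Q] by blast
  then show ?thesis using that tile_props(9)[OF Q(1)] by (auto simp: nbrs_def)
qed

lemma tiles_at_D: "Q \<in> tiles_at v \<Longrightarrow> tile T Q \<and> v \<in> Q"
  by (auto simp: tiles_at_def corners_def extreme_point_of_def)

lemma tiles_same_pair: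
  assumes "Q1 \<in> tiles_at v" "Q2 \<in> tiles_at v" "y1 \<in> Q1" "y2 \<in> Q1" "y1 \<in> Q2" "y2 \<in> Q2"
    "wedge (y1 - v) (y2 - v) \<noteq> 0"
  shows "Q1 = Q2"
proof (cases "wedge (y1 - v) (y2 - v) > 0")
  case True
  then show ?thesis using tile_from_cone[of Q1 v y1 y2 Q2] assms tiles_at_D by blast
next
  case False
  then have "wedge (y2 - v) (y1 - v) > 0" using assms(7) wedge_commute[of "y2 - v" "y1 - v"] by linarith
  then show ?thesis using tile_from_cone[of Q1 v y2 y1 Q2] assms tiles_at_D by blast
qed

lemma two_nbrs:
  assumes "Q \<in> tiles_at v" shows "card (nbrs v) \<ge> 2"
proof -
  obtain y1 y2 where y: "y1 \<in> nbrs v" "y2 \<in> nbrs v" "wedge (y1 - v) (y2 - v) > 0"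
    using tile_pair[OF assms] by metis
  then have "y1 \<noteq> y2" by auto
  then have "card {y1, y2} \<le> card (nbrs v)" using y finite_nbrs by (intro card_mono) auto
  then show ?thesis using \<open>y1 \<noteq> y2\<close> by simp
qed

text \<open>With two edges at the vertex, two tiles would occupy the same convex sector.\<close>

lemma three_nbrs:
  assumes "Q1 \<in> tiles_at v" "Q2 \<in> tiles_at v" "Q1 \<noteq> Q2" shows "card (nbrs v) \<ge> 3"
proof (rule ccontr)
  assume n: "\<not> ?thesis"
  obtain y1 y2 where y: "y1 \<in> nbrs v" "y2 \<in> nbrs v" "y1 \<in> Q1" "y2 \<in> Q1" "wedge (y1 - v) (y2 - v) > 0"
    using tile_pair[OF assms(1)] by metis
  obtain z1 z2 where z: "z1 \<in> nbrs v" "z2 \<in> nbrs v" "z1 \<in> Q2" "z2 \<in> Q2" "wedge (z1 - v) (z2 - v) > 0"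
    using tile_pair[OF assms(2)] by metis
  have ne: "y1 \<noteq> y2" "z1 \<noteq> z2" using y z by auto
  have "{y1, y2} = nbrs v" by (rule card_seteq[OF finite_nbrs]) (use y n ne in auto)
  moreover have "{z1, z2} = nbrs v" by (rule card_seteq[OF finite_nbrs]) (use z n ne in auto)
  ultimately have "{z1, z2} = {y1, y2}" by simp
  then have "y1 \<in> Q2" "y2 \<in> Q2" using z by auto
  then show False using tiles_same_pair[OF assms(1,2) y(3,4)] y(5) assms(3) by auto
qed

text \<open>Near the vertex the polygon coincides with the only tile there, in which the vertex is extreme.\<close>

lemma single_tile_corner:
  assumes v: "v \<in> verts T" and Q: "tiles_at v = {Q}" and deg: "card (nbrs v) \<le> 2"
  shows "v \<in> corners P"
proof -
  have Q': "Q \<in> tiles_at v" "tile T Q" "v \<in> corners Q" using Q by (auto simp: tiles_at_def)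
  note Qp = tile_props[OF Q'(2)]
  have vQ: "v \<in> Q" using Q' tiles_at_D by blast
  obtain y1 y2 where y: "y1 \<in> nbrs v" "y2 \<in> nbrs v" "y1 \<in> Q" "y2 \<in> Q" "wedge (y1 - v) (y2 - v) > 0"
    using tile_pair[OF Q'(1)] by metis
  then have "y1 \<noteq> y2" by auto
  then have nb: "nbrs v = {y1, y2}" using y deg finite_nbrs by (intro card_seteq[symmetric]) auto
  have near: "\<exists>\<delta>>0. v + \<delta> *\<^sub>R (s - v) \<in> Q" if s: "s \<in> P" "s \<noteq> v" for s
  proof (cases "\<exists>y r. {v, y} \<in> edges T \<and> r > 0 \<and> s - v = r *\<^sub>R (y - v)")
    case True
    then obtain y r where r: "y \<in> nbrs v" "r > 0" "s - v = r *\<^sub>R (y - v)" by (auto simp: nbrs_def)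
    then have "y \<in> Q" using nb y by auto
    moreover have "v + (1/r) *\<^sub>R (s - v) = y" using r by simp
    ultimately show ?thesis using r by (intro exI[of _ "1/r"]) simp
  next
    case False
    then obtain Q2 \<delta> where Q2: "tile T Q2" "v \<in> corners Q2" "0 < \<delta>" "v + \<delta> *\<^sub>R (s - v) \<in> interior Q2"
      using direction_tile[OF v, of "s - v"] s by auto
    then have "Q2 = Q" using Q by (auto simp: tiles_at_def)
    then show ?thesis using Q2 interior_subset by blast
  qed
  have "v \<notin> open_segment s t" if st: "s \<in> P" "t \<in> P" for s t
  proof
    assume "v \<in> open_segment s t"
    then obtain u where u: "0 < u" "u < 1" "s \<noteq> t" "v = (1 - u) *\<^sub>R s + u *\<^sub>R t"
      by (auto simp: in_segment)
    have rel: "u *\<^sub>R (t - v) = - ((1 - u) *\<^sub>R (s - v))" using u(4) by (simp add: algebra_simps)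
    have "s \<noteq> v" "t \<noteq> v"
    proof -
      have "v - s = u *\<^sub>R (t - s)" "t - v = (1 - u) *\<^sub>R (t - s)" using u(4) by (simp_all add: algebra_simps)
      then show "s \<noteq> v" "t \<noteq> v" using u by auto
    qed
    obtain d1 d2 where d: "d1 > 0" "v + d1 *\<^sub>R (s - v) \<in> Q" "d2 > 0" "v + d2 *\<^sub>R (t - v) \<in> Q"
      using near[OF st(1) \<open>s \<noteq> v\<close>] near[OF st(2) \<open>t \<noteq> v\<close>] by blast
    let ?a = "v + d1 *\<^sub>R (s - v)" and ?b = "v + d2 *\<^sub>R (t - v)"
    define \<mu> where "\<mu> = d2 * (1 - u) / u"
    have \<mu>: "\<mu> > 0" using d u by (simp add: \<mu>_def)
    have "d2 *\<^sub>R (t - v) = (d2 / u) *\<^sub>R (u *\<^sub>R (t - v))" using u by simp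
    also have "\<dots> = - (\<mu> *\<^sub>R (s - v))" unfolding rel by (simp add: \<mu>_def)
    finally have b_eq: "?b = v - \<mu> *\<^sub>R (s - v)" by simp
    define r where "r = d1 / (d1 + \<mu>)"
    have r: "0 < r" "r < 1" "(1 - r) * d1 = r * \<mu>" using d \<mu> by (auto simp: r_def field_simps)
    have "(1 - r) *\<^sub>R ?a + r *\<^sub>R ?b = v + ((1 - r) * d1 - r * \<mu>) *\<^sub>R (s - v)"
      unfolding b_eq by (simp add: algebra_simps)
    then have "v = (1 - r) *\<^sub>R ?a + r *\<^sub>R ?b" using r by simp
    moreover have "?a \<noteq> ?b"
    proof
      assume "?a = ?b"
      then have "(d1 + \<mu>) *\<^sub>R (s - v) = 0" unfolding b_eq by (simp add: algebra_simps)
      then show False using d \<mu> \<open>s \<noteq> v\<close> by auto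
    qed
    ultimately have "v \<in> open_segment ?a ?b" using r by (auto simp: in_segment)
    then show False using Q'(3) extreme_point_of_open_segment d by (metis corners_def mem_Collect_eq)
  qed
  then show ?thesis using verts_P[OF v] by (simp add: corners_def extreme_point_of_def)
qed

text \<open>Three tiles would use all three pairs of edges. At a corner the edges lie in an open half-plane, so
  one edge is between the two others and enters the tile of that pair.\<close>

lemma three_tiles_not_corner:
  assumes v: "v \<in> corners P" and Q: "card (tiles_at v) = 3" and deg: "card (nbrs v) = 3"
  shows False
proof -
  obtain c where c: "\<forall>z\<in>P. z \<noteq> v \<longrightarrow> c \<bullet> z < c \<bullet> v" using corner_exposed[OF v] by blast
  have neg: "c \<bullet> (y - v) < 0" if "y \<in> nbrs v" for y
    using c edge_verts[of v y] verts_P that by (auto simp: nbrs_def inner_diff_right)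
  have fin: "finite (tiles_at v)" using Q by (intro card_ge_0_finite) simp
  define pair where "pair Q = nbrs v \<inter> Q" for Q
  have pair2: "\<exists>y1 y2. y1 \<in> pair Q \<and> y2 \<in> pair Q \<and> wedge (y1 - v) (y2 - v) > 0" if "Q \<in> tiles_at v" for Q
    using tile_pair[OF that] unfolding pair_def by (metis IntI)
  have no3: "\<not> (wedge (y1 - v) (y2 - v) > 0 \<and> wedge (y2 - v) (y3 - v) > 0 \<and> wedge (y1 - v) (y3 - v) > 0)"
    if "Q \<in> tiles_at v" "y1 \<in> pair Q" "y3 \<in> pair Q" "y2 \<in> nbrs v" for Q y1 y2 y3
    using edge_not_inside_tile_cone[of Q v y1 y3 y2] that tiles_at_D unfolding pair_def nbrs_def by blast
  have nocyc: "\<not> (wedge (y1 - v) (y2 - v) > 0 \<and> wedge (y2 - v) (y3 - v) > 0 \<and> wedge (y3 - v) (y1 - v) > 0)"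
    if y: "y1 \<in> nbrs v" "y2 \<in> nbrs v" "y3 \<in> nbrs v" for y1 y2 y3
  proof
    assume w: "wedge (y1 - v) (y2 - v) > 0 \<and> wedge (y2 - v) (y3 - v) > 0 \<and> wedge (y3 - v) (y1 - v) > 0"
    have "wedge (y1 - v) (y2 - v) * (c \<bullet> (y3 - v))
      = wedge (y3 - v) (y2 - v) * (c \<bullet> (y1 - v)) + wedge (y1 - v) (y3 - v) * (c \<bullet> (y2 - v))"
      by (rule wedge_cramer_inner)
    moreover have "wedge (y1 - v) (y2 - v) * (c \<bullet> (y3 - v)) < 0" using w neg y by (simp add: mult_pos_neg)
    moreover have "wedge (y3 - v) (y2 - v) * (c \<bullet> (y1 - v)) > 0"
      using w neg[OF y(1)] wedge_commute[of "y3 - v" "y2 - v"] by (simp add: mult_pos_neg)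
    moreover have "wedge (y1 - v) (y3 - v) * (c \<bullet> (y2 - v)) > 0"
      using w neg[OF y(2)] wedge_commute[of "y1 - v" "y3 - v"] by (simp add: mult_pos_neg)
    ultimately show False by linarith
  qed
  have inj: "inj_on pair (tiles_at v)"
  proof (rule inj_onI)
    fix Q1 Q2 assume q: "Q1 \<in> tiles_at v" "Q2 \<in> tiles_at v" "pair Q1 = pair Q2"
    obtain y1 y2 where y: "y1 \<in> pair Q1" "y2 \<in> pair Q1" "wedge (y1 - v) (y2 - v) > 0"
      using pair2[OF q(1)] by blast
    then show "Q1 = Q2" using tiles_same_pair[OF q(1,2), of y1 y2] q(3) by (auto simp: pair_def)
  qed
  obtain e1 e2 e3 where e: "nbrs v = {e1, e2, e3}" "e1 \<noteq> e2" "e2 \<noteq> e3" "e1 \<noteq> e3"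
    using deg by (auto simp: card_Suc_eq numeral_3_eq_3)
  have pairs: "pair Q \<in> {{e1, e2}, {e2, e3}, {e1, e3}}" if q: "Q \<in> tiles_at v" for Q
  proof -
    have "pair Q \<subseteq> {e1, e2, e3}" using e by (auto simp: pair_def)
    obtain y1 y2 where y: "y1 \<in> pair Q" "y2 \<in> pair Q" "wedge (y1 - v) (y2 - v) > 0" using pair2[OF q] by blast
    then have "y1 \<noteq> y2" by auto
    moreover have "pair Q \<noteq> nbrs v"
    proof
      assume all: "pair Q = nbrs v"
      have "card (tiles_at v - {Q}) = 2" using Q q fin by simp
      then have "tiles_at v - {Q} \<noteq> {}" by (metis card.empty zero_neq_numeral)
      then obtain R where R: "R \<in> tiles_at v" "R \<noteq> Q" by blast
      obtain y1 y2 where y: "y1 \<in> pair R" "y2 \<in> pair R" "wedge (y1 - v) (y2 - v) > 0" using pair2[OF R(1)] by blast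
      then have "y1 \<in> Q" "y2 \<in> Q" using all by (auto simp: pair_def)
      then show False using tiles_same_pair[OF R(1) q, of y1 y2] y R by (auto simp: pair_def)
    qed
    ultimately show ?thesis using y \<open>pair Q \<subseteq> {e1, e2, e3}\<close> e by auto
  qed
  have "pair ` tiles_at v \<subseteq> {{e1, e2}, {e2, e3}, {e1, e3}}" using pairs by blast
  moreover have "card {{e1, e2}, {e2, e3}, {e1, e3}} \<le> card (pair ` tiles_at v)"
    using card_image[OF inj] Q by (simp add: card_insert_if)
  ultimately have im: "pair ` tiles_at v = {{e1, e2}, {e2, e3}, {e1, e3}}" by (intro card_seteq) auto
  have two: "\<exists>Q\<in>tiles_at v. pair Q = {a, b}" if "{a, b} \<in> {{e1, e2}, {e2, e3}, {e1, e3}}" for a b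
    using that unfolding im[symmetric] by (auto simp: image_iff)
  have non0: "wedge (a - v) (b - v) \<noteq> 0" if ab: "{a, b} \<in> {{e1, e2}, {e2, e3}, {e1, e3}}" for a b
  proof -
    obtain Q where Q: "Q \<in> tiles_at v" "pair Q = {a, b}" using two[OF ab] by blast
    obtain y1 y2 where "y1 \<in> {a, b}" "y2 \<in> {a, b}" "wedge (y1 - v) (y2 - v) > 0" using pair2[OF Q(1)] Q(2) by auto
    then show ?thesis using wedge_commute[of "a - v" "b - v"] by auto
  qed
  have mem: "e1 \<in> nbrs v" "e2 \<in> nbrs v" "e3 \<in> nbrs v" using e by auto
  have between: "\<not> (wedge (a - v) (b - v) > 0 \<and> wedge (b - v) (d - v) > 0 \<and> wedge (a - v) (d - v) > 0)"
    if ad: "{a, d} \<in> {{e1, e2}, {e2, e3}, {e1, e3}}" and b: "b \<in> nbrs v" for a b d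
  proof -
    obtain Q where "Q \<in> tiles_at v" "pair Q = {a, d}" using two[OF ad] by blast
    then show ?thesis using no3[of Q a d b] b by simp
  qed
  have w: "wedge (e1 - v) (e2 - v) \<noteq> 0" "wedge (e2 - v) (e3 - v) \<noteq> 0" "wedge (e1 - v) (e3 - v) \<noteq> 0"
    using non0 by blast+
  have comm: "wedge (e2 - v) (e1 - v) = - wedge (e1 - v) (e2 - v)"
    "wedge (e3 - v) (e2 - v) = - wedge (e2 - v) (e3 - v)" "wedge (e3 - v) (e1 - v) = - wedge (e1 - v) (e3 - v)"
    by (rule wedge_commute)+
  have swap: "{e2, e1} = {e1, e2}" "{e3, e2} = {e2, e3}" "{e3, e1} = {e1, e3}" by auto
  have b: "\<not> (wedge (e1 - v) (e2 - v) > 0 \<and> wedge (e2 - v) (e3 - v) > 0 \<and> wedge (e1 - v) (e3 - v) > 0)"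
    "\<not> (wedge (e1 - v) (e3 - v) > 0 \<and> wedge (e3 - v) (e2 - v) > 0 \<and> wedge (e1 - v) (e2 - v) > 0)"
    "\<not> (wedge (e2 - v) (e1 - v) > 0 \<and> wedge (e1 - v) (e3 - v) > 0 \<and> wedge (e2 - v) (e3 - v) > 0)"
    "\<not> (wedge (e2 - v) (e3 - v) > 0 \<and> wedge (e3 - v) (e1 - v) > 0 \<and> wedge (e2 - v) (e1 - v) > 0)"
    "\<not> (wedge (e3 - v) (e1 - v) > 0 \<and> wedge (e1 - v) (e2 - v) > 0 \<and> wedge (e3 - v) (e2 - v) > 0)"
    "\<not> (wedge (e3 - v) (e2 - v) > 0 \<and> wedge (e2 - v) (e1 - v) > 0 \<and> wedge (e3 - v) (e1 - v) > 0)"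
    by (rule between; simp add: mem swap)+
  show False
    using b nocyc[OF mem(1,2,3)] nocyc[OF mem(1,3,2)] w unfolding comm by linarith
qed

end

locale dual_to_arrangement = tiling +
  fixes A :: "(real^3^3) set set" and f :: "(real^3^3) set \<Rightarrow> complex" and g :: "real^3^3 \<Rightarrow> complex set"
  assumes A: "pseudoline_arrangement A" and triangular: "simplicial A" and inf: "line_at_infinity \<in> A"
    and f: "bij_betw f (cells A) (verts T)"
    and edges_eq: "edges T = {{f C, f D} | C D. \<exists>L\<in>finite_pseudolines A. adjacent_along A L C D}"
    and parallel: "\<And>L L' C D C' D'. L \<in> finite_pseudolines A \<Longrightarrow> L' \<in> finite_pseudolines A \<Longrightarrow>
      L \<inter> L' \<inter> line_at_infinity \<noteq> {} \<Longrightarrow> adjacent_along A L C D \<Longrightarrow> adjacent_along A L' C' D' \<Longrightarrow>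
      collinear {0, f D - f C, f D' - f C'}"
    and g: "bij_betw g (finite_crossings A) (bounded_faces T)"
    and g_verts: "\<And>p. p \<in> finite_crossings A \<Longrightarrow>
      verts T \<inter> frontier (g p) = f ` {C \<in> cells A. p \<in> closure C}"

lemma adjacent_along_sym: "adjacent_along A L C D \<Longrightarrow> adjacent_along A L D C"
  unfolding adjacent_along_def by blast

context dual_to_arrangement
begin

lemma f_inj: "C \<in> cells A \<Longrightarrow> D \<in> cells A \<Longrightarrow> f C = f D \<Longrightarrow> C = D"
  using f by (auto simp: bij_betw_def inj_on_def)

lemma f_vert: "C \<in> cells A \<Longrightarrow> f C \<in> verts T"
  using f by (auto simp: bij_betw_def)

lemma adjacent_cells: "adjacent_along A L C D \<Longrightarrow> C \<in> cells A \<and> D \<in> cells A"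
  by (simp add: adjacent_along_def)

lemma nbrs_dual:
  assumes C: "C \<in> cells A" and y: "y \<in> nbrs (f C)"
  shows "\<exists>L D. L \<in> finite_pseudolines A \<and> adjacent_along A L C D \<and> y = f D"
proof -
  have "{f C, y} \<in> edges T" using y by (simp add: nbrs_def)
  then obtain C' D' L where e: "{f C, y} = {f C', f D'}" "L \<in> finite_pseudolines A" "adjacent_along A L C' D'"
    unfolding edges_eq by blast
  from e(1) consider "f C = f C'" "y = f D'" | "f C = f D'" "y = f C'" by (auto simp: doubleton_eq_iff)
  then show ?thesis
  proof cases
    case 1
    then have "C = C'" using f_inj C adjacent_cells[OF e(3)] by blast
    then show ?thesis using 1 e by blast
  next
    case 2
    then have "C = D'" using f_inj C adjacent_cells[OF e(3)] by blast
    then show ?thesis using 2 e adjacent_along_sym by blast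
  qed
qed

definition crossings_at :: "(real^3^3) set \<Rightarrow> (real^3^3) set" where
  "crossings_at C = {p \<in> finite_crossings A. p \<in> closure C}"

lemma frontier_tile: "tile T Q \<Longrightarrow> frontier (interior Q) = frontier Q"
  unfolding frontier_def[of "interior Q"] using tile_props(7,12) by simp

text \<open>The vertices of the tile of a crossing are the cells whose closure contains the crossing.\<close>

lemma tiles_at_dual:
  assumes C: "C \<in> cells A"
  shows "card (tiles_at (f C)) = card (crossings_at C)"
proof -
  have "inj_on interior (tiles_at (f C))"
    by (rule inj_onI) (metis tile_props(7) tiles_at_D)
  moreover have "interior ` tiles_at (f C) = g ` crossings_at C"
  proof (intro equalityI subsetI)
    fix F assume "F \<in> interior ` tiles_at (f C)"
    then obtain Q where Q: "tile T Q" "f C \<in> corners Q" "F = interior Q" by (auto simp: tiles_at_def)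
    have "F \<in> bounded_faces T" using Q by (simp add: tile_def)
    then have "F \<in> g ` finite_crossings A" using bij_betw_imp_surj_on[OF g] by simp
    then obtain p where p: "F = g p" "p \<in> finite_crossings A" by (rule imageE)
    have eq: "verts T \<inter> frontier Q = f ` {C \<in> cells A. p \<in> closure C}"
      using g_verts[OF p(2)] p(1) Q(3) frontier_tile[OF Q(1)] by simp
    have "f C \<in> verts T \<inter> frontier Q" using Q by (simp add: tile_def)
    then have "f C \<in> f ` {C \<in> cells A. p \<in> closure C}" unfolding eq .
    then have "p \<in> closure C" using f_inj C by blast
    then show "F \<in> g ` crossings_at C" using p unfolding crossings_at_def by blast
  next
    fix F assume "F \<in> g ` crossings_at C"
    then obtain p where p: "p \<in> finite_crossings A" "p \<in> closure C" "F = g p" by (auto simp: crossings_at_def)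
    then have "F \<in> bounded_faces T" using g by (auto simp: bij_betw_def)
    then obtain Q where Q: "tile T Q" "F = interior Q" by (rule face_tile)
    have "f C \<in> verts T \<inter> frontier (g p)" using g_verts[OF p(1)] p C by blast
    then have "f C \<in> verts T \<inter> frontier Q" using Q p frontier_tile by simp
    moreover have "verts T \<inter> frontier Q = corners Q" using Q(1) by (simp add: tile_def)
    ultimately have "f C \<in> corners Q" by (simp only:)
    then show "F \<in> interior ` tiles_at (f C)" using Q by (auto simp: tiles_at_def)
  qed
  moreover have "inj_on g (crossings_at C)"
    using g by (auto simp: bij_betw_def crossings_at_def inj_on_def)
  ultimately show ?thesis by (metis card_image)
qed

lemma cell_triangle:
  assumes "C \<in> cells A"
  shows "\<exists>a b c h k L M N. triangle_cell A C a b c h k L M N"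
proof -
  have "triangular_cell A C" using triangular assms by (simp add: simplicial_def)
  then show ?thesis
    unfolding triangular_cell_def
  proof (elim exE bexE conjE)
    fix a b c :: complex and h k L M N
    assume "L \<in> A" "M \<in> A" "N \<in> A" "\<not> collinear {a, b, c}" "L \<noteq> M" "M \<noteq> N" "L \<noteq> N"
      "homeomorphism (convex hull {a, b, c}) (closure C) h k"
      "h ` interior (convex hull {a, b, c}) = C"
      "h ` closed_segment a b \<subseteq> L" "h ` closed_segment b c \<subseteq> M" "h ` closed_segment c a \<subseteq> N"
    then have "triangle_cell A C a b c h k L M N" using A assms by (intro triangle_cell.intro)
    then show ?thesis by blast
  qed
qed

lemma meet_once: "L \<in> A \<Longrightarrow> M \<in> A \<Longrightarrow> L \<noteq> M \<Longrightarrow> p \<in> L \<Longrightarrow> p \<in> M \<Longrightarrow> q \<in> L \<Longrightarrow> q \<in> M \<Longrightarrow> p = q"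
proof -
  assume LM: "L \<in> A" "M \<in> A" "L \<noteq> M" and pq: "p \<in> L" "p \<in> M" "q \<in> L" "q \<in> M"
  obtain r where "L \<inter> M = {r}" using A LM unfolding pseudoline_arrangement_def by metis
  then show "p = q" using pq by (metis IntI singletonD)
qed

text \<open>Each neighbour determines a dual pseudoline, and distinct neighbours have distinct ones. So the number of
  finite sides bounds the degree.\<close>

definition side_lines :: "complex \<Rightarrow> (real^3^3) set \<Rightarrow> (real^3^3) set" where
  "side_lines y C = (SOME L. L \<in> finite_pseudolines A \<and> (\<exists>D. adjacent_along A L C D \<and> y = f D))"

lemma side_lines:
  assumes "C \<in> cells A" "y \<in> nbrs (f C)"
  shows "side_lines y C \<in> finite_pseudolines A" "\<exists>D. adjacent_along A (side_lines y C) C D \<and> y = f D"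
proof -
  have "\<exists>L. L \<in> finite_pseudolines A \<and> (\<exists>D. adjacent_along A L C D \<and> y = f D)"
    using nbrs_dual[OF assms] by blast
  from someI_ex[OF this]
  show "side_lines y C \<in> finite_pseudolines A" "\<exists>D. adjacent_along A (side_lines y C) C D \<and> y = f D"
    unfolding side_lines_def by blast+
qed

lemma side_lines_inj:
  assumes "triangle_cell A C a b c h k L M N"
  shows "inj_on (\<lambda>y. side_lines y C) (nbrs (f C))"
    "(\<lambda>y. side_lines y C) ` nbrs (f C) \<subseteq> {L, M, N} - {line_at_infinity}"
proof -
  interpret triangle_cell A C a b c h k L M N by (rule assms)
  have sl: "side_lines y C \<in> A" if "y \<in> nbrs (f C)" for y
    using side_lines(1)[OF C that] by (simp add: finite_pseudolines_def)
  show "inj_on (\<lambda>y. side_lines y C) (nbrs (f C))"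
  proof (rule inj_onI)
    fix y z assume yz: "y \<in> nbrs (f C)" "z \<in> nbrs (f C)" "side_lines y C = side_lines z C"
    obtain D where D: "adjacent_along A (side_lines y C) C D" "y = f D" using side_lines(2)[OF C yz(1)] by blast
    obtain D' where D': "adjacent_along A (side_lines z C) C D'" "z = f D'" using side_lines(2)[OF C yz(2)] by blast
    have "D = D'" using adjacent_unique[OF sl[OF yz(1)] D(1)] D'(1) yz(3) by simp
    then show "y = z" using D D' by simp
  qed
  show "(\<lambda>y. side_lines y C) ` nbrs (f C) \<subseteq> {L, M, N} - {line_at_infinity}"
  proof
    fix L' assume "L' \<in> (\<lambda>y. side_lines y C) ` nbrs (f C)"
    then obtain y where y: "y \<in> nbrs (f C)" "L' = side_lines y C" by blast
    then have "L' = L \<or> L' = M \<or> L' = N" using adjacent_side[OF sl] side_lines(2)[OF C] by blast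
    then show "L' \<in> {L, M, N} - {line_at_infinity}"
      using side_lines(1)[OF C y(1)] y(2) by (simp add: finite_pseudolines_def)
  qed
qed

lemma nbrs_le_sides:
  assumes "triangle_cell A C a b c h k L M N"
  shows "card (nbrs (f C)) \<le> card ({L, M, N} - {line_at_infinity})"
  using card_inj_on_le[OF side_lines_inj[OF assms]] by simp

lemma crossings_at_triangle:
  assumes "triangle_cell A C a b c h k L M N"
  shows "crossings_at C = {h a, h b, h c} - line_at_infinity"
proof -
  interpret triangle_cell A C a b c h k L M N by (rule assms)
  have "p \<in> crossings_at C \<Longrightarrow> p \<in> {h a, h b, h c} - line_at_infinity" for p
    using crossing_corner[of p] unfolding crossings_at_def finite_crossings_def by blast
  moreover have "p \<in> crossings_at C" if "p \<in> {h a, h b, h c} - line_at_infinity" for p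
  proof -
    have "\<exists>L\<in>A. \<exists>M\<in>A. L \<noteq> M \<and> p \<in> L \<inter> M" using that corner_images LMN by blast
    moreover have "p \<in> closure C" using that corner_images by blast
    ultimately show ?thesis using that unfolding crossings_at_def finite_crossings_def by blast
  qed
  ultimately show ?thesis by blast
qed

text \<open>The only finite crossing is the corner opposite to the side at infinity.\<close>

lemma degree_side_at_infinity:
  assumes tri: "triangle_cell A C a b c h k L M line_at_infinity"
  shows "f C \<in> corners P" "card (nbrs (f C)) = 2"
proof -
  interpret triangle_cell A C a b c h k L M line_at_infinity by (rule tri)
  have "h b \<notin> line_at_infinity"
    using meet_once[of M line_at_infinity "h b" "h c"] corner_images LMN by blast
  then have "crossings_at C = {h b}" using crossings_at_triangle[OF tri] corner_images by auto
  then have "card (tiles_at (f C)) = 1" using tiles_at_dual[OF C] by simp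
  then obtain Q where Q: "tiles_at (f C) = {Q}" by (auto simp: card_1_singleton_iff)
  have "{L, M, line_at_infinity} - {line_at_infinity} = {L, M}" using LMN by auto
  then have le: "card (nbrs (f C)) \<le> 2" using nbrs_le_sides[OF tri] LMN by simp
  then show "f C \<in> corners P" using single_tile_corner[OF f_vert[OF C] Q] by blast
  show "card (nbrs (f C)) = 2" using le two_nbrs[of Q "f C"] Q by simp
qed

text \<open>Three crossings give three tiles and hence at least three edges, while three sides allow at most three.\<close>

lemma degree_bounded:
  assumes tri: "triangle_cell A C a b c h k L M N" and fin: "line_at_infinity \<notin> {L, M, N}"
    and out: "h a \<notin> line_at_infinity" "h b \<notin> line_at_infinity" "h c \<notin> line_at_infinity"
  shows "f C \<notin> corners P" "card (nbrs (f C)) = 3"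
proof -
  interpret triangle_cell A C a b c h k L M N by (rule tri)
  have "crossings_at C = {h a, h b, h c}" using crossings_at_triangle[OF tri] out by auto
  then have t3: "card (tiles_at (f C)) = 3" using tiles_at_dual[OF C] corner_images(7-9) by auto
  then obtain Q1 Q2 where "Q1 \<in> tiles_at (f C)" "Q2 \<in> tiles_at (f C)" "Q1 \<noteq> Q2"
    by (auto simp: card_Suc_eq numeral_3_eq_3)
  then have "card (nbrs (f C)) \<ge> 3" by (rule three_nbrs)
  moreover have "{L, M, N} - {line_at_infinity} = {L, M, N}" using fin by auto
  then have "card (nbrs (f C)) \<le> 3" using nbrs_le_sides[OF tri] LMN by simp
  ultimately show n3: "card (nbrs (f C)) = 3" by simp
  show "f C \<notin> corners P" using three_tiles_not_corner[OF _ t3 n3] by blast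
qed

text \<open>The two sides that meet at infinity have parallel dual edges. They are different unit edges at the
  same vertex, hence opposite, and the vertex is the midpoint between two others.\<close>

lemma degree_corner_at_infinity:
  assumes tri: "triangle_cell A C a b c h k L M N" and fin: "line_at_infinity \<notin> {L, M, N}"
    and out: "h b \<in> line_at_infinity"
  shows "f C \<notin> corners P" "card (nbrs (f C)) = 3"
proof -
  interpret triangle_cell A C a b c h k L M N by (rule tri)
  have "h a \<notin> line_at_infinity"
    using meet_once[of L line_at_infinity "h a" "h b"] corner_images LMN inf fin out by blast
  moreover have "h c \<notin> line_at_infinity"
    using meet_once[of M line_at_infinity "h b" "h c"] corner_images LMN inf fin out by blast
  ultimately have "crossings_at C = {h a, h c}" using crossings_at_triangle[OF tri] out by auto
  then have "card (tiles_at (f C)) = 2" using tiles_at_dual[OF C] corner_images(9) by auto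
  then obtain Q1 Q2 where "Q1 \<in> tiles_at (f C)" "Q2 \<in> tiles_at (f C)" "Q1 \<noteq> Q2"
    by (auto simp: card_Suc_eq numeral_2_eq_2)
  then have "card (nbrs (f C)) \<ge> 3" by (rule three_nbrs)
  moreover have lines: "{L, M, N} - {line_at_infinity} = {L, M, N}" using fin by auto
  then have "card (nbrs (f C)) \<le> 3" using nbrs_le_sides[OF tri] LMN by simp
  ultimately show n3: "card (nbrs (f C)) = 3" by simp
  have "(\<lambda>y. side_lines y C) ` nbrs (f C) = {L, M, N}"
    using side_lines_inj[OF tri] n3 LMN unfolding lines by (intro card_subset_eq) (auto simp: card_image)
  then obtain y z where yz: "y \<in> nbrs (f C)" "side_lines y C = L" "z \<in> nbrs (f C)" "side_lines z C = M"
    by (metis (no_types, lifting) imageE insertCI)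
  then have "y \<noteq> z" using LMN by auto
  obtain D where D: "adjacent_along A L C D" "y = f D" using side_lines(2)[OF C yz(1)] yz(2) by blast
  obtain D' where D': "adjacent_along A M C D'" "z = f D'" using side_lines(2)[OF C yz(3)] yz(4) by blast
  have "L \<inter> M \<inter> line_at_infinity \<noteq> {}" using corner_images out by blast
  moreover have "L \<in> finite_pseudolines A" "M \<in> finite_pseudolines A"
    using LMN fin by (auto simp: finite_pseudolines_def)
  ultimately have col: "collinear {0, y - f C, z - f C}" using parallel D D' by blast
  have e: "{f C, y} \<in> edges T" "{f C, z} \<in> edges T" using yz by (auto simp: nbrs_def)
  have n: "norm (y - f C) = 1" "norm (z - f C) = 1" using edge_verts e by auto
  have "wedge (y - f C) (z - f C) = 0"
  proof (rule ccontr)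
    assume "wedge (y - f C) (z - f C) \<noteq> 0"
    then have "wedge ((y - f C) - 0) ((z - f C) - 0) \<noteq> 0" by simp
    then show False using not_collinear_wedge col by blast
  qed
  then have "z - f C = y - f C \<or> z - f C = - (y - f C)" using wedge_eq_0_unit n by blast
  then have op: "z - f C = - (y - f C)" using \<open>y \<noteq> z\<close> by auto
  have "f C = (1 - 1/2) *\<^sub>R y + (1/2) *\<^sub>R z" using op by (simp add: complex_eq_iff field_simps)
  then have "f C \<in> open_segment y z" using \<open>y \<noteq> z\<close> unfolding in_segment
    by (intro conjI exI[of _ "1/2"]) auto
  moreover have "y \<in> P" "z \<in> P" using e edge_verts verts_P by auto
  ultimately show "f C \<notin> corners P" using extreme_point_of_open_segment by (metis corners_def mem_Collect_eq)
qed

theorem vertex_degree_dual: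
  assumes "v \<in> verts T"
  shows "vertex_degree T v = (if v \<in> corners P then 2 else 3)"
proof -
  obtain C where C: "C \<in> cells A" "v = f C" using assms f by (auto simp: bij_betw_def)
  obtain a b c h k L M N where tri: "triangle_cell A C a b c h k L M N" using cell_triangle[OF C(1)] by blast
  note tri1 = triangle_cell.rotate[OF tri]
  note tri2 = triangle_cell.rotate[OF tri1]
  have deg: "vertex_degree T v = card (nbrs (f C))" using vertex_degree_nbrs C by simp
  consider "L = line_at_infinity" | "M = line_at_infinity" | "N = line_at_infinity" | "line_at_infinity \<notin> {L, M, N}" by auto
  then show ?thesis
  proof cases
    case 1
    show ?thesis using degree_side_at_infinity[OF tri1[unfolded 1]] deg C by simp
  next
    case 2
    show ?thesis using degree_side_at_infinity[OF tri2[unfolded 2]] deg C by simp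
  next
    case 3
    show ?thesis using degree_side_at_infinity[OF tri[unfolded 3]] deg C by simp
  next
    case 4
    have "f C \<notin> corners P \<and> card (nbrs (f C)) = 3"
    proof (cases "h a \<in> line_at_infinity \<or> h b \<in> line_at_infinity \<or> h c \<in> line_at_infinity")
      case True
      then show ?thesis
        using degree_corner_at_infinity[OF tri 4] degree_corner_at_infinity[OF tri1]
          degree_corner_at_infinity[OF tri2] 4 by auto
    next
      case False
      then show ?thesis using degree_bounded[OF tri 4] by blast
    qed
    then show ?thesis using deg C by simp
  qed
qed

end

lemma dual_tiling_locale:
  assumes "zonotopal_tiling P T" "pseudoline_arrangement A" "simplicial A" "line_at_infinity \<in> A" "dual_tiling T A"
  shows "\<exists>f g. dual_to_arrangement P T A f g"
proof -
  from assms(5) show ?thesis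
    unfolding dual_tiling_def
  proof (elim exE conjE)
    fix f g
    assume f: "bij_betw f (cells A) (verts T)"
      and e: "edges T = {{f C, f D} | C D. \<exists>L\<in>finite_pseudolines A. adjacent_along A L C D}"
      and p: "\<forall>L\<in>finite_pseudolines A. \<forall>L'\<in>finite_pseudolines A. \<forall>C D C' D'.
        L \<inter> L' \<inter> line_at_infinity \<noteq> {} \<longrightarrow>
        adjacent_along A L C D \<longrightarrow> adjacent_along A L' C' D' \<longrightarrow>
        collinear {0, f D - f C, f D' - f C'}"
      and g: "bij_betw g (finite_crossings A) (bounded_faces T)"
      and gv: "\<forall>p\<in>finite_crossings A. verts T \<inter> frontier (g p) = f ` {C \<in> cells A. p \<in> closure C}"
    have "dual_to_arrangement P T A f g"
    proof
      fix L L' C D C' D'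
      assume "L \<in> finite_pseudolines A" "L' \<in> finite_pseudolines A" "L \<inter> L' \<inter> line_at_infinity \<noteq> {}"
        "adjacent_along A L C D" "adjacent_along A L' C' D'"
      then show "collinear {0, f D - f C, f D' - f C'}" using p by simp
    next
      fix q assume "q \<in> finite_crossings A"
      then show "verts T \<inter> frontier (g q) = f ` {C \<in> cells A. q \<in> closure C}" using gv by simp
    qed (fact assms f e g)+
    then show ?thesis by blast
  qed
qed

section \<open>Planarity of the glued graph\<close>

context tiling
begin

text \<open>An edge exists, and the polygon has points on at least one side of it.\<close>

lemma tile_exists: "\<exists>Q. tile T Q"
proof -
  obtain i where i: "i \<in> interior P" using P_interior by blast
  have "corners P \<noteq> {}"
  proof
    assume "corners P = {}"
    then have "P = {}" using Krein_Milman_Minkowski[OF P_compact P_convex] by (simp add: corners_def)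
    then show False using i by simp
  qed
  then obtain v where v: "v \<in> corners P" by blast
  then have vv: "v \<in> verts T" using corners_P_verts by blast
  have "v \<noteq> i" using v i extreme_point_not_in_interior by (auto simp: corners_def)
  then have "(i - v) \<bullet> (i - v) > 0" by simp
  then have "(i - v) \<bullet> v < (i - v) \<bullet> i" by (simp add: inner_diff_right)
  then obtain y where y: "{v, y} \<in> edges T" using ascend[OF vv] i interior_subset by blast
  then have y': "{y, v} \<in> edges T" "y - v \<noteq> 0" using edge_verts(3) by (auto simp: insert_commute)
  show ?thesis
  proof (cases "\<forall>t\<in>P. wedge (y - v) (t - v) \<ge> 0")
    case True
    then have "wedge (y - v) (i - v) > 0" using interior_wedge_pos[OF _ y'(2) i] by blast
    then show ?thesis using side_tile[OF y] i interior_subset by blast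
  next
    case False
    then obtain t where t: "t \<in> P" "wedge (y - v) (t - v) < 0" by (auto simp: not_le)
    then have "wedge (v - y) (t - y) > 0" by (simp add: wedge_def algebra_simps)
    then show ?thesis using side_tile[OF y'(1) t(1)] by blast
  qed
qed

end

text \<open>A homeomorphism to the unit disc is corrected, without changing it on the circle, so that a given
  interior point goes to the centre. The inversion in the circle, scaled by two, then gives the outer copy.\<close>

lemma disc_model:
  fixes P :: "complex set"
  assumes P: "convex P" "compact P" and z: "z \<in> interior P"
  shows "\<exists>(h :: complex \<Rightarrow> complex) \<psi>. continuous_on P h \<and> inj_on h P \<and> (\<forall>x\<in>P. norm (h x) \<le> 1) \<and>
    continuous_on (P - {z}) \<psi> \<and> inj_on \<psi> (P - {z}) \<and> (\<forall>x\<in>P - {z}. norm (\<psi> x) \<ge> 2) \<and>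
    (\<forall>p\<in>P - interior P. norm (h p) = 1 \<and> \<psi> p = 2 *\<^sub>R h p)"
proof -
  have "interior P \<noteq> {}" using z by blast
  then have "P homeomorphic cball (0::complex) 1" using P by (intro homeomorphic_convex_compact_cball) auto
  then obtain h k where hk: "homeomorphism P (cball (0::complex) 1) h k"
    unfolding homeomorphic_def by blast
  then have h: "continuous_on P h" "h ` P = cball 0 1" "\<forall>x\<in>P. k (h x) = x"
    "continuous_on (cball 0 1) k" "k ` cball 0 1 = P" "\<forall>y\<in>cball 0 1. h (k y) = y"
    unfolding homeomorphism_def by blast+
  have inj: "inj_on h P" using h(3) by (metis inj_onI)
  have injk: "inj_on k (cball 0 1)" using h(6) by (metis inj_onI)
  have bnd: "norm (h x) \<le> 1" if "x \<in> P" for x using h(2) that by auto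
  have "open (h ` interior P)"
    by (rule invariance_of_domain[OF continuous_on_subset[OF h(1) interior_subset] open_interior
          inj_on_subset[OF inj interior_subset]])
  moreover have "h ` interior P \<subseteq> cball 0 1" using h(2) interior_subset by blast
  ultimately have "h ` interior P \<subseteq> ball 0 1" using interior_maximal[of "h ` interior P" "cball 0 1"] by simp
  then have hz: "h z \<in> ball 0 1" using z by blast
  have bd: "norm (h p) = 1" if p: "p \<in> P - interior P" for p
  proof (rule ccontr)
    assume "norm (h p) \<noteq> 1"
    then have hp: "h p \<in> ball 0 1" using bnd[of p] p by auto
    have "open (k ` ball 0 1)"
      by (rule invariance_of_domain[OF continuous_on_subset[OF h(4) ball_subset_cball] open_ball
            inj_on_subset[OF injk ball_subset_cball]])
    moreover have "k ` ball 0 1 \<subseteq> P" using h(5) by auto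
    ultimately have "k ` ball 0 1 \<subseteq> interior P" by (rule interior_maximal[rotated])
    moreover have "p \<in> k ` ball 0 1" using hp h(3) p by (metis DiffD1 imageI)
    ultimately show False using p by blast
  qed
  have aff: "affine hull (ball (0::complex) 1) = UNIV" by (intro affine_hull_open) auto
  obtain m m' where m: "homeomorphism (cball (0::complex) 1) (cball 0 1) m m'" "m (h z) = 0"
      "{x. \<not> (m x = x \<and> m' x = x)} \<subseteq> ball 0 1"
    by (rule homeomorphism_moving_point[of "ball (0::complex) 1" "cball 0 1" "h z" 0])
      (use aff hz in \<open>auto simp: connected_ball\<close>)
  have mc: "continuous_on (cball 0 1) m" "m ` cball 0 1 = cball 0 1" "\<forall>x\<in>cball 0 1. m' (m x) = x"
    using m(1) unfolding homeomorphism_def by blast+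
  have injm: "inj_on m (cball 0 1)" using mc(3) by (metis inj_onI)
  define g where "g x = m (h x)" for x
  have hP: "h x \<in> cball 0 1" if "x \<in> P" for x using bnd that by simp
  have gc: "continuous_on P g" unfolding g_def
    by (rule continuous_on_compose2[OF mc(1) h(1)]) (use h in auto)
  have ginj: "x = y" if "x \<in> P" "y \<in> P" "g x = g y" for x y
    using that injm inj hP unfolding g_def inj_on_def by blast
  have gz: "g z = 0" using m by (simp add: g_def)
  have zP: "z \<in> P" using z interior_subset by blast
  have g0: "g x \<noteq> 0" if "x \<in> P - {z}" for x using ginj[of x z] that gz zP by auto
  have g1: "norm (g x) \<le> 1" if "x \<in> P" for x using mc(2) hP[OF that] unfolding g_def by auto
  have gbd: "g p = h p" if p: "p \<in> P - interior P" for p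
  proof -
    have "h p \<notin> ball 0 1" using bd[OF p] by simp
    then show ?thesis using m(3) unfolding g_def by blast
  qed
  define \<psi> where "\<psi> x = (2 / (norm (g x))\<^sup>2) *\<^sub>R g x" for x
  have n\<psi>: "norm (\<psi> x) = 2 / norm (g x)" for x
    by (simp add: \<psi>_def power2_eq_square)
  have "continuous_on (P - {z}) \<psi>" unfolding \<psi>_def
    by (intro continuous_intros continuous_on_subset[OF gc]) (use g0 in auto)
  moreover have "inj_on \<psi> (P - {z})"
  proof (rule inj_onI)
    fix x y assume xy: "x \<in> P - {z}" "y \<in> P - {z}" "\<psi> x = \<psi> y"
    have n0: "norm (g x) > 0" "norm (g y) > 0" using g0 xy by auto
    have "2 / norm (g x) = 2 / norm (g y)" using n\<psi> xy(3) by metis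
    then have "norm (g x) = norm (g y)" using n0 by (simp add: field_simps)
    then have "g x = g y" using xy(3) n0 by (simp add: \<psi>_def)
    then show "x = y" using ginj xy by blast
  qed
  moreover have "norm (\<psi> x) \<ge> 2" if x: "x \<in> P - {z}" for x
  proof -
    have "norm (g x) > 0" "norm (g x) \<le> 1" using g0[OF x] g1 x by auto
    then show ?thesis unfolding n\<psi> by (simp add: field_simps)
  qed
  moreover have "norm (h p) = 1 \<and> \<psi> p = 2 *\<^sub>R h p" if p: "p \<in> P - interior P" for p
    using bd[OF p] gbd[OF p] by (simp add: \<psi>_def)
  ultimately show ?thesis using h(1) inj bnd by blast
qed

lemma simple_edge:
  assumes "simple_graph G" "e \<in> edges G"
  shows "\<exists>u v. e = {u, v} \<and> u \<in> verts G \<and> v \<in> verts G \<and> u \<noteq> v"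
  using bspec[OF assms(1)[unfolded simple_graph_def] assms(2)] by blast

lemma planar_drawing_simple: "planar_drawing T \<Longrightarrow> simple_graph T"
  by (simp add: planar_drawing_def)

lemma planar_drawing_segments:
  assumes "planar_drawing T" "{a, b} \<in> edges T"
  shows "a \<in> verts T" "b \<in> verts T" "a \<noteq> b" "closed_segment a b \<inter> verts T = {a, b}"
    "closed_segment a b \<subseteq> drawn T"
    "{c, d} \<in> edges T \<Longrightarrow> {a, b} \<noteq> {c, d} \<Longrightarrow> closed_segment a b \<inter> closed_segment c d = {a, b} \<inter> {c, d}"
proof -
  obtain u v where "{a, b} = {u, v}" "u \<in> verts T" "v \<in> verts T" "u \<noteq> v"
    using simple_edge[OF planar_drawing_simple[OF assms(1)] assms(2)] by metis
  then show "a \<in> verts T" "b \<in> verts T" "a \<noteq> b" by (auto simp: doubleton_eq_iff)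
  show "closed_segment a b \<inter> verts T = {a, b}"
    using assms by (simp add: planar_drawing_def segment_convex_hull)
  show "closed_segment a b \<subseteq> drawn T" using assms by (auto simp: drawn_def segment_convex_hull)
  show "{c, d} \<in> edges T \<Longrightarrow> {a, b} \<noteq> {c, d} \<Longrightarrow> closed_segment a b \<inter> closed_segment c d = {a, b} \<inter> {c, d}"
    using assms by (simp add: planar_drawing_def segment_convex_hull)
qed

lemma arc_image:
  assumes "arc g" "path_image g \<subseteq> S" "continuous_on S f" "inj_on f S"
  shows "arc (f \<circ> g)"
proof -
  have "path (f \<circ> g)"
    using assms by (intro path_continuous_image continuous_on_subset[OF assms(3)]) (auto simp: arc_def)
  moreover have "inj_on (f \<circ> g) {0..1}"
    using assms(1,2) inj_on_subset[OF assms(4)] by (intro comp_inj_on) (auto simp: arc_def path_image_def)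
  ultimately show ?thesis by (simp add: arc_def)
qed

lemma inj_on_image_Int_eq:
  "inj_on f A \<Longrightarrow> X \<subseteq> A \<Longrightarrow> Y \<subseteq> A \<Longrightarrow> f ` X \<inter> f ` Y = f ` (X \<inter> Y)"
  using inj_on_image_Int by metis

text \<open>The first drawing lies in the unit disc, the second one outside the disc of radius two, and the
  radial segments between them meet the drawings only in corners. The inversion is centred at a point that is
  not drawn.\<close>

theorem planar_join:
  assumes P: "convex P" "compact P" and z: "z \<in> interior P" "z \<notin> drawn R"
    and T: "planar_drawing T" "drawn T \<subseteq> P" "corners P \<subseteq> verts T"
    and R: "planar_drawing R" "drawn R \<subseteq> P" "corners P \<subseteq> verts R"
    and simple: "simple_graph (join_at_corners P T R)"
  shows "planar (join_at_corners P T R)"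
proof -
  let ?G = "join_at_corners P T R"
  obtain h \<psi> :: "complex \<Rightarrow> complex" where h: "continuous_on P h" "inj_on h P" "\<forall>x\<in>P. norm (h x) \<le> 1"
    and \<psi>: "continuous_on (P - {z}) \<psi>" "inj_on \<psi> (P - {z})" "\<forall>x\<in>P - {z}. norm (\<psi> x) \<ge> 2"
    and bd: "\<forall>p\<in>P - interior P. norm (h p) = 1 \<and> \<psi> p = 2 *\<^sub>R h p"
    using disc_model[OF P z(1)] by blast
  have dR: "drawn R \<subseteq> P - {z}" using R z by blast
  have vT: "v \<in> verts T \<Longrightarrow> v \<in> P" for v using T(2) by (auto simp: drawn_def)
  have vR: "v \<in> verts R \<Longrightarrow> v \<in> P - {z}" for v using dR by (auto simp: drawn_def)
  have corner: "norm (h p) = 1" "\<psi> p = 2 *\<^sub>R h p" "p \<in> verts T" "p \<in> verts R" if "p \<in> corners P" for p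
  proof -
    have "p \<in> P - interior P" using that extreme_point_not_in_interior
      by (auto simp: corners_def extreme_point_of_def)
    then show "norm (h p) = 1" "\<psi> p = 2 *\<^sub>R h p" using bd by auto
    show "p \<in> verts T" "p \<in> verts R" using that T R by auto
  qed
  define pos where "pos = case_sum h \<psi>"
  have pos [simp]: "pos (Inl x) = h x" "pos (Inr x) = \<psi> x" for x by (simp_all add: pos_def)
  have vG: "verts ?G = Inl ` verts T \<union> Inr ` verts R" by (auto simp: join_at_corners_def)
  have posG: "pos ` verts ?G = h ` verts T \<union> \<psi> ` verts R" unfolding vG by (auto simp: image_Un image_image)
  define radial where "radial p = closed_segment (h p) (2 *\<^sub>R h p)" for p
  have radialE: "\<exists>r. 1 \<le> r \<and> r \<le> 2 \<and> y = r *\<^sub>R h p \<and> norm y = r" if y: "y \<in> radial p" and p: "p \<in> corners P" for y p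
  proof -
    obtain u where u: "0 \<le> u" "u \<le> 1" "y = (1 - u) *\<^sub>R h p + u *\<^sub>R (2 *\<^sub>R h p)"
      using y by (auto simp: radial_def in_segment)
    have "y = ((1 - u) + u * 2) *\<^sub>R h p" unfolding u(3) by (simp only: scaleR_add_left scaleR_scaleR)
    then have "y = (1 + u) *\<^sub>R h p" by simp
    then show ?thesis using u corner(1)[OF p] by (intro exI[of _ "1 + u"]) auto
  qed
  have ends: "h p \<in> radial p" "\<psi> p \<in> radial p" if "p \<in> corners P" for p
    using corner[OF that] by (auto simp: radial_def)
  have rad_T: "y = h p \<and> x = p" if a: "y \<in> radial p" "p \<in> corners P" "y = h x" "x \<in> P" for y p x
  proof -
    obtain r where r: "1 \<le> r" "y = r *\<^sub>R h p" "norm y = r" using radialE[OF a(1,2)] by blast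
    have "norm y \<le> 1" using h(3) a by simp
    then have "y = h p" using r by simp
    then show ?thesis using a h(2) vT corner(3) by (auto simp: inj_on_def)
  qed
  have rad_R: "y = \<psi> p \<and> x = p" if a: "y \<in> radial p" "p \<in> corners P" "y = \<psi> x" "x \<in> P - {z}" for y p x
  proof -
    obtain r where r: "r \<le> 2" "y = r *\<^sub>R h p" "norm y = r" using radialE[OF a(1,2)] by blast
    have "norm y \<ge> 2" using \<psi>(3) a by simp
    then have "y = \<psi> p" using r corner(2)[OF a(2)] by simp
    moreover have "p \<in> P - {z}" using vR corner(4)[OF a(2)] by blast
    ultimately show ?thesis using a(3,4) \<psi>(2) unfolding inj_on_def by metis
  qed
  have hpsi: "h x \<noteq> \<psi> y" if "x \<in> P" "y \<in> P - {z}" for x y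
    using h(3) \<psi>(3) that by force
  note segT = planar_drawing_segments[OF T(1)] and segR = planar_drawing_segments[OF R(1)]
  have sT: "closed_segment a b \<subseteq> P" if "{a, b} \<in> edges T" for a b using segT(5)[OF that] T(2) by blast
  have sR: "closed_segment a b \<subseteq> P - {z}" if "{a, b} \<in> edges R" for a b using segR(5)[OF that] dR by blast
  have edge_cases: "(\<exists>a b. e = {Inl a, Inl b} \<and> {a, b} \<in> edges T) \<or> (\<exists>a b. e = {Inr a, Inr b} \<and> {a, b} \<in> edges R) \<or>
    (\<exists>p. e = {Inl p, Inr p} \<and> p \<in> corners P)" if eG: "e \<in> edges ?G" for e
  proof -
    have T': "\<exists>a b. Inl ` e' = {Inl a, Inl b} \<and> {a, b} \<in> edges T" if e': "e' \<in> edges T" for e'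
    proof -
      obtain a b where "e' = {a, b}" using simple_edge[OF planar_drawing_simple[OF T(1)] e'] by metis
      then show ?thesis using e' by (intro exI[of _ a] exI[of _ b]) simp
    qed
    have R': "\<exists>a b. Inr ` e' = {Inr a, Inr b} \<and> {a, b} \<in> edges R" if e': "e' \<in> edges R" for e'
    proof -
      obtain a b where "e' = {a, b}" using simple_edge[OF planar_drawing_simple[OF R(1)] e'] by metis
      then show ?thesis using e' by (intro exI[of _ a] exI[of _ b]) simp
    qed
    show ?thesis using eG T' R' unfolding join_at_corners_def by auto
  qed
  define img where "img e = (if Inr -` e = {} then h ` (convex hull (Inl -` e))
    else if Inl -` e = {} then \<psi> ` (convex hull (Inr -` e)) else \<Union> (radial ` (Inl -` e)))" for e :: "(complex + complex) set"
  have vim: "Inl -` {Inl a, Inl b} = {a, b}" "Inr -` {Inl a, Inl b} = {}" "Inr -` {Inr a, Inr b} = {a, b}"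
    "Inl -` {Inr a, Inr b} = {}" "Inl -` {Inl a, Inr b} = {a}" "Inr -` {Inl a, Inr b} = {b}" for a b :: complex
    by auto
  have img: "img {Inl a, Inl b} = h ` closed_segment a b" "img {Inr a, Inr b} = \<psi> ` closed_segment a b"
    "img {Inl p, Inr p} = radial p" for a b p
    unfolding img_def vim by (simp_all add: segment_convex_hull)
  have arcs: "\<exists>\<gamma>. arc \<gamma> \<and> {pathstart \<gamma>, pathfinish \<gamma>} = pos ` e \<and> path_image \<gamma> = img e" if e: "e \<in> edges ?G" for e
    using edge_cases[OF e]
  proof (elim disjE exE conjE)
    fix a b assume ab: "e = {Inl a, Inl b}" "{a, b} \<in> edges T"
    have "arc (h \<circ> linepath a b)"
      using segT(3)[OF ab(2)] sT[OF ab(2)] by (intro arc_image[OF _ _ h(1,2)]) auto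
    then show ?thesis unfolding ab(1) img
      by (intro exI[of _ "h \<circ> linepath a b"]) (simp add: pathstart_compose pathfinish_compose path_image_compose)
  next
    fix a b assume ab: "e = {Inr a, Inr b}" "{a, b} \<in> edges R"
    have "arc (\<psi> \<circ> linepath a b)"
      using segR(3)[OF ab(2)] sR[OF ab(2)] by (intro arc_image[OF _ _ \<psi>(1,2)]) auto
    then show ?thesis unfolding ab(1) img
      by (intro exI[of _ "\<psi> \<circ> linepath a b"]) (simp add: pathstart_compose pathfinish_compose path_image_compose)
  next
    fix p assume p: "e = {Inl p, Inr p}" "p \<in> corners P"
    have "h p \<noteq> 2 *\<^sub>R h p"
    proof
      assume "h p = 2 *\<^sub>R h p"
      then have "norm (h p) = norm (2 *\<^sub>R h p)" by (rule arg_cong)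
      then show False using corner(1)[OF p(2)] by simp
    qed
    then show ?thesis unfolding p(1) img using corner(2)[OF p(2)]
      by (intro exI[of _ "linepath (h p) (2 *\<^sub>R h p)"]) (auto simp: radial_def)
  qed
  have meet_verts: "img e \<inter> pos ` verts ?G = pos ` e" if e: "e \<in> edges ?G" for e
    using edge_cases[OF e]
  proof (elim disjE exE conjE)
    fix a b assume ab: "e = {Inl a, Inl b}" "{a, b} \<in> edges T"
    have "h ` closed_segment a b \<inter> h ` verts T = h ` {a, b}"
      using inj_on_image_Int_eq[OF h(2) sT[OF ab(2)], of "verts T"] segT(4)[OF ab(2)] vT by auto
    moreover have "h ` closed_segment a b \<inter> \<psi> ` verts R = {}" using hpsi sT[OF ab(2)] vR by blast
    ultimately show ?thesis unfolding posG ab(1) img by (auto simp: Int_Un_distrib)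
  next
    fix a b assume ab: "e = {Inr a, Inr b}" "{a, b} \<in> edges R"
    have "\<psi> ` closed_segment a b \<inter> \<psi> ` verts R = \<psi> ` {a, b}"
      using inj_on_image_Int_eq[OF \<psi>(2) sR[OF ab(2)], of "verts R"] segR(4)[OF ab(2)] vR by auto
    moreover have "\<psi> ` closed_segment a b \<inter> h ` verts T = {}"
    proof -
      have "\<psi> x \<noteq> h y" if "x \<in> closed_segment a b" "y \<in> verts T" for x y
        using hpsi[OF vT[OF that(2)]] sR[OF ab(2)] that(1) by (metis subsetD)
      then show ?thesis by blast
    qed
    ultimately show ?thesis unfolding posG ab(1) img by (auto simp: Int_Un_distrib)
  next
    fix p assume p: "e = {Inl p, Inr p}" "p \<in> corners P"
    have "radial p \<inter> h ` verts T = {h p}" using rad_T[OF _ p(2)] vT ends[OF p(2)] corner(3)[OF p(2)] by blast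
    moreover have "radial p \<inter> \<psi> ` verts R = {\<psi> p}" using rad_R[OF _ p(2)] vR ends[OF p(2)] corner(4)[OF p(2)] by blast
    ultimately show ?thesis unfolding posG p(1) img by (auto simp: Int_Un_distrib)
  qed
  have TT: "h ` closed_segment a b \<inter> h ` closed_segment c d = h ` ({a, b} \<inter> {c, d})"
    if "{a, b} \<in> edges T" "{c, d} \<in> edges T" "{a, b} \<noteq> {c, d}" for a b c d
    using inj_on_image_Int_eq[OF h(2) sT[OF that(1)] sT[OF that(2)]] segT(6)[OF that] by simp
  have RR: "\<psi> ` closed_segment a b \<inter> \<psi> ` closed_segment c d = \<psi> ` ({a, b} \<inter> {c, d})"
    if "{a, b} \<in> edges R" "{c, d} \<in> edges R" "{a, b} \<noteq> {c, d}" for a b c d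
    using inj_on_image_Int_eq[OF \<psi>(2) sR[OF that(1)] sR[OF that(2)]] segR(6)[OF that] by simp
  have TR: "h ` closed_segment a b \<inter> \<psi> ` closed_segment c d = {}"
    if "{a, b} \<in> edges T" "{c, d} \<in> edges R" for a b c d
    using hpsi sT[OF that(1)] sR[OF that(2)] by blast
  have CT: "radial p \<inter> h ` closed_segment a b = h ` ({p} \<inter> {a, b})"
    if p: "p \<in> corners P" and ab: "{a, b} \<in> edges T" for p a b
  proof -
    have "p \<in> closed_segment a b \<Longrightarrow> p \<in> {a, b}" using segT(4)[OF ab] corner(3)[OF p] by blast
    then have "radial p \<inter> h ` closed_segment a b \<subseteq> h ` ({p} \<inter> {a, b})"
      using rad_T[OF _ p] sT[OF ab] by blast
    moreover have "h ` ({p} \<inter> {a, b}) \<subseteq> radial p \<inter> h ` closed_segment a b" using ends[OF p] by auto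
    ultimately show ?thesis by blast
  qed
  have CR: "radial p \<inter> \<psi> ` closed_segment a b = \<psi> ` ({p} \<inter> {a, b})"
    if p: "p \<in> corners P" and ab: "{a, b} \<in> edges R" for p a b
  proof -
    have "p \<in> closed_segment a b \<Longrightarrow> p \<in> {a, b}" using segR(4)[OF ab] corner(4)[OF p] by blast
    then have "radial p \<inter> \<psi> ` closed_segment a b \<subseteq> \<psi> ` ({p} \<inter> {a, b})"
      using rad_R[OF _ p] sR[OF ab] by blast
    moreover have "\<psi> ` ({p} \<inter> {a, b}) \<subseteq> radial p \<inter> \<psi> ` closed_segment a b" using ends[OF p] by auto
    ultimately show ?thesis by blast
  qed
  have CC: "radial p \<inter> radial q = {}" if p: "p \<in> corners P" "q \<in> corners P" "p \<noteq> q" for p q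
  proof (rule ccontr)
    assume "radial p \<inter> radial q \<noteq> {}"
    then obtain y where y: "y \<in> radial p" "y \<in> radial q" by blast
    obtain r s where rs: "1 \<le> r" "y = r *\<^sub>R h p" "norm y = r" "y = s *\<^sub>R h q" "norm y = s"
      using radialE[OF y(1) p(1)] radialE[OF y(2) p(2)] by blast
    then have "r *\<^sub>R h p = r *\<^sub>R h q" "r \<noteq> 0" by auto
    then have "h p = h q" by simp
    then show False using h(2) vT corner(3) p by (metis inj_onD)
  qed
  have set_eqs: "{Inl a, Inl b} \<inter> {Inl c, Inl d} = Inl ` ({a, b} \<inter> {c, d})"
    "{Inr a, Inr b} \<inter> {Inr c, Inr d} = Inr ` ({a, b} \<inter> {c, d})"
    "{Inl a, Inl b} \<inter> {Inr c, Inr d} = {}" "{Inr c, Inr d} \<inter> {Inl a, Inl b} = {}"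
    "{Inl p, Inr p} \<inter> {Inl a, Inl b} = Inl ` ({p} \<inter> {a, b})" "{Inl a, Inl b} \<inter> {Inl p, Inr p} = Inl ` ({p} \<inter> {a, b})"
    "{Inl p, Inr p} \<inter> {Inr a, Inr b} = Inr ` ({p} \<inter> {a, b})" "{Inr a, Inr b} \<inter> {Inl p, Inr p} = Inr ` ({p} \<inter> {a, b})"
    for a b c d p :: complex by auto
  have meet: "img e \<inter> img e' = pos ` (e \<inter> e')" if e: "e \<in> edges ?G" "e' \<in> edges ?G" "e \<noteq> e'" for e e'
    using edge_cases[OF e(1)] edge_cases[OF e(2)]
  proof (elim disjE exE conjE)
    fix a b c d assume "e = {Inl a, Inl b}" "{a, b} \<in> edges T" "e' = {Inl c, Inl d}" "{c, d} \<in> edges T"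
    then show ?thesis using e(3) TT[of a b c d] by (simp only: img set_eqs image_image pos) auto
  next
    fix a b c d assume "e = {Inr a, Inr b}" "{a, b} \<in> edges R" "e' = {Inr c, Inr d}" "{c, d} \<in> edges R"
    then show ?thesis using e(3) RR[of a b c d] by (simp only: img set_eqs image_image pos) auto
  next
    fix a b c d assume "e = {Inl a, Inl b}" "{a, b} \<in> edges T" "e' = {Inr c, Inr d}" "{c, d} \<in> edges R"
    then show ?thesis using TR[of a b c d] by (simp only: img set_eqs image_empty)
  next
    fix a b c d assume "e = {Inr c, Inr d}" "{c, d} \<in> edges R" "e' = {Inl a, Inl b}" "{a, b} \<in> edges T"
    then show ?thesis using TR[of a b c d] by (simp only: img set_eqs image_empty Int_commute)
  next
    fix a b p assume "e = {Inl p, Inr p}" "p \<in> corners P" "e' = {Inl a, Inl b}" "{a, b} \<in> edges T"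
    then show ?thesis using CT[of p a b] by (simp only: img set_eqs image_image pos)
  next
    fix a b p assume "e' = {Inl p, Inr p}" "p \<in> corners P" "e = {Inl a, Inl b}" "{a, b} \<in> edges T"
    then show ?thesis using CT[of p a b] Int_commute[of "radial p"] by (simp only: img set_eqs image_image pos)
  next
    fix a b p assume "e = {Inl p, Inr p}" "p \<in> corners P" "e' = {Inr a, Inr b}" "{a, b} \<in> edges R"
    then show ?thesis using CR[of p a b] by (simp only: img set_eqs image_image pos)
  next
    fix a b p assume "e' = {Inl p, Inr p}" "p \<in> corners P" "e = {Inr a, Inr b}" "{a, b} \<in> edges R"
    then show ?thesis using CR[of p a b] Int_commute[of "radial p"] by (simp only: img set_eqs image_image pos)
  next
    fix p q assume pq: "e = {Inl p, Inr p}" "p \<in> corners P" "e' = {Inl q, Inr q}" "q \<in> corners P"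
    then have "p \<noteq> q" using e(3) by auto
    then have "e \<inter> e' = {}" using pq by auto
    then show ?thesis using CC[OF pq(2,4) \<open>p \<noteq> q\<close>] unfolding pq(1,3) img by simp
  qed
  have "inj_on pos (verts ?G)"
    unfolding vG
  proof (rule inj_onI)
    fix x y assume xy: "x \<in> Inl ` verts T \<union> Inr ` verts R" "y \<in> Inl ` verts T \<union> Inr ` verts R" and eq: "pos x = pos y"
    from xy consider (ll) u v where "x = Inl u" "y = Inl v" "u \<in> verts T" "v \<in> verts T"
      | (lr) u v where "x = Inl u" "y = Inr v" "u \<in> verts T" "v \<in> verts R"
      | (rl) u v where "x = Inr u" "y = Inl v" "u \<in> verts R" "v \<in> verts T"
      | (rr) u v where "x = Inr u" "y = Inr v" "u \<in> verts R" "v \<in> verts R"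
      by blast
    then show "x = y"
    proof cases
      case (ll u v)
      then show ?thesis using inj_onD[OF h(2) _ vT vT, of u v] eq by simp
    next
      case (lr u v)
      then show ?thesis using hpsi[OF vT vR, of u v] eq by simp
    next
      case (rl u v)
      then show ?thesis using hpsi[OF vT vR, of v u] eq by simp
    next
      case (rr u v)
      then show ?thesis using inj_onD[OF \<psi>(2) _ vR vR, of u v] eq by simp
    qed
  qed
  moreover obtain \<gamma> where "\<forall>e\<in>edges ?G. arc (\<gamma> e) \<and> {pathstart (\<gamma> e), pathfinish (\<gamma> e)} = pos ` e \<and> path_image (\<gamma> e) = img e"
    using arcs by metis
  ultimately show ?thesis
    unfolding planar_def using simple meet_verts meet
    by (intro conjI exI[of _ pos] exI[of _ \<gamma>]) simp_all
qed

section \<open>Gluing two dual tilings\<close>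

lemma image_reflection_hull:
  "convex hull (point_reflection c ` S) = point_reflection c ` (convex hull S)"
proof -
  have "point_reflection c = (\<lambda>x. 2 * c + (-1) *\<^sub>R x)" by (auto simp: point_reflection_def)
  then show ?thesis by (simp only: convex_hull_affinity)
qed

lemma drawn_central_reflection:
  "drawn (central_reflection P T) = point_reflection (center P) ` drawn T"
  by (auto simp: drawn_def central_reflection_def image_reflection_hull image_Un image_UN)

lemma planar_drawing_central_reflection:
  assumes "planar_drawing T"
  shows "planar_drawing (central_reflection P T)"
proof -
  let ?r = "point_reflection (center P)"
  have inj: "inj ?r" by (rule inj_point_reflection)
  have "simple_graph (central_reflection P T)"
    unfolding simple_graph_def
  proof
    fix e assume "e \<in> edges (central_reflection P T)"
    then obtain e' where e': "e' \<in> edges T" "e = ?r ` e'" by (auto simp: central_reflection_def)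
    obtain u v where uv: "e' = {u, v}" "u \<in> verts T" "v \<in> verts T" "u \<noteq> v"
      using simple_edge[OF planar_drawing_simple[OF assms] e'(1)] by metis
    then have "?r u \<noteq> ?r v" using injD[OF inj] by blast
    then show "\<exists>u\<in>verts (central_reflection P T). \<exists>v\<in>verts (central_reflection P T). u \<noteq> v \<and> e = {u, v}"
      using uv e'(2) by (intro bexI[of _ "?r u"] bexI[of _ "?r v"]) (auto simp: central_reflection_def)
  qed
  moreover have "finite (verts (central_reflection P T))"
    using assms by (simp add: planar_drawing_def central_reflection_def)
  moreover have "convex hull (?r ` e) \<inter> ?r ` verts T = ?r ` e" if "e \<in> edges T" for e
    using assms that by (simp add: image_reflection_hull image_Int[OF inj, symmetric] planar_drawing_def)
  moreover have "convex hull (?r ` e) \<inter> convex hull (?r ` e') = ?r ` e \<inter> ?r ` e'"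
    if "e \<in> edges T" "e' \<in> edges T" "?r ` e \<noteq> ?r ` e'" for e e'
  proof -
    have "e \<noteq> e'" using that by auto
    then show ?thesis
      using assms that by (simp add: image_reflection_hull image_Int[OF inj, symmetric] planar_drawing_def)
  qed
  ultimately show ?thesis by (auto simp: planar_drawing_def central_reflection_def)
qed

lemma (in glued) antipode_corner_iff: "C.antipode p \<in> corners P \<longleftrightarrow> p \<in> corners P"
  using C.antipode_corner[of p] C.antipode_corner[of "C.antipode p"] by auto

lemma (in glued) vertex_degree_Inl:
  "vertex_degree G (Inl v) = vertex_degree T v + of_bool (v \<in> corners P)"
proof -
  have eq: "{e \<in> edges G. Inl v \<in> e} = (\<lambda>e. Inl ` e) ` {e \<in> edges T. v \<in> e} \<union>
    (if v \<in> corners P then {{Inl v, Inr v}} else {})"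
    unfolding edges_G by (auto split: if_splits)
  have "inj (\<lambda>e :: complex set. Inl ` e :: (complex + complex) set)"
    by (intro injI) (metis inj_Inl inj_image_eq_iff)
  then have c: "card ((\<lambda>e. Inl ` e :: (complex + complex) set) ` {e \<in> edges T. v \<in> e}) = vertex_degree T v"
    unfolding vertex_degree_def by (intro card_image) (rule inj_on_subset, auto)
  have "{Inl v, Inr v} \<notin> (\<lambda>e. Inl ` e) ` {e \<in> edges T. v \<in> e}" by auto
  moreover have "finite ((\<lambda>e. Inl ` e :: (complex + complex) set) ` {e \<in> edges T. v \<in> e})" using A.finite_edges by simp
  ultimately show ?thesis unfolding vertex_degree_def[of G] eq using c by simp
qed

lemma (in glued) vertex_degree_Inr:
  "vertex_degree G (Inr (C.antipode w)) = vertex_degree T' w + of_bool (w \<in> corners P)"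
proof -
  let ?F = "\<lambda>e. Inr ` C.antipode ` e :: (complex + complex) set"
  have inj: "inj ?F"
    by (intro injI) (metis inj_Inr inj_point_reflection inj_image_eq_iff)
  have mem: "Inr (C.antipode w) \<in> ?F e \<longleftrightarrow> w \<in> e" for e
    using inj_image_mem_iff[OF inj_point_reflection] by auto
  have eq: "{e \<in> edges G. Inr (C.antipode w) \<in> e} = ?F ` {e \<in> edges T'. w \<in> e} \<union>
    (if w \<in> corners P then {{Inl (C.antipode w), Inr (C.antipode w)}} else {})"
  proof -
    have k1: "{e \<in> {{Inl p, Inr p} | p. p \<in> corners P}. Inr (C.antipode w) \<in> e} =
      (if w \<in> corners P then {{Inl (C.antipode w), Inr (C.antipode w)}} else {})"
      using antipode_corner_iff[of w] by auto
    have k2: "{e \<in> (\<lambda>e. Inl ` e) ` edges T. Inr (C.antipode w) \<in> e} = {}" by auto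
    have k3: "{e \<in> ?F ` edges T'. Inr (C.antipode w) \<in> e} = ?F ` {e \<in> edges T'. w \<in> e}"
      using mem by blast
    have k4: "{e \<in> edges G. Inr (C.antipode w) \<in> e} = {e \<in> (\<lambda>e. Inl ` e) ` edges T. Inr (C.antipode w) \<in> e} \<union>
      {e \<in> ?F ` edges T'. Inr (C.antipode w) \<in> e} \<union> {e \<in> {{Inl p, Inr p} | p. p \<in> corners P}. Inr (C.antipode w) \<in> e}"
      unfolding edges_G by blast
    show ?thesis by (simp only: k4 k1 k2 k3 Un_empty_left)
  qed
  have c: "card (?F ` {e \<in> edges T'. w \<in> e}) = vertex_degree T' w"
    unfolding vertex_degree_def by (intro card_image inj_on_subset[OF inj]) simp
  have "{Inl (C.antipode w), Inr (C.antipode w)} \<notin> ?F ` {e \<in> edges T'. w \<in> e}" by auto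
  moreover have "finite (?F ` {e \<in> edges T'. w \<in> e})" using B.finite_edges by simp
  ultimately show ?thesis unfolding vertex_degree_def[of G] eq using c by simp
qed

lemma (in glued) planar_G: "planar G"
proof -
  obtain Q where Q: "tile T' Q" using B.tile_exists by blast
  obtain i where i: "i \<in> interior Q" using B.tile_props(3)[OF Q] by blast
  then have "i \<in> interior P" using B.tile_props(6)[OF Q] interior_mono by blast
  then obtain e where e: "e > 0" "ball i e \<subseteq> P" by (meson mem_interior)
  have "ball (C.antipode i) e \<subseteq> P"
  proof
    fix y assume "y \<in> ball (C.antipode i) e"
    then have "C.antipode y \<in> ball i e"
      by (simp add: point_reflection_def dist_norm norm_minus_commute algebra_simps)
    then have "C.antipode (C.antipode y) \<in> P" using e C.antipode_P by blast
    then show "y \<in> P" by simp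
  qed
  then have z: "C.antipode i \<in> interior P" using e by (meson mem_interior)
  have "i \<notin> drawn T'" using i B.tile_props(4)[OF Q] by blast
  then have z': "C.antipode i \<notin> drawn (central_reflection P T')"
    unfolding drawn_central_reflection using inj_image_mem_iff[OF inj_point_reflection] by blast
  have "drawn (central_reflection P T') \<subseteq> P"
    unfolding drawn_central_reflection using B.drawn_subset_P C.antipode_P by blast
  moreover have "corners P \<subseteq> verts (central_reflection P T')"
  proof
    fix p assume "p \<in> corners P"
    then have "C.antipode p \<in> verts T'" using C.antipode_corner B.corners_P_verts by blast
    then have "C.antipode (C.antipode p) \<in> C.antipode ` verts T'" by (rule imageI)
    then show "p \<in> verts (central_reflection P T')" by (simp add: central_reflection_def)
  qed
  ultimately show ?thesis unfolding G_def
    using planar_join[OF C.P_convex C.P_compact z z' A.planar_drawing A.drawn_subset_P A.corners_P_verts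
        planar_drawing_central_reflection[OF B.planar_drawing]] simple_G[unfolded G_def] by blast
qed

theorem lemma3:
  fixes P :: "complex set" and T T' :: "complex ugraph"
    and A A' :: "(real^3^3) set set" and G :: "(complex + complex) ugraph"
  assumes "zonotopal_tiling P T" and "zonotopal_tiling P T'"
    and "pseudoline_arrangement A" and "simplicial A" and "line_at_infinity \<in> A"
    and "dual_tiling T A"
    and "pseudoline_arrangement A'" and "simplicial A'" and "line_at_infinity \<in> A'"
    and "dual_tiling T' A'"
    and "zonotopal_tiling P (overlay T T')"
    and G_def: "G = join_at_corners P T (central_reflection P T')"
  shows "planar G \<and> cubic G \<and> partial_cube G"
proof -
  interpret W: tiling P "overlay T T'" by unfold_locales fact
  obtain U N where pot: "potential (overlay T T') U N" using W.potential_exists by blast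
  have "potential T U N" "potential T' U N"
    by (rule potential_subgraph[OF pot], simp add: overlay_def)+
  then interpret J: glued P T T' U N
    using assms(1,2,11) pot by unfold_locales
  have G: "G = J.G" by (simp add: G_def J.G_def)
  obtain f g where "dual_to_arrangement P T A f g"
    using dual_tiling_locale[OF assms(1,3,4,5,6)] by blast
  then have degT: "vertex_degree T v = (if v \<in> corners P then 2 else 3)" if "v \<in> verts T" for v
    using dual_to_arrangement.vertex_degree_dual that by blast
  obtain f' g' where "dual_to_arrangement P T' A' f' g'"
    using dual_tiling_locale[OF assms(2,7,8,9,10)] by blast
  then have degT': "vertex_degree T' v = (if v \<in> corners P then 2 else 3)" if "v \<in> verts T'" for v
    using dual_to_arrangement.vertex_degree_dual that by blast
  have "vertex_degree J.G x = 3" if x: "x \<in> verts J.G" for x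
  proof -
    from x consider v where "x = Inl v" "v \<in> verts T" | w where "x = Inr (J.C.antipode w)" "w \<in> verts T'"
      unfolding J.verts_G by blast
    then show ?thesis
    proof cases
      case 1 then show ?thesis using J.vertex_degree_Inl degT by simp
    next
      case 2 then show ?thesis using J.vertex_degree_Inr degT' by simp
    qed
  qed
  then have "cubic J.G" using J.simple_G by (simp add: cubic_def)
  then show ?thesis unfolding G using J.planar_G J.partial_cube_G by blast
qed

end
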